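(* Let $a<-1$ and let $f$ and $\Omega$ be as in the context. The saddle periodic points of $f$ are a dense subset of $\Omega\cap\mathbf R^2$, and $\Omega\cap\mathbf R^2$ is a totally disconnected and perfect subset of $\mathbf R^2$.
   Context: Fix a real number $a<-1$. Let $\overline{\mathbf R^2}=(\mathbf R\cup\{\infty\})\times(\mathbf R\cup\{\infty\})$, with $+\infty$ and $-\infty$ identified to $\infty$ in each factor. The birational map $f(x,y)=\left(y\frac{x+a}{x-1},\,x+a-1\right)$, with inverse $f^{-1}(x,y)=\left(y+1-a,\,x\frac{y-a}{y+1}\right)$, extends continuously to $\overline{\mathbf R^2}\setminus I(f)$, resp. $\overline{\mathbf R^2}\setminus I(f^{-1})$, where $I(f)=\{(1,0),(-a,\infty)\}$ and $I(f^{-1})=\{(0,-1),(\infty,a)\}$. Rectangles: $R_0=[1,\infty]\times[-\infty,-1]$ and $R_1=[-\infty,0]\times[0,\infty]$. Words: $\Sigma\subset\{0,1\}^{\mathbf Z}$ is the set of bi-infinite sequences in which the block $11$ does not occur. For a finite block $w=w_{-n}\dots w_m$ ($n,m\ge0$) occurring in an element of $\Sigma$, $R(w)=\overline{\bigcap_{k=-n}^{m}f^{-k}(\operatorname{int}R_{w_k})}$ (images under iterates of $f^{\pm1}$; no point of $\operatorname{int}R_0\cup\operatorname{int}R_1$ is indeterminate for any iterate). For $w\in\Sigma$, $R(w)=\bigcap_{n,m\ge0}R(w_{-n}\dots w_m)$. Set $\Omega=\bigcup_{w\in\Sigma}R(w)$. A saddle periodic point is a point $p\in\mathbf R^2$ with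 $f^n(p)=p$ for some $n\ge1$ such that $Df^n_p$ has one eigenvalue of modulus $>1$ and one of modulus $<1$. *)

theory Defs
  imports "HOL-Analysis.Analysis" "Jordan_Normal_Form.Char_Poly"
begin

(* The compactified line is the one-point compactification of the reals: None is the point
   infinity (+infinity and -infinity identified) and Some t is the real number t. *)

type_synonym cline = "real option"
type_synonym cplane = "cline \<times> cline"

definition cline_top :: "cline topology" where
  "cline_top = Alexandroff_compactification euclideanreal"

definition cplane_top :: "cplane topology" where
  "cplane_top = prod_topology cline_top cline_top"

definition emb :: "real \<times> real \<Rightarrow> cplane" where
  "emb = map_prod Some Some"

(* Left inverse of emb; its value at points at infinity is irrelevant. *)
definition fin :: "cplane \<Rightarrow> real \<times> real" where
  "fin = map_prod the the"


(* The continuous extension of t \<mapsto> t + c. *)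
definition ctranslate :: "real \<Rightarrow> cline \<Rightarrow> cline" where
  "ctranslate c = map_option (\<lambda>t. t + c)"

(* The continuous extension of t \<mapsto> (t - p) / (t - q), used for p \<noteq> q only. *)
definition cmobius :: "real \<Rightarrow> real \<Rightarrow> cline \<Rightarrow> cline" where
  "cmobius p q s = (case s of None \<Rightarrow> Some 1
     | Some t \<Rightarrow> if t = q then None else Some ((t - p) / (t - q)))"

(* The continuous extension of multiplication. It exists away from the two pairs (0, infinity) and
   (infinity, 0), where the value None carries no meaning. *)
definition cmult :: "cline \<Rightarrow> cline \<Rightarrow> cline" where
  "cmult s t = (case (s, t) of (Some u, Some v) \<Rightarrow> Some (u * v) | _ \<Rightarrow> None)"

(* The extensions of f(x,y) = (y (x+a)/(x-1), x+a-1) and of its inverse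
   (x,y) \<mapsto> (y+1-a, x (y-a)/(y+1)). For a \<noteq> -1 the meaningless products arise exactly on the
   indeterminacy sets below; the values there are placeholders. *)
definition fmap :: "real \<Rightarrow> cplane \<Rightarrow> cplane" where
  "fmap a = (\<lambda>(x, y). (cmult y (cmobius (- a) 1 x), ctranslate (a - 1) x))"

definition finv :: "real \<Rightarrow> cplane \<Rightarrow> cplane" where
  "finv a = (\<lambda>(x, y). (ctranslate (1 - a) y, cmult x (cmobius a (- 1) y)))"

definition indet :: "real \<Rightarrow> cplane set" where
  "indet a = {(Some 1, Some 0), (Some (- a), None)}"

definition indet_inv :: "real \<Rightarrow> cplane set" where
  "indet_inv a = {(Some 0, Some (- 1)), (None, Some a)}"

definition fiter :: "real \<Rightarrow> int \<Rightarrow> cplane \<Rightarrow> cplane" where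
  "fiter a k = (if 0 \<le> k then fmap a ^^ nat k else finv a ^^ nat (- k))"


(* rect 0 is [1,infinity] x [-infinity,-1] and rect 1 is [-infinity,0] x [0,infinity]. *)
definition rect :: "nat \<Rightarrow> cplane set" where
  "rect j = (if j = 0 then insert None (Some ` {1..}) \<times> insert None (Some ` {..- 1})
             else insert None (Some ` {..0}) \<times> insert None (Some ` {0..}))"

definition Sig :: "(int \<Rightarrow> nat) set" where
  "Sig = {w. (\<forall>k. w k \<in> {0, 1}) \<and> (\<nexists>k. w k = 1 \<and> w (k + 1) = 1)}"

(* R(w_{-n} ... w_m); only the entries of w with index in {-n..m} matter. *)
definition Rblock :: "real \<Rightarrow> (int \<Rightarrow> nat) \<Rightarrow> nat \<Rightarrow> nat \<Rightarrow> cplane set" where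
  "Rblock a w n m = cplane_top closure_of
     (\<Inter>k\<in>{- int n..int m}. fiter a (- k) ` (cplane_top interior_of rect (w k)))"

definition Rword :: "real \<Rightarrow> (int \<Rightarrow> nat) \<Rightarrow> cplane set" where
  "Rword a w = (\<Inter>n. \<Inter>m. Rblock a w n m)"

definition Omega :: "real \<Rightarrow> cplane set" where
  "Omega a = (\<Union>w\<in>Sig. Rword a w)"

definition Omega_plane :: "real \<Rightarrow> (real \<times> real) set" where
  "Omega_plane a = emb -` Omega a"


(* The standard matrix of a linear map of the plane, with complex entries so that all its
   eigenvalues are available. *)
definition cmatrix :: "(real \<times> real \<Rightarrow> real \<times> real) \<Rightarrow> complex mat" where
  "cmatrix D = mat_of_rows_list 2
     [[of_real (fst (D (1, 0))), of_real (fst (D (0, 1)))],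
      [of_real (snd (D (1, 0))), of_real (snd (D (0, 1)))]]"

(* The first condition says that the n-th iterate is defined at p: no point of the orbit segment is
   a point of indeterminacy. It is then continuous at p, hence finite near p, and its expression in
   the coordinates of the plane is fin \<circ> fmap a ^^ n \<circ> emb. *)
definition saddle_periodic :: "real \<Rightarrow> real \<times> real \<Rightarrow> bool" where
  "saddle_periodic a p \<longleftrightarrow> (\<exists>n\<ge>1.
     (\<forall>i<n. (fmap a ^^ i) (emb p) \<notin> indet a) \<and>
     (fmap a ^^ n) (emb p) = emb p \<and>
     (\<exists>D l m. ((fin \<circ> (fmap a ^^ n) \<circ> emb) has_derivative D) (at p) \<and>
        eigenvalue (cmatrix D) l \<and> eigenvalue (cmatrix D) m \<and> cmod l > 1 \<and> cmod m < 1))"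


definition totally_disconnected :: "'a::topological_space set \<Rightarrow> bool" where
  "totally_disconnected S \<longleftrightarrow> (\<forall>T. T \<subseteq> S \<and> connected T \<longrightarrow> (\<exists>x. T \<subseteq> {x}))"

definition perfect :: "'a::topological_space set \<Rightarrow> bool" where
  "perfect S \<longleftrightarrow> closed S \<and> (\<forall>x\<in>S. x islimpt S)"

end

theory Submission
  imports Defs "HOL-Library.Diagonal_Subsequence"
begin

text \<open>In nonnegative coordinates u, v on the two rectangles, f becomes an algebraic relation between
  consecutive points that is reversible: exchanging u and v reverses time. Two orbits with the same
  itinerary separate along an invariant cone in the differences of ln (1 + u) and ln (1 + v), which
  gives uniqueness and Lipschitz dependence in the boundary value problem that prescribes v at the
  start and u at the end. Intermediate values solve this problem, and Brouwer's theorem then closes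
  the orbits up: every admissible block lies in a periodic itinerary that is realised.

  The word of a finite point of Omega contains the block 00 both in the future and in the past,
  because an orbit starting at a finite point cannot alternate for too long. The expansion of the
  cone then forces all orbit segments following a long block of the word to be close to each
  other at time 0. So a finite point is determined by its word, and conversely; this gives the
  density of periodic points, total disconnectedness and perfectness. The derivative along a
  periodic orbit is, up to sign, a product of nonnegative matrices, and f preserves the area form
  dx dy / (y - x + 1); so the product has determinant 1 and trace larger than 2.\<close>

text \<open>The obstacle is the behaviour at infinity. Along an alternating word a point with u
  infinite in the state 0 passes to a point with v infinite in the state 1 and back, and its finite
  coordinate is merely translated by b + 2. So there is no uniform expansion: the gain guaranteed by
  a block 010 is a factor 1 + 1 / L with L a bound for u, and it fades as u grows. Only a block 00
  has a uniform factor, 1 + 1 / b, because v' = b - u is nonnegative there. Logarithms suit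
  relations between products. The difference of ln (1 + u) stays finite on the boundary u = 0 and is
  smaller than that of ln u; the gap between the two is the source of the expansion. A point of R(w)
  is only a limit of time-0 points of interior orbits, and these may run off to infinity or into a
  point of indeterminacy in the limit. Therefore the estimates concern finite orbit segments, are
  uniform in the segment, and are passed to the limit at time 0.\<close>

text \<open>The point of the state 0 (the rectangle R0) with coordinates u, v is (1 + u, - 1 - v), that of the
  state 1 (the rectangle R1) is (- u, v). With b = - 1 - a, the following relation says that f maps
  the point u, v of the state s to the point u', v' of the state s'.\<close>

definition step :: "real \<Rightarrow> nat \<Rightarrow> nat \<Rightarrow> real \<Rightarrow> real \<Rightarrow> real \<Rightarrow> real \<Rightarrow> bool" where
  "step b s s' u v u' v' \<longleftrightarrow>
     (if s = 0 then
        if s' = 0 then v' = b - u \<and> (1 + u') * u = (1 + v) * v'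
        else u = v' + b + 1 \<and> u' * u = (1 + v) * (1 + v')
      else s' = 0 \<and> v' = u + b + 1 \<and> (1 + u') * (1 + u) = v * v')"

section \<open>Orbit segments, time reversal and the block structure of words\<close>

lemma step_rev: "step b s s' u v u' v' = step b s' s v' u' v u"
  by (auto simp: step_def algebra_simps)

text \<open>Coordinates are allowed to vanish, so boundary points of the rectangles are included and
  the intermediate value and fixed point arguments can work on closed sets. Values outside {i..j}
  are arbitrary, which makes restricting and prepending easy.\<close>

definition orb :: "real \<Rightarrow> (int \<Rightarrow> nat) \<Rightarrow> int \<Rightarrow> int \<Rightarrow> (int \<Rightarrow> real) \<Rightarrow> (int \<Rightarrow> real) \<Rightarrow> bool" where
  "orb b w i j u v \<longleftrightarrow> (\<forall>k\<in>{i..j}. 0 \<le> u k \<and> 0 \<le> v k) \<and>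
     (\<forall>k\<in>{i..<j}. step b (w k) (w (k+1)) (u k) (v k) (u (k+1)) (v (k+1)))"

lemma orb_sub: "orb b w i j u v \<Longrightarrow> i \<le> i' \<Longrightarrow> j' \<le> j \<Longrightarrow> orb b w i' j' u v"
  by (auto simp: orb_def)

lemma orbD:
  assumes "orb b w i j u v" "i \<le> k" "k \<le> j"
  shows "0 \<le> u k" "0 \<le> v k"
  using assms by (auto simp: orb_def)

lemma orb_step:
  "orb b w i j u v \<Longrightarrow> i \<le> k \<Longrightarrow> k < j \<Longrightarrow> step b (w k) (w (k+1)) (u k) (v k) (u (k+1)) (v (k+1))"
  by (auto simp: orb_def)

text \<open>Serves to recentre at time 1 when the letter at time 0 is not 0.\<close>

lemma orb_shift:
  "orb b w (i + d) (j + d) u v \<longleftrightarrow> orb b (\<lambda>k. w (k + d)) i j (\<lambda>k. u (k + d)) (\<lambda>k. v (k + d))"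
proof -
  have 1: "(\<forall>k\<in>{i + d..j + d}. Q k) \<longleftrightarrow> (\<forall>k\<in>{i..j}. Q (k + d))"
    and 2: "(\<forall>k\<in>{i + d..<j + d}. Q k) \<longleftrightarrow> (\<forall>k\<in>{i..<j}. Q (k + d))" for Q :: "int \<Rightarrow> bool"
    unfolding image_add_int_atLeastLessThan image_add_atLeastAtMost'[symmetric]
    by (auto simp: Ball_def) (metis add_le_cancel_right add_less_cancel_right diff_add_cancel)+
  show ?thesis
    unfolding orb_def 1 2 by (simp add: algebra_simps)
qed

text \<open>Through this lemma every estimate of u by the future becomes one of v by the
  past.\<close>

lemma orb_rev:
  assumes "orb b w i j u v"
  shows "orb b (\<lambda>k. w (- k)) (- j) (- i) (\<lambda>k. v (- k)) (\<lambda>k. u (- k))"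
proof -
  have "step b (w (- k)) (w (- (k + 1))) (v (- k)) (u (- k)) (v (- (k + 1))) (u (- (k + 1)))"
    if "- j \<le> k" "k < - i" for k
  proof -
    have "step b (w (- k - 1)) (w (- k)) (u (- k - 1)) (v (- k - 1)) (u (- k)) (v (- k))"
      using orb_step[OF assms, of "- k - 1"] that by simp
    then show ?thesis unfolding minus_add_distrib step_rev[of b "w (- k)"] by simp
  qed
  then show ?thesis using assms by (auto simp: orb_def)
qed

text \<open>\<open>step\<close> treats every nonzero letter as the state 1, so the condition makes
  sense for all words of natural numbers. The restriction to the letters 0 and 1 matters later, when
  words are compared.\<close>

definition no11 :: "(int \<Rightarrow> nat) \<Rightarrow> bool" where
  "no11 w \<longleftrightarrow> (\<forall>k. w k \<noteq> 0 \<longrightarrow> w (k + 1) = 0)"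

lemma no11_rev: "no11 w \<Longrightarrow> no11 (\<lambda>k. w (- k))"
  unfolding no11_def
proof (intro allI impI)
  fix k assume "\<forall>k. w k \<noteq> 0 \<longrightarrow> w (k + 1) = 0" "w (- k) \<noteq> 0"
  moreover have "- (k + 1) + 1 = - k" by simp
  ultimately show "w (- (k + 1)) = 0" by metis
qed

lemma no11_shift: "no11 w \<Longrightarrow> no11 (\<lambda>k. w (k + d))"
  unfolding no11_def by (metis add.assoc add.commute)

text \<open>A word is cut at its letters 0 into blocks 00 and 010; the induction goes back block by block.\<close>

lemma backward_block_induct [consumes 4, case_names base step00 step010]:
  fixes i j :: int
  assumes "no11 w" "w j = 0" "w i = 0" "i \<le> j"
    and base: "P j"
    and s00: "\<And>i. i < j \<Longrightarrow> w i = 0 \<Longrightarrow> w (i + 1) = 0 \<Longrightarrow> P (i + 1) \<Longrightarrow> P i"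
    and s010: "\<And>i. i + 2 \<le> j \<Longrightarrow> w i = 0 \<Longrightarrow> w (i + 1) \<noteq> 0 \<Longrightarrow> w (i + 2) = 0 \<Longrightarrow> P (i + 2) \<Longrightarrow> P i"
  shows "P i"
  using assms(3,4)
proof (induction "nat (j - i)" arbitrary: i rule: less_induct)
  case less
  show ?case
  proof (cases "i = j")
    case False
    show ?thesis
    proof (cases "w (i + 1) = 0")
      case True
      have "P (i + 1)" by (rule less.hyps) (use True less.prems False in auto)
      then show ?thesis by (rule s00[rotated -1]) (use True less.prems False in auto)
    next
      case F: False
      have "w (i + 1 + 1) = 0" using \<open>no11 w\<close> F unfolding no11_def by blast
      then have "w (i + 2) = 0" by (simp add: add.assoc)
      have "i + 1 \<noteq> j" using F \<open>w j = 0\<close> by auto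
      then have ij: "i + 2 \<le> j" using less.prems False by simp
      have "P (i + 2)" by (rule less.hyps) (use \<open>w (i + 2) = 0\<close> ij in auto)
      then show ?thesis by (rule s010[rotated -1]) (use \<open>w (i + 2) = 0\<close> ij F less.prems in auto)
    qed
  qed (simp add: base)
qed

lemma orb_step00:
  assumes "orb b w i j u v" "i < j" "w i = 0" "w (i + 1) = 0"
  shows "v (i+1) = b - u i" "(1 + u (i+1)) * u i = (1 + v i) * v (i+1)"
    "0 \<le> u i" "0 \<le> v i" "0 \<le> u (i+1)" "0 \<le> v (i+1)"
  using orb_step[OF assms(1), of i] orbD[OF assms(1), of i] orbD[OF assms(1), of "i+1"] assms
  by (auto simp: step_def)

lemma orb_step010:
  assumes "orb b w i j u v" "i + 2 \<le> j" "w i = 0" "w (i + 1) \<noteq> 0"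
  shows "u i = v (i+1) + b + 1" "u (i+1) * u i = (1 + v i) * (1 + v (i+1))"
    "v (i+2) = u (i+1) + b + 1" "(1 + u (i+2)) * (1 + u (i+1)) = v (i+1) * v (i+2)"
    "0 \<le> u i" "0 \<le> v i" "0 \<le> u (i+1)" "0 \<le> v (i+1)" "0 \<le> u (i+2)" "0 \<le> v (i+2)"
proof -
  have e: "i + 1 + 1 = i + 2" by simp
  show "u i = v (i+1) + b + 1" "u (i+1) * u i = (1 + v i) * (1 + v (i+1))"
    "v (i+2) = u (i+1) + b + 1" "(1 + u (i+2)) * (1 + u (i+1)) = v (i+1) * v (i+2)"
    using orb_step[OF assms(1), of i] orb_step[OF assms(1), of "i+1", unfolded e] assms
    by (auto simp: step_def)
qed (use orbD[OF assms(1), of i] orbD[OF assms(1), of "i+1"] orbD[OF assms(1), of "i+2"] assms in auto)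

subsection \<open>The invariant cone of pairs of orbits\<close>

lemma ln_diff_add_le:
  fixes u p c :: real
  assumes "0 < u" "u \<le> p" "0 \<le> c"
  shows "ln (c + p) - ln (c + u) \<le> ln p - ln u"
proof -
  have "(c + p) / (c + u) \<le> p / u"
    using assms mult_right_mono[of u p c] by (simp add: field_simps)
  then have "ln ((c + p) / (c + u)) \<le> ln (p / u)"
    using assms by (subst ln_le_cancel_iff) (auto intro!: divide_pos_pos)
  then show ?thesis using assms by (simp add: ln_div)
qed

text \<open>The quotient d ln x / d ln (1 + x) is 1 + 1 / x, which is at least 1 + 1 / L on [u, p].
  The quantitative gain in both cone lemmas comes from here.\<close>

lemma ln_diff_gain:
  fixes u p L :: real
  assumes "0 < u" "u \<le> p" "p \<le> L"
  shows "(ln (1 + p) - ln (1 + u)) * (1 + 1 / L) \<le> ln p - ln u"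
proof -
  let ?f = "\<lambda>x. ln x - (1 + 1 / L) * ln (1 + x)"
  have "?f u \<le> ?f p"
  proof (rule DERIV_nonneg_imp_nondecreasing[OF assms(2)])
    fix x assume x: "u \<le> x" "x \<le> p"
    have "(1 + 1 / L) / (1 + x) \<le> 1 / x"
      using x assms by (simp add: divide_simps) (simp add: algebra_simps)
    then show "\<exists>y. (?f has_real_derivative y) (at x) \<and> 0 \<le> y"
      using x assms
      by (intro exI[of _ "1 / x - (1 + 1 / L) * (1 / (1 + x))"] conjI)
        (auto intro!: derivative_eq_intros)
  qed
  then show ?thesis by (simp add: algebra_simps)
qed

text \<open>The order matters: p is ahead of u. With X and Y the differences of ln (1 + u) and ln (1
  + v), the number n is a lower bound for X and for X - Y. The bound on Y is one-sided, since the
  next block needs no more; n measures the size and is what grows.\<close>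

definition cone :: "real \<Rightarrow> real \<Rightarrow> real \<Rightarrow> real \<Rightarrow> real \<Rightarrow> bool" where
  "cone n u v p q \<longleftrightarrow> 0 < ln (1 + p) - ln (1 + u) \<and> n \<le> ln (1 + p) - ln (1 + u) \<and>
     n \<le> (ln (1 + p) - ln (1 + u)) - (ln (1 + q) - ln (1 + v))"

lemma cone_mono: "cone n u v p q \<Longrightarrow> m \<le> n \<Longrightarrow> cone m u v p q"
  by (auto simp: cone_def)

text \<open>Since v' = b - u is decreasing, the order of the two points is reversed, which is why u'
  and p' change places in the conclusion. Taking logarithms of the product relation, the new
  difference of ln (1 + u) is X' = Y - (ln p - ln u) - (ln v' - ln q'). Here ln p - ln u is at least
  X + X / L, and the last bracket pays for the new difference of ln (1 + v).\<close>

lemma cone_step00: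
  fixes b :: real
  assumes b: "0 < b" and nn: "0 \<le> u" "0 \<le> v" "0 \<le> u'" "0 \<le> v'" "0 \<le> p" "0 \<le> q" "0 \<le> p'" "0 \<le> q'"
    and st: "v' = b - u" "(1 + u') * u = (1 + v) * v'"
    and st': "q' = b - p" "(1 + p') * p = (1 + q) * q'"
    and c: "cone n u v p q" and L: "0 \<le> n" "u \<le> L" "p \<le> L"
  shows "cone (n + (ln (1 + p) - ln (1 + u)) / L) p' q' u' v'"
proof -
  \<comment> \<open>By the product relation x and y' vanish together, but they add up to b >
    0.\<close>
  have pos: "0 < x \<and> 0 < y'"
    if "y' = b - x" "(1 + x') * x = (1 + y) * y'" "0 \<le> x" "0 \<le> y" "0 \<le> x'" "0 \<le> y'" for x y x' y'
  proof -
    have "x = 0 \<longleftrightarrow> y' = 0" using that(2-6)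
      by (metis add_nonneg_eq_0_iff mult_eq_0_iff zero_le_one zero_neq_one)
    then show ?thesis using that b by auto
  qed
  have P: "0 < u" "0 < v'" "0 < p" "0 < q'" using pos st st' nn by blast+
  have X: "0 < ln (1 + p) - ln (1 + u)" using c by (simp add: cone_def)
  then have up: "u < p" using nn by simp
  have g: "(ln (1 + p) - ln (1 + u)) * (1 + 1 / L) \<le> ln p - ln u"
    using ln_diff_gain P up L by simp
  have E: "ln (1 + u') + ln u = ln (1 + v) + ln v'" "ln (1 + p') + ln p = ln (1 + q) + ln q'"
    using arg_cong[OF st(2), of ln] arg_cong[OF st'(2), of ln] P nn by (simp_all add: ln_mult)
  have vq: "q' < v'" using st st' up by simp
  have V: "ln (1 + v') - ln (1 + q') \<le> ln v' - ln q'" "ln (1 + q') \<le> ln (1 + v')"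
    using ln_diff_add_le[of q' v' 1] P vq by auto
  have "0 < L" using P L by simp
  then have "0 < (ln (1 + p) - ln (1 + u)) / L" using X by simp
  moreover have "(ln (1 + p) - ln (1 + u)) + (ln (1 + p) - ln (1 + u)) / L \<le> ln p - ln u"
    using g by (simp only: distrib_left mult_1_right times_divide_eq_right)
  ultimately show ?thesis using c E V X L unfolding cone_def by - (elim conjE disjE; intro conjI; linarith)
qed

text \<open>The order of the two points is kept. The increment of ln v1 is at least that of ln u
  because u = v1 + b + 1, and the latter has the gain X / L. The two product relations then express
  the increment of ln (1 + u2) through known ones.\<close>

lemma cone_step010:
  fixes b :: real
  assumes b: "0 < b" and nn: "0 \<le> u" "0 \<le> v" "0 \<le> u1" "0 \<le> v1" "0 \<le> u2" "0 \<le> v2"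
      "0 \<le> p" "0 \<le> q" "0 \<le> p1" "0 \<le> q1" "0 \<le> p2" "0 \<le> q2"
    and st: "u = v1 + b + 1" "u1 * u = (1 + v) * (1 + v1)"
      "v2 = u1 + b + 1" "(1 + u2) * (1 + u1) = v1 * v2"
    and st': "p = q1 + b + 1" "p1 * p = (1 + q) * (1 + q1)"
      "q2 = p1 + b + 1" "(1 + p2) * (1 + p1) = q1 * q2"
    and c: "cone n u v p q" and L: "0 \<le> n" "u \<le> L" "p \<le> L"
  shows "cone (n + (ln (1 + p) - ln (1 + u)) / L) u2 v2 p2 q2"
proof -
  have pos: "0 < y1" if "(1 + x2) * (1 + x1) = y1 * y2" "0 \<le> x1" "0 \<le> x2" "0 \<le> y1" for x1 x2 y1 y2 :: real
  proof -
    have "0 < (1 + x2) * (1 + x1)" using that by (intro mult_pos_pos) auto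
    then show ?thesis using that by (metis mult_eq_0_iff less_eq_real_def less_irrefl)
  qed
  have P: "0 < v1" "0 < q1" using pos st st' nn by blast+
  have Q: "0 < u" "0 < p" "0 < v2" "0 < q2" using st st' nn b by auto
  have "0 < (1 + v) * (1 + v1)" "0 < (1 + q) * (1 + q1)" using nn by (auto intro!: mult_pos_pos)
  then have R: "0 < u1" "0 < p1" using st(2) st'(2) Q zero_less_mult_pos2 by metis+
  have X: "0 < ln (1 + p) - ln (1 + u)" using c by (simp add: cone_def)
  then have up: "u < p" using nn by simp
  have g: "(ln (1 + p) - ln (1 + u)) * (1 + 1 / L) \<le> ln p - ln u"
    using ln_diff_gain Q up L by simp
  have E: "ln u1 + ln u = ln (1 + v) + ln (1 + v1)" "ln p1 + ln p = ln (1 + q) + ln (1 + q1)"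
    "ln (1 + u2) + ln (1 + u1) = ln v1 + ln v2" "ln (1 + p2) + ln (1 + p1) = ln q1 + ln q2"
    using arg_cong[OF st(2), of ln] arg_cong[OF st'(2), of ln] arg_cong[OF st(4), of ln]
      arg_cong[OF st'(4), of ln] P Q R nn by (simp_all add: ln_mult)
  have vq: "v1 < q1" using st st' up by simp
  have V: "ln p - ln u \<le> ln q1 - ln v1" "ln (1 + q1) - ln (1 + v1) \<le> ln q1 - ln v1"
    using ln_diff_add_le[of v1 q1 "b+1"] ln_diff_add_le[of v1 q1 1] P vq b st st' by (auto simp: algebra_simps)
  \<comment> \<open>The order of u1 and p1 is not determined. If p1 is ahead, its increment is
    bounded through the first product relation; if it is behind, it only helps, and the increment of
    ln v1 alone suffices.\<close>
  have U: "(ln (1 + p1) - ln (1 + u1) \<le> ln p1 - ln u1 \<and>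
      0 \<le> ln (1 + q2) - ln (1 + v2) \<and> ln (1 + q2) - ln (1 + v2) \<le> ln q2 - ln v2 \<and>
      ln q2 - ln v2 \<le> ln (1 + p1) - ln (1 + u1)) \<or>
     (ln (1 + p1) - ln (1 + u1) \<le> 0 \<and>
      ln (1 + q2) - ln (1 + v2) \<le> 0 \<and>
      ln (1 + p1) - ln (1 + u1) \<le> ln q2 - ln v2)"
  proof (cases "u1 \<le> p1")
    case True
    then show ?thesis
      using ln_diff_add_le[of u1 p1 1] ln_diff_add_le[of v2 q2 1] ln_diff_add_le[of "1 + u1" "1 + p1" b]
        R Q st st' b by (auto simp: algebra_simps)
  next
    case False
    then show ?thesis
      using ln_diff_add_le[of p1 u1 1] ln_diff_add_le[of q2 v2 1] ln_diff_add_le[of "1 + p1" "1 + u1" b]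
        R Q st st' b by (auto simp: algebra_simps)
  qed
  have "0 < L" using Q L by simp
  then have "0 < (ln (1 + p) - ln (1 + u)) / L" using X by simp
  moreover have "(ln (1 + p) - ln (1 + u)) + (ln (1 + p) - ln (1 + u)) / L \<le> ln p - ln u"
    using g by (simp only: distrib_left mult_1_right times_divide_eq_right)
  ultimately show ?thesis using c E V X L U unfolding cone_def by - (elim conjE disjE; intro conjI; linarith)
qed

text \<open>Both orders at once, as each block 00 exchanges them.\<close>

definition dcone :: "real \<Rightarrow> real \<Rightarrow> real \<Rightarrow> real \<Rightarrow> real \<Rightarrow> bool" where
  "dcone n u v p q \<longleftrightarrow> cone n u v p q \<or> cone n p q u v"

lemma dcone_block00:
  assumes b: "0 < b" and o: "orb b w i j u v" "orb b w i j p q" "i < j" "w i = 0" "w (i + 1) = 0"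
    and c: "dcone n (u i) (v i) (p i) (q i)" and L: "0 \<le> n" "u i \<le> L" "p i \<le> L"
  shows "dcone (n + \<bar>ln (1 + p i) - ln (1 + u i)\<bar> / L) (u (i+1)) (v (i+1)) (p (i+1)) (q (i+1))"
proof -
  note U = orb_step00[OF o(1,3,4,5)] and P = orb_step00[OF o(2,3,4,5)]
  from c show ?thesis unfolding dcone_def
  proof
    assume c: "cone n (u i) (v i) (p i) (q i)"
    then show "cone (n + \<bar>ln (1 + p i) - ln (1 + u i)\<bar> / L) (u (i+1)) (v (i+1)) (p (i+1)) (q (i+1)) \<or>
      cone (n + \<bar>ln (1 + p i) - ln (1 + u i)\<bar> / L) (p (i+1)) (q (i+1)) (u (i+1)) (v (i+1))"
      using cone_step00[OF b U(3-6) P(3-6) U(1,2) P(1,2) c L] by (auto simp: cone_def)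
  next
    assume c: "cone n (p i) (q i) (u i) (v i)"
    then show "cone (n + \<bar>ln (1 + p i) - ln (1 + u i)\<bar> / L) (u (i+1)) (v (i+1)) (p (i+1)) (q (i+1)) \<or>
      cone (n + \<bar>ln (1 + p i) - ln (1 + u i)\<bar> / L) (p (i+1)) (q (i+1)) (u (i+1)) (v (i+1))"
      using cone_step00[OF b P(3-6) U(3-6) P(1,2) U(1,2) c L(1,3,2)]
      by (subst abs_minus_commute) (auto simp: cone_def)
  qed
qed

lemma dcone_block010:
  assumes b: "0 < b" and o: "orb b w i j u v" "orb b w i j p q" "i + 2 \<le> j" "w i = 0" "w (i + 1) \<noteq> 0"
    and c: "dcone n (u i) (v i) (p i) (q i)" and L: "0 \<le> n" "u i \<le> L" "p i \<le> L"
  shows "dcone (n + \<bar>ln (1 + p i) - ln (1 + u i)\<bar> / L) (u (i+2)) (v (i+2)) (p (i+2)) (q (i+2))"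
proof -
  note U = orb_step010[OF o(1,3,4,5)] and P = orb_step010[OF o(2,3,4,5)]
  from c show ?thesis unfolding dcone_def
  proof
    assume c: "cone n (u i) (v i) (p i) (q i)"
    then show "cone (n + \<bar>ln (1 + p i) - ln (1 + u i)\<bar> / L) (u (i+2)) (v (i+2)) (p (i+2)) (q (i+2)) \<or>
      cone (n + \<bar>ln (1 + p i) - ln (1 + u i)\<bar> / L) (p (i+2)) (q (i+2)) (u (i+2)) (v (i+2))"
      using cone_step010[OF b U(5-10) P(5-10) U(1-4) P(1-4) c L] by (auto simp: cone_def)
  next
    assume c: "cone n (p i) (q i) (u i) (v i)"
    then show "cone (n + \<bar>ln (1 + p i) - ln (1 + u i)\<bar> / L) (u (i+2)) (v (i+2)) (p (i+2)) (q (i+2)) \<or>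
      cone (n + \<bar>ln (1 + p i) - ln (1 + u i)\<bar> / L) (p (i+2)) (q (i+2)) (u (i+2)) (v (i+2))"
      using cone_step010[OF b P(5-10) U(5-10) P(1-4) U(1-4) c L(1,3,2)]
      by (subst abs_minus_commute) (auto simp: cone_def)
  qed
qed

lemma dcone_lower: "dcone n u v p q \<Longrightarrow> n \<le> \<bar>ln (1 + p) - ln (1 + u)\<bar> \<and> u \<noteq> p"
  by (auto simp: dcone_def cone_def)

lemma dcone_mono: "dcone n u v p q \<Longrightarrow> m \<le> n \<Longrightarrow> dcone m u v p q"
  using cone_mono by (auto simp: dcone_def)

section \<open>Growth of the cone along a word and the Lipschitz bounds that follow\<close>

definition count00 :: "(int \<Rightarrow> nat) \<Rightarrow> int \<Rightarrow> int \<Rightarrow> nat" where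
  "count00 w i j = card {k\<in>{i..<j}. w k = 0 \<and> w (k + 1) = 0}"

lemma count00_block00:
  assumes "i < j" "w i = 0" "w (i + 1) = 0"
  shows "count00 w i j = Suc (count00 w (i+1) j)"
proof -
  have "{k\<in>{i..<j}. w k = 0 \<and> w (k + 1) = 0} = insert i {k\<in>{i+1..<j}. w k = 0 \<and> w (k + 1) = 0}"
    using assms by auto
  moreover have "finite {k\<in>{i+1..<j}. w k = 0 \<and> w (k + 1) = 0}"
    by (rule finite_subset[of _ "{i..<j}"]) auto
  moreover have "i \<notin> {k\<in>{i+1..<j}. w k = 0 \<and> w (k + 1) = 0}" by simp
  ultimately show ?thesis unfolding count00_def by (metis (no_types, lifting) card_insert_disjoint)
qed

lemma count00_block010:
  assumes "w (i + 1) \<noteq> 0"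
  shows "count00 w i j = count00 w (i+2) j"
proof -
  have "k \<in> {i+2..<j}" if k: "k \<in> {i..<j}" "w k = 0" "w (k + 1) = 0" for k
  proof -
    have "k \<noteq> i" "k \<noteq> i + 1" using assms k by auto
    then show ?thesis using k by simp
  qed
  then have "{k\<in>{i..<j}. w k = 0 \<and> w (k + 1) = 0} = {k\<in>{i+2..<j}. w k = 0 \<and> w (k + 1) = 0}"
    by auto
  then show ?thesis unfolding count00_def by simp
qed

text \<open>Each block 00 starts with u at most b and therefore multiplies the size of the cone.\<close>

lemma dcone_orb:
  assumes b: "0 < b" and w: "no11 w" "w j = 0" "w i = 0" "i \<le> j"
    and o: "orb b w i j u v" "orb b w i j p q"
    and c: "dcone n (u i) (v i) (p i) (q i)" "0 \<le> n"
  shows "dcone (n * (1 + 1 / b) ^ count00 w i j) (u j) (v j) (p j) (q j)"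
  using w o c
proof (induction i arbitrary: n rule: backward_block_induct)
  case base
  then show ?case by (simp add: count00_def)
next
  case (step00 i)
  let ?X = "\<bar>ln (1 + p i) - ln (1 + u i)\<bar>"
  have ub: "u i \<le> b" "p i \<le> b"
    using orb_step00(1,6)[OF step00.prems(1) step00.hyps(1-3)]
      orb_step00(1,6)[OF step00.prems(2) step00.hyps(1-3)] by linarith+
  have "dcone (n + ?X / b) (u (i+1)) (v (i+1)) (p (i+1)) (q (i+1))"
    using dcone_block00[OF b step00.prems(1,2) step00.hyps(1-3) step00.prems(3,4) ub] .
  moreover have "n * (1 + 1 / b) \<le> n + ?X / b"
    using dcone_lower[OF step00.prems(3)] b by (simp add: field_simps)
  ultimately have D: "dcone (n * (1 + 1 / b)) (u (i+1)) (v (i+1)) (p (i+1)) (q (i+1))"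
    by (rule dcone_mono)
  have *: "dcone (n * (1 + 1 / b) * (1 + 1 / b) ^ count00 w (i+1) j) (u j) (v j) (p j) (q j)"
    by (rule step00.IH) (use orb_sub[OF step00.prems(1), of "i+1" j] orb_sub[OF step00.prems(2), of "i+1" j] step00.prems(4) b D in auto)
  have "count00 w i j = Suc (count00 w (i+1) j)"
    by (rule count00_block00) (use step00.hyps in auto)
  then show ?case using * by (simp add: mult.assoc)
next
  case (step010 i)
  \<comment> \<open>Inside an alternating stretch nothing bounds u uniformly, so the gain of this
    block is only used as nonnegative and then dropped.\<close>
  define L where "L = max (u i) (p i)"
  have "dcone (n + \<bar>ln (1 + p i) - ln (1 + u i)\<bar> / L) (u (i+2)) (v (i+2)) (p (i+2)) (q (i+2))"
    using dcone_block010[OF b step010.prems(1,2) step010.hyps(1-3) step010.prems(3,4), of L]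
    by (simp add: L_def)
  moreover have "0 \<le> L" using orbD(1)[OF step010.prems(1), of i] step010.hyps by (simp add: L_def)
  ultimately have D: "dcone n (u (i+2)) (v (i+2)) (p (i+2)) (q (i+2))"
    by (elim dcone_mono) simp
  have *: "dcone (n * (1 + 1 / b) ^ count00 w (i+2) j) (u j) (v j) (p j) (q j)"
    by (rule step010.IH) (use orb_sub[OF step010.prems(1), of "i+2" j] orb_sub[OF step010.prems(2), of "i+2" j] step010.prems(4) b D in auto)
  have "count00 w i j = count00 w (i+2) j"
    by (rule count00_block010) (use step010.hyps in auto)
  then show ?case using * by simp
qed

lemma dconeI:
  assumes "0 \<le> n" "\<bar>ln (1 + p) - ln (1 + u)\<bar> \<ge> \<bar>ln (1 + q) - ln (1 + v)\<bar> + n" "u \<noteq> p" "0 \<le> u" "0 \<le> p"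
  shows "dcone n u v p q"
proof -
  have "ln (1 + p) \<noteq> ln (1 + u)" using assms by simp
  then show ?thesis using assms by (auto simp: dcone_def cone_def)
qed

text \<open>If the u-difference at time i exceeded the v-difference, the pair would lie in a cone of
  size 0. This persists up to time j and makes the values of u there distinct.\<close>

lemma lipschitz_u_of_v:
  assumes b: "0 < b" and w: "no11 w" "w j = 0" "w i = 0" "i \<le> j"
    and o: "orb b w i j u v" "orb b w i j p q" and e: "u j = p j"
  shows "\<bar>ln (1 + u i) - ln (1 + p i)\<bar> \<le> \<bar>ln (1 + v i) - ln (1 + q i)\<bar>"
proof (rule ccontr)
  assume "\<not> ?thesis"
  then have "dcone 0 (u i) (v i) (p i) (q i)"
    using orbD[OF o(1), of i] orbD[OF o(2), of i] w by (intro dconeI) auto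
  from dcone_orb[OF b w o this] e show False using dcone_lower by fastforce
qed

text \<open>Equal v at time i puts the pair into the cone whose size is the full u-difference, and
  the size never decreases.\<close>

lemma lipschitz_u_of_u:
  assumes b: "0 < b" and w: "no11 w" "w j = 0" "w i = 0" "i \<le> j"
    and o: "orb b w i j u v" "orb b w i j p q" and e: "v i = q i"
  shows "\<bar>ln (1 + u i) - ln (1 + p i)\<bar> \<le> \<bar>ln (1 + u j) - ln (1 + p j)\<bar>"
proof (cases "u i = p i")
  case False
  let ?n = "\<bar>ln (1 + p i) - ln (1 + u i)\<bar>"
  have "dcone ?n (u i) (v i) (p i) (q i)"
    using orbD[OF o(1), of i] orbD[OF o(2), of i] w e False by (intro dconeI) auto
  from dcone_lower[OF dcone_orb[OF b w o this]] 
  have "?n * (1 + 1 / b) ^ count00 w i j \<le> \<bar>ln (1 + p j) - ln (1 + u j)\<bar>"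
    by simp
  moreover have "?n * 1 \<le> ?n * (1 + 1 / b) ^ count00 w i j"
    using b by (intro mult_left_mono) auto
  ultimately show ?thesis by (simp add: abs_minus_commute)
qed simp

subsection \<open>Orbits with prescribed end data\<close>

lemma continuous_on_ln_lipschitz:
  fixes G :: "real \<Rightarrow> real"
  assumes G: "\<And>x. 0 \<le> x \<Longrightarrow> 0 \<le> G x"
    and L: "\<And>x y. 0 \<le> x \<Longrightarrow> 0 \<le> y \<Longrightarrow> \<bar>ln (1 + G x) - ln (1 + G y)\<bar> \<le> \<bar>ln (1 + x) - ln (1 + y)\<bar>"
  shows "continuous_on {0..} G"
proof -
  have c: "continuous_on {0..} (\<lambda>x. ln (1 + G x))"
    unfolding continuous_on_iff
  proof (intro ballI allI impI)
    fix x e :: real assume x: "x \<in> {0..}" and e: "0 < e"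
    have "continuous_on {0..} (\<lambda>x::real. ln (1 + x))"
      by (intro continuous_intros) auto
    from this[unfolded continuous_on_iff, rule_format, OF x e] obtain d where
      d: "0 < d" "\<And>y. y \<in> {0..} \<Longrightarrow> dist y x < d \<Longrightarrow> dist (ln (1 + y)) (ln (1 + x)) < e" by blast
    have "dist (ln (1 + G y)) (ln (1 + G x)) < e" if "y \<in> {0..}" "dist y x < d" for y
      using d(2)[OF that] L[of y x] that x by (simp add: dist_real_def)
    then show "\<exists>d>0. \<forall>y\<in>{0..}. dist y x < d \<longrightarrow> dist (ln (1 + G y)) (ln (1 + G x)) < e"
      using d(1) by blast
  qed
  have "continuous_on {0..} (\<lambda>x. exp (ln (1 + G x)) - 1)"
    by (intro continuous_intros c)
  moreover have "exp (ln (1 + G x)) - 1 = G x" if "x \<in> {0..}" for x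
    using G[of x] that by simp
  ultimately show ?thesis by (rule continuous_on_eq)
qed

lemma orb_prepend1:
  assumes o: "orb b w (i+1) j u v" and s: "step b (w i) (w (i+1)) x y (u (i+1)) (v (i+1))"
    and "0 \<le> x" "0 \<le> y"
  shows "orb b w i j (u(i := x)) (v(i := y))"
  unfolding orb_def
proof (intro conjI ballI)
  fix k assume "k \<in> {i..j}"
  then show "0 \<le> (u(i := x)) k" "0 \<le> (v(i := y)) k"
    using assms orbD[OF o, of k] by auto
next
  fix k assume "k \<in> {i..<j}"
  then show "step b (w k) (w (k + 1)) ((u(i := x)) k) ((v(i := y)) k) ((u(i := x)) (k + 1)) ((v(i := y)) (k + 1))"
    using s orb_step[OF o, of k] by (cases "k = i") auto
qed

text \<open>Induction backwards over blocks. For the part already built, the Lipschitz bound makes u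
  at its start a continuous function G of v there; putting one more block in front then amounts to
  one scalar equation, solved by intermediate values.\<close>

lemma exists_orb_v_start_u_end:
  assumes b: "0 < b" and w: "no11 w" "w j = 0" "w i = 0" "i \<le> j" and c: "0 \<le> c"
  shows "\<forall>y\<ge>0. \<exists>u v. orb b w i j u v \<and> v i = y \<and> u j = c"
proof -
  \<comment> \<open>The relation whose continuous selection, from v to u at time i, is the function
    G.\<close>
  define R where "R i x y \<longleftrightarrow> (\<exists>u v. orb b w i j u v \<and> u i = x \<and> v i = y \<and> u j = c)" for i x y
  have sel: "\<exists>G. continuous_on {0..} G \<and> (\<forall>y\<ge>0. 0 \<le> G y \<and> R i (G y) y)"
    if "w i = 0" "i \<le> j" "\<forall>y\<ge>0. \<exists>x. R i x y" for i
  proof -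
    from that obtain G where G: "\<And>y. y \<ge> 0 \<Longrightarrow> R i (G y) y" by metis
    have nn: "0 \<le> G y" if "0 \<le> y" for y
      using G[OF that] \<open>i \<le> j\<close> orbD(1) unfolding R_def by fastforce
    have "\<bar>ln (1 + G x) - ln (1 + G y)\<bar> \<le> \<bar>ln (1 + x) - ln (1 + y)\<bar>" if "0 \<le> x" "0 \<le> y" for x y
      using G[OF that(1)] G[OF that(2)] lipschitz_u_of_v[OF b w(1,2) \<open>w i = 0\<close> \<open>i \<le> j\<close>]
      unfolding R_def by metis
    from continuous_on_ln_lipschitz[OF nn this] G nn show ?thesis by blast
  qed
  have "\<forall>y\<ge>0. \<exists>x. R i x y"
    using w
  proof (induction i rule: backward_block_induct)
    case base
    have "orb b w j j (\<lambda>_. c) (\<lambda>_. y)" if "0 \<le> y" for y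
      using that c by (auto simp: orb_def)
    then show ?case unfolding R_def by fastforce
  next
    case (step00 i)
    obtain G where G: "continuous_on {0..} G" "\<And>y. 0 \<le> y \<Longrightarrow> 0 \<le> G y" "\<And>y. 0 \<le> y \<Longrightarrow> R (i+1) (G y) y"
      using sel[of "i+1"] step00 by auto
    show ?case
    proof (intro allI impI)
      fix y :: real assume y: "0 \<le> y"
      \<comment> \<open>The unknown x is u at time i; then v' = b - x and u' = G (b - x), and a zero
        of \<open>?h\<close> is the product relation of the block 00.\<close>
      let ?h = "\<lambda>x. (1 + G (b - x)) * x - (1 + y) * (b - x)"
      have "continuous_on {0..b} (\<lambda>x. G (b - x))"
        by (rule continuous_on_compose2[OF G(1)]) (auto intro!: continuous_intros)
      then have "continuous_on {0..b} ?h" by (intro continuous_intros)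
      moreover have "?h 0 \<le> 0" "0 \<le> ?h b" using y b G(2)[of 0] by auto
      ultimately obtain x where x: "0 \<le> x" "x \<le> b" "?h x = 0"
        using IVT'[of ?h 0 0 b] b by auto
      obtain u v where o: "orb b w (i+1) j u v" "u (i+1) = G (b - x)" "v (i+1) = b - x" "u j = c"
        using G(3)[of "b - x"] x unfolding R_def by auto
      have "step b (w i) (w (i+1)) x y (u (i+1)) (v (i+1))"
        using step00 x o by (simp add: step_def)
      from orb_prepend1[OF o(1) this x(1) y] o step00.hyps
      show "\<exists>x. R i x y" unfolding R_def
        by (intro exI[of _ x] exI[of _ "u(i := x)"] exI[of _ "v(i := y)"]) simp
    qed
  next
    case (step010 i)
    obtain G where G: "continuous_on {0..} G" "\<And>y. 0 \<le> y \<Longrightarrow> 0 \<le> G y" "\<And>y. 0 \<le> y \<Longrightarrow> R (i+2) (G y) y"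
      using sel[of "i+2"] step010 by auto
    show ?case
    proof (intro allI impI)
      fix y :: real assume y: "0 \<le> y"
      \<comment> \<open>The unknown t is v at the middle time. It determines u = t + b + 1, then u1
        by the first product relation and v2 = u1 + b + 1; the second product relation is left as
        the equation \<open>?h t = 0\<close>.\<close>
      define u1 where "u1 t = (1 + y) * (1 + t) / (t + b + 1)" for t
      let ?v2 = "\<lambda>t. u1 t + b + 1"
      let ?h = "\<lambda>t. t * ?v2 t - (1 + G (?v2 t)) * (1 + u1 t)"
      have u1: "0 \<le> u1 t" "u1 t \<le> 1 + y" if "0 \<le> t" for t
      proof -
        show "0 \<le> u1 t" using that y b by (auto simp: u1_def intro!: divide_nonneg_nonneg)
        have "(1 + y) * (1 + t) \<le> (1 + y) * (t + b + 1)"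
          using that y b by (intro mult_left_mono) auto
        then show "u1 t \<le> 1 + y" using that b by (simp add: u1_def pos_divide_le_eq)
      qed
      \<comment> \<open>Since u1 is at most 1 + y, the argument of G stays at most y + b + 2 for all
        t. So G is bounded by some M there, and \<open>?h\<close> is nonnegative at t = 1 +
        M.\<close>
      have "\<exists>z\<in>{0..y + b + 2}. \<forall>x\<in>{0..y + b + 2}. G x \<le> G z"
        by (rule continuous_attains_sup)
          (use y b continuous_on_subset[OF G(1), of "{0..y + b + 2}"] in simp_all)
      then obtain z where M': "\<forall>x\<in>{0..y + b + 2}. G x \<le> G z" by blast
      define M where "M = G z"
      have M: "G x \<le> M" if "0 \<le> x" "x \<le> y + b + 2" for x
        using M' that unfolding M_def by simp
      have M0: "0 \<le> M" using M[of 0] G(2)[of 0] y b by simp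
      have cu: "continuous_on {0..1+M} u1"
        unfolding u1_def using b by (intro continuous_intros) auto
      have "continuous_on {0..1+M} (\<lambda>t. G (?v2 t))"
      proof (rule continuous_on_compose2[OF G(1)])
        show "continuous_on {0..1+M} ?v2" by (intro continuous_intros cu)
        show "?v2 ` {0..1+M} \<subseteq> {0..}"
        proof (rule image_subsetI)
          fix t assume "t \<in> {0..1+M}"
          then show "?v2 t \<in> {0..}" using u1(1)[of t] b by simp
        qed
      qed
      then have "continuous_on {0..1+M} ?h" by (intro continuous_intros cu)
      moreover have "?h 0 \<le> 0"
        using G(2)[of "?v2 0"] u1[of 0] b by (auto intro!: mult_nonneg_nonneg)
      moreover have "0 \<le> ?h (1+M)"
      proof -
        have "(1 + G (?v2 (1+M))) * (1 + u1 (1+M)) \<le> (1 + M) * ?v2 (1+M)"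
          using M[of "?v2 (1+M)"] u1[of "1+M"] M0 b G(2)[of "?v2 (1+M)"]
          by (intro mult_mono) auto
        then show ?thesis by simp
      qed
      ultimately obtain t where t: "0 \<le> t" "?h t = 0"
        using IVT'[of ?h 0 0 "1+M"] M0 by auto
      have v2: "0 \<le> ?v2 t" using u1[of t] t b by simp
      obtain u v where o: "orb b w (i+2) j u v" "u (i+2) = G (?v2 t)" "v (i+2) = ?v2 t" "u j = c"
        using G(3)[OF v2] unfolding R_def by auto
      have e: "i + 1 + 1 = i + 2" by simp
      have "step b (w (i+1)) (w (i+1+1)) (u1 t) t (u (i+1+1)) (v (i+1+1))"
        using step010.hyps t(2) o(2,3) unfolding e by (simp add: step_def)
      then have o1: "orb b w (i+1) j (u(i+1 := u1 t)) (v(i+1 := t))"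
        using o(1) u1(1)[OF t(1)] t(1) by (intro orb_prepend1) (simp_all only: e)
      have s0: "step b (w i) (w (i+1)) (t + b + 1) y ((u(i+1 := u1 t)) (i+1)) ((v(i+1 := t)) (i+1))"
        using step010.hyps t(1) b by (simp add: step_def u1_def)
      have "orb b w i j (u(i+1 := u1 t, i := t + b + 1)) (v(i+1 := t, i := y))"
        by (rule orb_prepend1[OF o1 s0 _ y]) (use t(1) b in linarith)
      then show "\<exists>x. R i x y" unfolding R_def using o(4) step010.hyps
        by (intro exI[of _ "t + b + 1"] exI[of _ "u(i+1 := u1 t, i := t + b + 1)"] exI[of _ "v(i+1 := t, i := y)"])
          simp
    qed
  qed
  then show ?thesis unfolding R_def by blast
qed

section \<open>Closing up orbit segments by a fixed point\<close>

lemma lipschitz_v_of_u: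
  assumes b: "0 < b" and w: "no11 w" "w j = 0" "w i = 0" "i \<le> j"
    and o: "orb b w i j u v" "orb b w i j p q" and e: "v i = q i"
  shows "\<bar>ln (1 + v j) - ln (1 + q j)\<bar> \<le> \<bar>ln (1 + u j) - ln (1 + p j)\<bar>"
  by (rule lipschitz_u_of_v[OF b no11_rev[OF w(1)] _ _ _ orb_rev[OF o(1)] orb_rev[OF o(2)], unfolded minus_minus])
    (use w(2-4) e in simp_all)

lemma lipschitz_v_of_v:
  assumes b: "0 < b" and w: "no11 w" "w j = 0" "w i = 0" "i \<le> j"
    and o: "orb b w i j u v" "orb b w i j p q" and e: "u j = p j"
  shows "\<bar>ln (1 + v j) - ln (1 + q j)\<bar> \<le> \<bar>ln (1 + v i) - ln (1 + q i)\<bar>"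
  by (rule lipschitz_u_of_u[OF b no11_rev[OF w(1)] _ _ _ orb_rev[OF o(1)] orb_rev[OF o(2)], unfolded minus_minus])
    (use w(2-4) e in simp_all)

lemma continuous_on_ln_lipschitz_prod:
  fixes G :: "real \<times> real \<Rightarrow> real"
  assumes G: "\<And>x. x \<in> {0..b} \<times> {0..b} \<Longrightarrow> 0 \<le> G x"
    and L: "\<And>x y x' y'. \<lbrakk>0 \<le> x; 0 \<le> y; 0 \<le> x'; 0 \<le> y'\<rbrakk> \<Longrightarrow>
       \<bar>ln (1 + G (x, y)) - ln (1 + G (x', y'))\<bar> \<le> \<bar>ln (1 + x) - ln (1 + x')\<bar> + \<bar>ln (1 + y) - ln (1 + y')\<bar>"
  shows "continuous_on ({0..b} \<times> {0..b}) G"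
proof -
  let ?S = "{0..b} \<times> {0..b}"
  have c: "continuous_on ?S (\<lambda>x. ln (1 + G x))"
    unfolding continuous_on_def
  proof
    fix z assume z: "z \<in> ?S"
    have "continuous_on ?S (\<lambda>x. \<bar>ln (1 + fst x) - ln (1 + fst z)\<bar> + \<bar>ln (1 + snd x) - ln (1 + snd z)\<bar>)"
      by (intro continuous_intros) auto
    then have "((\<lambda>x. \<bar>ln (1 + fst x) - ln (1 + fst z)\<bar> + \<bar>ln (1 + snd x) - ln (1 + snd z)\<bar>) \<longlongrightarrow> 0) (at z within ?S)"
      using z by (auto dest: continuous_on_def[THEN iffD1, THEN bspec, of _ _ z])
    moreover have "\<forall>\<^sub>F x in at z within ?S. norm (ln (1 + G x) - ln (1 + G z))
        \<le> \<bar>ln (1 + fst x) - ln (1 + fst z)\<bar> + \<bar>ln (1 + snd x) - ln (1 + snd z)\<bar>"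
      unfolding eventually_at_topological
      using L[of _ _ "fst z" "snd z"] z by (intro exI[of _ UNIV]) (auto simp: mem_Times_iff)
    ultimately have "((\<lambda>x. ln (1 + G x) - ln (1 + G z)) \<longlongrightarrow> 0) (at z within ?S)"
      by (rule Lim_null_comparison[rotated])
    then show "((\<lambda>x. ln (1 + G x)) \<longlongrightarrow> ln (1 + G z)) (at z within ?S)"
      by (simp add: LIM_zero_iff)
  qed
  have "continuous_on ?S (\<lambda>x. exp (ln (1 + G x)) - 1)"
    by (intro continuous_intros c)
  moreover have "exp (ln (1 + G x)) - 1 = G x" if "x \<in> ?S" for x
    using G[of x] that by simp
  ultimately show ?thesis by (rule continuous_on_eq)
qed

text \<open>The map \<open>\<Phi>\<close> sends the prescribed pair (v at the start, u at the end)
  to the pair (v at the end, u at the start) of a solution. Its fixed points are closed orbits. The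
  four Lipschitz bounds give its continuity, varying one boundary value at a time.\<close>

lemma exists_closed_orb:
  assumes b: "0 < b" and w: "no11 w" "i < j" "w i = 0" "w (i + 1) = 0" "w (j - 1) = 0" "w j = 0"
  shows "\<exists>u v. orb b w i j u v \<and> u i = u j \<and> v i = v j"
proof -
  let ?S = "{0..b} \<times> {0..b}"
  have "\<exists>u v. orb b w i j u v \<and> v i = y \<and> u j = c" if "0 \<le> y" "0 \<le> c" for y c
    using exists_orb_v_start_u_end[OF b w(1,6,3) less_imp_le[OF w(2)] that(2)] that by blast
  then obtain u v where o: "\<And>y c. 0 \<le> y \<Longrightarrow> 0 \<le> c \<Longrightarrow> orb b w i j (u y c) (v y c)"
    "\<And>y c. 0 \<le> y \<Longrightarrow> 0 \<le> c \<Longrightarrow> v y c i = y" "\<And>y c. 0 \<le> y \<Longrightarrow> 0 \<le> c \<Longrightarrow> u y c j = c" by metis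
  have ij: "i \<le> j" using w by simp
  note l = lipschitz_u_of_u[OF b w(1,6,3) ij] lipschitz_u_of_v[OF b w(1,6,3) ij]
    lipschitz_v_of_v[OF b w(1,6,3) ij] lipschitz_v_of_u[OF b w(1,6,3) ij]
  define \<Phi> where "\<Phi> z = (v (fst z) (snd z) j, u (fst z) (snd z) i)" for z
  have "continuous_on ?S (\<lambda>z. v (fst z) (snd z) j)"
  proof (rule continuous_on_ln_lipschitz_prod)
    fix x assume "x \<in> ?S" then show "0 \<le> v (fst x) (snd x) j"
      using orbD(2)[OF o(1), of "fst x" "snd x" j] ij by auto
  next
    fix x y x' y' :: real assume nn: "0 \<le> x" "0 \<le> y" "0 \<le> x'" "0 \<le> y'"
    have "\<bar>ln (1 + v x y j) - ln (1 + v x' y j)\<bar> \<le> \<bar>ln (1 + x) - ln (1 + x')\<bar>"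
      using l(3)[OF o(1)[OF nn(1,2)] o(1)[OF nn(3,2)]] o(2,3) nn by simp
    moreover have "\<bar>ln (1 + v x' y j) - ln (1 + v x' y' j)\<bar> \<le> \<bar>ln (1 + y) - ln (1 + y')\<bar>"
      using l(4)[OF o(1)[OF nn(3,2)] o(1)[OF nn(3,4)]] o(2,3) nn by simp
    ultimately show "\<bar>ln (1 + v (fst (x, y)) (snd (x, y)) j) - ln (1 + v (fst (x', y')) (snd (x', y')) j)\<bar>
      \<le> \<bar>ln (1 + x) - ln (1 + x')\<bar> + \<bar>ln (1 + y) - ln (1 + y')\<bar>" by simp
  qed
  moreover have "continuous_on ?S (\<lambda>z. u (fst z) (snd z) i)"
  proof (rule continuous_on_ln_lipschitz_prod)
    fix x assume "x \<in> ?S" then show "0 \<le> u (fst x) (snd x) i"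
      using orbD(1)[OF o(1), of "fst x" "snd x" i] ij by auto
  next
    fix x y x' y' :: real assume nn: "0 \<le> x" "0 \<le> y" "0 \<le> x'" "0 \<le> y'"
    have "\<bar>ln (1 + u x y i) - ln (1 + u x' y i)\<bar> \<le> \<bar>ln (1 + x) - ln (1 + x')\<bar>"
      using l(2)[OF o(1)[OF nn(1,2)] o(1)[OF nn(3,2)]] o(2,3) nn by simp
    moreover have "\<bar>ln (1 + u x' y i) - ln (1 + u x' y' i)\<bar> \<le> \<bar>ln (1 + y) - ln (1 + y')\<bar>"
      using l(1)[OF o(1)[OF nn(3,2)] o(1)[OF nn(3,4)]] o(2,3) nn by simp
    ultimately show "\<bar>ln (1 + u (fst (x, y)) (snd (x, y)) i) - ln (1 + u (fst (x', y')) (snd (x', y')) i)\<bar>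
      \<le> \<bar>ln (1 + x) - ln (1 + x')\<bar> + \<bar>ln (1 + y) - ln (1 + y')\<bar>" by simp
  qed
  ultimately have cont: "continuous_on ?S \<Phi>" unfolding \<Phi>_def by (intro continuous_intros)
  \<comment> \<open>This is where the blocks 00 at both ends enter: the first one keeps u at the
    start below b, the last one keeps v at the end below b.\<close>
  have range: "\<Phi> ` ?S \<subseteq> ?S"
  proof (rule image_subsetI)
    fix z assume "z \<in> ?S"
    then obtain y c where z: "z = (y, c)" and yc: "y \<in> {0..b}" "c \<in> {0..b}" by blast
    then have oo: "orb b w i j (u y c) (v y c)" using o by simp
    have oo': "orb b w (j - 1) j (u y c) (v y c)" by (rule orb_sub[OF oo]) (use w in auto)
    have "v y c (j - 1 + 1) = b - u y c (j - 1)" "0 \<le> u y c (j - 1)" "0 \<le> v y c (j - 1 + 1)"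
      by (rule orb_step00[OF oo']; use w in simp)+
    moreover have "v y c (i + 1) = b - u y c i" "0 \<le> u y c i" "0 \<le> v y c (i + 1)"
      by (rule orb_step00[OF oo]; use w in simp)+
    ultimately show "\<Phi> z \<in> ?S" unfolding \<Phi>_def z by simp
  qed
  have "compact ?S" "convex ?S" "?S \<noteq> {}" "\<Phi> \<in> ?S \<rightarrow> ?S"
    using b range by (simp_all add: compact_Times convex_Times image_subset_iff_funcset)
  from brouwer[OF this(1-3) cont this(4)] obtain z where z: "z \<in> ?S" "\<Phi> z = z" .
  then have nn: "0 \<le> fst z" "0 \<le> snd z" by auto
  have e: "v (fst z) (snd z) j = fst z" "u (fst z) (snd z) i = snd z"
    using arg_cong[OF z(2), of fst] arg_cong[OF z(2), of snd] by (simp_all add: \<Phi>_def)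
  show ?thesis
  proof (intro exI conjI)
    show "orb b w i j (u (fst z) (snd z)) (v (fst z) (snd z))" using o(1) nn .
    show "u (fst z) (snd z) i = u (fst z) (snd z) j" using e o(3)[OF nn] by simp
    show "v (fst z) (snd z) i = v (fst z) (snd z) j" using e o(2)[OF nn] by simp
  qed
qed

subsection \<open>Alternating stretches\<close>

text \<open>In the ratio r = (1 + v) / u the block 010 is expanding: 1 + r grows at least by the factor
  1 + 1 / u, while u loses 2 and regains at most b / r. As u grows at most linearly, the ratio
  eventually exceeds 1, and from then on u decreases, which cannot go on forever.\<close>

lemma block010_ratio:
  fixes b :: real
  assumes b: "0 < b" and nn: "0 \<le> u" "0 \<le> v" "0 \<le> u1" "0 \<le> v1" "0 < u2" "0 \<le> v2"
    and st: "u = v1 + b + 1" "u1 * u = (1 + v) * (1 + v1)"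
      "v2 = u1 + b + 1" "(1 + u2) * (1 + u1) = v1 * v2"
  shows "(1 + v) / u + 1 / u \<le> (1 + v2) / u2" "u2 \<le> u - b - 2 + b / ((1 + v) / u)"
proof -
  \<comment> \<open>With r the ratio at the start, r = u1 / (1 + v1), so (1 + r) (1 + 1 / v1) = (q +
    v1) / v1. The first claim thus reduces to an inequality in q and v1, as 1 / v1 is at least 1 /
    u.\<close>
  define q where "q = 1 + u1"
  have q: "0 < q" using nn by (simp add: q_def)
  have u: "0 < u" using st nn b by simp
  have v1: "0 < v1"
  proof -
    have "0 < (1 + u2) * (1 + u1)" using nn by (intro mult_pos_pos) auto
    then show ?thesis using st(4) nn by (metis mult_eq_0_iff less_eq_real_def less_irrefl)
  qed
  have u2: "u2 * q = (v1 - 1) * q + v1 * b"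
    using st(3,4) by (simp add: q_def algebra_simps)
  have r: "(1 + v) / u = u1 / (1 + v1)"
    using st(2) u nn by (simp add: frac_eq_eq algebra_simps)
  have "1 + u1 / (1 + v1) = (q + v1) / (1 + v1)" "1 + 1 / v1 = (1 + v1) / v1"
    using v1 by (simp_all add: q_def field_simps)
  then have "(1 + u1 / (1 + v1)) * (1 + 1 / v1) = (q + v1) / v1"
    using v1 by simp
  moreover have "(q + v1) / v1 \<le> 1 + (1 + v2) / u2"
  proof -
    have "(q + v1) * (u2 * q) \<le> v1 * ((u2 + 1 + v2) * q)"
    proof -
      have "(u2 + 1 + v2) * q = q * (q + b + v1) + v1 * b"
        using u2 st(3) by (simp add: q_def algebra_simps)
      then have "v1 * ((u2 + 1 + v2) * q) - (q + v1) * (u2 * q) = q * q + v1 * q"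
        unfolding u2 by (simp add: algebra_simps)
      moreover have "0 \<le> q * q + v1 * q" using q v1 by simp
      ultimately show ?thesis by linarith
    qed
    then have "q * ((q + v1) * u2) \<le> q * (v1 * (u2 + 1 + v2))" by (simp add: algebra_simps)
    then have "(q + v1) * u2 \<le> v1 * (u2 + 1 + v2)" using q by simp
    then have "(q + v1) / v1 \<le> (u2 + 1 + v2) / u2"
      using v1 nn by (intro iffD2[OF pos_divide_le_eq] iffD2[OF pos_le_divide_eq]) (auto simp: pos_le_divide_eq mult.commute)
    then show ?thesis using nn by (simp add: field_simps)
  qed
  moreover have "1 + u1 / (1 + v1) + 1 / u \<le> (1 + u1 / (1 + v1)) * (1 + 1 / v1)"
  proof -
    have "1 / u \<le> 1 / v1" using st v1 b by (intro divide_left_mono) auto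
    moreover have "1 * (1 / v1) \<le> (1 + u1 / (1 + v1)) * (1 / v1)"
      using v1 nn by (intro mult_right_mono) auto
    moreover have "(1 + R) * (1 + x) = 1 + R + (1 + R) * x" for R x :: real by (simp add: algebra_simps)
    ultimately show ?thesis by simp
  qed
  ultimately show "(1 + v) / u + 1 / u \<le> (1 + v2) / u2" unfolding r by linarith
  have "u2 = v1 - 1 + v1 * b / q" using u2 q by (simp add: field_simps)
  moreover have "v1 * b / q \<le> b / (u1 / (1 + v1))"
  proof -
    have "0 < (1 + v) * (1 + v1)" using nn by (intro mult_pos_pos) auto
    then have "0 < u1" using st(2) u zero_less_mult_pos2 by metis
    then have "v1 * b * u1 \<le> b * (1 + v1) * q"
      using b nn by (simp add: q_def algebra_simps)
    then show ?thesis using \<open>0 < u1\<close> q by (simp add: field_simps)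
  qed
  ultimately show "u2 \<le> u - b - 2 + b / ((1 + v) / u)" unfolding r using st b by linarith
qed

text \<open>Comparison with the harmonic series, as L + k c is at most (L + c) (k + 1). The
  threshold 1 is the value of the ratio r from which b / r is at most b, so that u loses at least 2
  per block.\<close>

lemma sum_harmonic_unbounded:
  fixes L c :: real
  assumes "0 < L" "0 \<le> c"
  shows "\<exists>N. \<forall>n\<ge>N. 1 \<le> (\<Sum>k<n. 1 / (L + real k * c))"
proof -
  define d where "d = L + c"
  have d: "0 < d" using assms by (simp add: d_def)
  have "\<not> summable (\<lambda>n. 1 / (d * real (Suc n)))"
  proof
    assume "summable (\<lambda>n. 1 / (d * real (Suc n)))"
    from summable_mult[OF this, of d] have "summable (\<lambda>n. inverse (real (Suc n)))"
      using d by (simp add: divide_inverse)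
    then have "summable (\<lambda>n. inverse (real n))"
      by (subst (asm) summable_Suc_iff[of "\<lambda>n. inverse (real n)"])
    then show False using not_summable_harmonic[where 'a = real] by simp
  qed
  moreover have "summable (\<lambda>n. 1 / (d * real (Suc n)))" if "\<And>n. (\<Sum>k<n. 1 / (d * real (Suc k))) \<le> 1"
    using that d by (intro summableI_nonneg_bounded[of _ 1]) auto
  ultimately obtain N where N: "1 < (\<Sum>k<N. 1 / (d * real (Suc k)))"
    by (metis not_le)
  have "1 \<le> (\<Sum>k<n. 1 / (L + real k * c))" if "N \<le> n" for n
  proof -
    have "(\<Sum>k<N. 1 / (d * real (Suc k))) \<le> (\<Sum>k<n. 1 / (d * real (Suc k)))"
      using that d by (intro sum_mono2) auto
    also have "\<dots> \<le> (\<Sum>k<n. 1 / (L + real k * c))"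
    proof (intro sum_mono divide_left_mono)
      fix k
      have "L * 1 \<le> L * (1 + real k)" using assms by (intro mult_left_mono) auto
      then show "L + real k * c \<le> d * real (Suc k)" using assms by (simp add: d_def algebra_simps)
    qed (use assms d in \<open>auto intro!: mult_pos_pos add_pos_nonneg\<close>)
    finally show ?thesis using N by linarith
  qed
  then show ?thesis by blast
qed

text \<open>The number N depends on b and L only, hence is uniform in words and orbits. Starting
  from u 0 at most L, the ratio is at least 1 / L, so u grows by at most b L per block; the
  increments 1 / u of the ratio then have a divergent sum.\<close>

lemma alternating_seq_bound:
  fixes b L :: real
  assumes b: "0 < b" and L: "0 < L"
  shows "\<exists>N::nat. \<forall>u r :: nat \<Rightarrow> real.
     (\<forall>k\<le>N. 0 < u k) \<longrightarrow> 1 / u 0 \<le> r 0 \<longrightarrow>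
     (\<forall>k<N. r k + 1 / u k \<le> r (Suc k) \<and> u (Suc k) \<le> u k - b - 2 + b / r k) \<longrightarrow> L < u 0"
proof -
  obtain K where K: "\<And>n. K \<le> n \<Longrightarrow> 1 \<le> (\<Sum>k<n. 1 / (L + real k * (b * L)))"
    using sum_harmonic_unbounded[of L "b * L"] b L by auto
  \<comment> \<open>K blocks to bring the ratio up to 1, by which time u is at most L + K b L; then
    enough blocks with a loss of 2 each to make u negative.\<close>
  define N where "N = K + nat \<lceil>L + real K * (b * L)\<rceil> + 1"
  show ?thesis
  proof (intro exI[of _ N] allI impI, rule ccontr)
    fix u r :: "nat \<Rightarrow> real"
    assume pos: "\<forall>k\<le>N. 0 < u k" and r0: "1 / u 0 \<le> r 0"
      and st: "\<forall>k<N. r k + 1 / u k \<le> r (Suc k) \<and> u (Suc k) \<le> u k - b - 2 + b / r k" and "\<not> L < u 0"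
    then have u0: "u 0 \<le> L" by simp
    have r0': "1 / L \<le> r 0" using r0 u0 pos L by (smt (verit) frac_le le0)
    have A: "u k \<le> L + real k * (b * L) \<and> 1 / L \<le> r k \<and> (\<Sum>i<k. 1 / (L + real i * (b * L))) \<le> r k" if "k \<le> N" for k
      using that
    proof (induction k)
      case 0
      then show ?case using u0 r0' L by (auto intro: order_trans[rotated])
    next
      case (Suc k)
      then have IH: "u k \<le> L + real k * (b * L)" "1 / L \<le> r k" "(\<Sum>i<k. 1 / (L + real i * (b * L))) \<le> r k"
        and k: "k < N" by auto
      have s: "r k + 1 / u k \<le> r (Suc k)" "u (Suc k) \<le> u k - b - 2 + b / r k" using st k by auto
      have up: "0 < u k" using pos k by simp
      have "b / r k \<le> b / (1 / L)" using IH(2) b L by (intro divide_left_mono mult_pos_pos) (auto intro: less_le_trans[of _ "1 / L"])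
      then have "b / r k \<le> b * L" by simp
      moreover have "1 / (L + real k * (b * L)) \<le> 1 / u k"
        using IH(1) up by (intro divide_left_mono) (auto intro: mult_pos_pos)
      moreover have "0 \<le> 1 / u k" using up by simp
      moreover have "real (Suc k) * (b * L) = real k * (b * L) + b * L" by (simp add: algebra_simps)
      ultimately have "u (Suc k) \<le> L + real (Suc k) * (b * L)" "1 / L \<le> r (Suc k)"
        "(\<Sum>i<k. 1 / (L + real i * (b * L))) + 1 / (L + real k * (b * L)) \<le> r (Suc k)"
        using s IH b by linarith+
      then show ?case by simp
    qed
    have C: "u (K + k) \<le> u K - 2 * real k" if "K + k \<le> N" for k
      using that
    proof (induction k)
      case (Suc k)
      have "1 \<le> r (K + k)" using A[of "K + k"] K[of "K + k"] Suc.prems by force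
      then have "b / r (K + k) \<le> b" using b by (simp add: divide_le_eq mult_le_cancel_left1)
      then show ?case using Suc st[rule_format, of "K + k"] by (simp add: algebra_simps)
    qed simp
    define m where "m = nat \<lceil>L + real K * (b * L)\<rceil> + 1"
    have N: "N = K + m" by (simp add: N_def m_def)
    have "L + real K * (b * L) \<le> real m" unfolding m_def by linarith
    moreover have "u N \<le> u K - 2 * real m" using C[of m] N by simp
    moreover have "u K \<le> L + real K * (b * L)" using A[of K] N by simp
    moreover have "0 < u N" using pos by simp
    ultimately show False by linarith
  qed
qed

text \<open>The next block 00 starts with u at most b, and going back over a block 010 raises u by
  at most b + 2. This bounds u by the distance to the next 00 alone.\<close>

lemma orb_u_bound:
  assumes b: "0 < b" and w: "no11 w" "w i = 0" and k: "i \<le> k" "k < j" "w k = 0" "w (k + 1) = 0"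
    and o: "orb b w i j u v"
  shows "u i \<le> b + real_of_int (k - i) * (b + 2)"
  using w(1) k(3) w(2) k(1) o
proof (induction i rule: backward_block_induct)
  case base
  show ?case using orb_step00(1,6)[OF base k(2,3,4)] by simp
next
  case (step00 i)
  have "i < j" using step00.hyps(1) k(2) by simp
  then have "u i \<le> b" using orb_step00(1,6)[OF step00.prems _ step00.hyps(2,3)] by simp
  moreover have "0 \<le> real_of_int (k - i) * (b + 2)" using step00.hyps(1) b by (intro mult_nonneg_nonneg) auto
  ultimately show ?case by linarith
next
  case (step010 i)
  have ij: "i + 2 \<le> j" using step010.hyps(1) k(2) by simp
  note st = orb_step010[OF step010.prems ij step010.hyps(2,3)]
  have "u (i + 2) \<le> b + real_of_int (k - (i + 2)) * (b + 2)"
    by (rule step010.IH, rule orb_sub[OF step010.prems]) auto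
  moreover have "u i \<le> u (i + 2) + b + 2"
  proof -
    have "v (i+1) * (1 + u (i+1)) \<le> v (i+1) * v (i+2)"
      using st b by (intro mult_left_mono) auto
    then have "v (i+1) * (1 + u (i+1)) \<le> (1 + u (i+2)) * (1 + u (i+1))" using st(4) by simp
    then have "v (i+1) \<le> 1 + u (i+2)" using st(7) by (simp add: mult_le_cancel_right)
    then show ?thesis using st(1) by simp
  qed
  moreover have "real_of_int (k - (i + 2)) * (b + 2) + 2 * b + 4 = real_of_int (k - i) * (b + 2)"
    by (simp add: algebra_simps)
  moreover have "u i \<le> b + x" if "u i \<le> y + b + 2" "y \<le> b + z" "z + 2 * b + 4 = x" for x y z
    using that b by linarith
  ultimately show ?case by metis
qed

lemma orb_v_bound:
  assumes b: "0 < b" and w: "no11 w" "w j = 0" and k: "i \<le> k" "k < j" "w k = 0" "w (k + 1) = 0"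
    and o: "orb b w i j u v"
  shows "v j \<le> b + real_of_int (j - k) * (b + 2)"
proof -
  have "v (- (- j)) \<le> b + real_of_int (- k - 1 - (- j)) * (b + 2)"
  proof (rule orb_u_bound[OF b no11_rev[OF w(1)] _ _ _ _ _ orb_rev[OF o]])
    show "w (- (- k - 1)) = 0" "w (- (- k - 1 + 1)) = 0" using k(3,4) by (simp_all add: add.commute)
  qed (use w k in simp_all)
  then have "v j \<le> b + (real_of_int (j - k) - 1) * (b + 2)" by (simp add: algebra_simps)
  also have "\<dots> \<le> b + real_of_int (j - k) * (b + 2)" using b by (simp add: algebra_simps)
  finally show ?thesis .
qed

lemma alternating_letters:
  assumes w: "no11 w" "w i = 0" and no: "\<And>k. i \<le> k \<Longrightarrow> k < i + 2 * int N \<Longrightarrow> \<not> (w k = 0 \<and> w (k + 1) = 0)"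
    and "m \<le> N"
  shows "w (i + 2 * int m) = 0"
  using \<open>m \<le> N\<close>
proof (induction m)
  case (Suc m)
  then have "w (i + 2 * int m + 1) \<noteq> 0" using no[of "i + 2 * int m"] by auto
  then have "w (i + 2 * int m + 1 + 1) = 0" using w(1) unfolding no11_def by blast
  then show ?case by (simp add: algebra_simps)
qed (simp add: w)

text \<open>Sampling an orbit at every second time on a stretch without 00 gives the sequences u and
  r of the abstract bound.\<close>

lemma alternating_orb_bound:
  fixes b L :: real
  assumes b: "0 < b" and L: "0 < L"
  shows "\<exists>N::nat. \<forall>w u v i. no11 w \<longrightarrow> w i = 0 \<longrightarrow>
    (\<forall>k\<in>{i..<i + 2 * int N}. \<not> (w k = 0 \<and> w (k + 1) = 0)) \<longrightarrow>
    orb b w i (i + 2 * int N) u v \<longrightarrow> L < u i"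
proof -
  from alternating_seq_bound[OF b L] obtain N where N: "\<And>u r :: nat \<Rightarrow> real.
     (\<forall>k\<le>N. 0 < u k) \<Longrightarrow> 1 / u 0 \<le> r 0 \<Longrightarrow>
     (\<forall>k<N. r k + 1 / u k \<le> r (Suc k) \<and> u (Suc k) \<le> u k - b - 2 + b / r k) \<Longrightarrow> L < u 0" by blast
  show ?thesis
  \<comment> \<open>One block beyond the N that are used: u at the last sampled time is positive
    because another block 010 starts there.\<close>
  proof (intro exI[of _ "Suc N"] allI impI)
    fix w u v i
    assume w: "no11 w" "w i = 0"
      and no: "\<forall>k\<in>{i..<i + 2 * int (Suc N)}. \<not> (w k = 0 \<and> w (k + 1) = 0)"
      and o: "orb b w i (i + 2 * int (Suc N)) u v"
    have w0: "w (i + 2 * int m) = 0" if "m \<le> Suc N" for m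
      by (rule alternating_letters[OF w _ that]) (use no in auto)
    have st: "i \<le> i + 2 * int m" "i + 2 * int m + 2 \<le> i + 2 * int (Suc N)" "w (i + 2 * int m) = 0"
      "w (i + 2 * int m + 1) \<noteq> 0" if "m \<le> N" for m
      using that w0[of m] bspec[OF no, of "i + 2 * int m"] by auto
    have o': "orb b w (i + 2 * int m) (i + 2 * int (Suc N)) u v" for m
      by (rule orb_sub[OF o]) auto
    note s = orb_step010[OF o' st(2-4)]
    define U where "U m = u (i + 2 * int m)" for m
    define r where "r m = (1 + v (i + 2 * int m)) / U m" for m
    have pos: "0 < U m" if "m \<le> N" for m
      using s(1)[OF that] s(8)[OF that] b that by (simp add: U_def)
    have e: "i + 2 * int m + 2 = i + 2 * int (Suc m)" for m by simp
    have "L < U 0"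
    proof (rule N[of U r])
      show "\<forall>k\<le>N. 0 < U k" using pos by simp
      show "1 / U 0 \<le> r 0" using pos[of 0] s(6)[of 0] unfolding r_def
        by (intro divide_right_mono) auto
      show "\<forall>k<N. r k + 1 / U k \<le> r (Suc k) \<and> U (Suc k) \<le> U k - b - 2 + b / r k"
      proof (intro allI impI)
        fix k assume k: "k < N"
        then have k': "k \<le> N" by simp
        have "0 < u (i + 2 * int k + 2)" using pos[of "Suc k"] k unfolding U_def e by simp
        from block010_ratio[OF b s(5-8)[OF k'] this s(10)[OF k'] s(1-4)[OF k']]
        show "r k + 1 / U k \<le> r (Suc k) \<and> U (Suc k) \<le> U k - b - 2 + b / r k"
          unfolding r_def U_def e using k' by blast
      qed
    qed
    then show "L < u i" by (simp add: U_def)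
  qed
qed

subsection \<open>Long orbits with the same itinerary are close\<close>

text \<open>A dominating u-difference only gives a cone of size 0. The first block turns it into
  size X / L, and from then on blocks 00 multiply. That first block ends at time 1 or 2, and
  counting from 2 is safe in both cases.\<close>

lemma dcone_growth:
  assumes b: "0 < b" and w: "no11 w" "w j = 0" "w 0 = 0" "1 \<le> j"
    and o: "orb b w 0 j u v" "orb b w 0 j p q"
    and c: "\<bar>ln (1 + q 0) - ln (1 + v 0)\<bar> \<le> \<bar>ln (1 + p 0) - ln (1 + u 0)\<bar>"
    and L: "u 0 \<le> L" "p 0 \<le> L" "0 < L"
  shows "\<bar>ln (1 + p 0) - ln (1 + u 0)\<bar> * (1 + 1 / b) ^ count00 w 2 j \<le> L * \<bar>ln (1 + p j) - ln (1 + u j)\<bar>"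
proof (cases "u 0 = p 0")
  case False
  let ?X = "\<bar>ln (1 + p 0) - ln (1 + u 0)\<bar>"
  have d: "dcone 0 (u 0) (v 0) (p 0) (q 0)"
    using c False orbD[OF o(1), of 0] orbD[OF o(2), of 0] w by (intro dconeI) auto
  have *: "?X * (1 + 1 / b) ^ count00 w 2 j \<le> L * \<bar>ln (1 + p j) - ln (1 + u j)\<bar>"
    if i: "1 \<le> i" "i \<le> 2" "i \<le> j" "w i = 0" "dcone (?X / L) (u i) (v i) (p i) (q i)" for i
  proof -
    have o': "orb b w i j u v" "orb b w i j p q" using o i by (auto intro: orb_sub)
    have "?X / L * (1 + 1 / b) ^ count00 w i j \<le> \<bar>ln (1 + p j) - ln (1 + u j)\<bar>"
      using dcone_orb[OF b w(1,2) i(4,3) o' i(5)] L dcone_lower by fastforce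
    moreover have "count00 w 2 j \<le> count00 w i j"
      unfolding count00_def using i by (intro card_mono) (auto intro: finite_subset[of _ "{i..<j}"])
    then have "?X / L * (1 + 1 / b) ^ count00 w 2 j \<le> ?X / L * (1 + 1 / b) ^ count00 w i j"
      using b L by (intro mult_left_mono power_increasing) auto
    ultimately have "?X / L * (1 + 1 / b) ^ count00 w 2 j \<le> \<bar>ln (1 + p j) - ln (1 + u j)\<bar>" by linarith
    from mult_left_mono[OF this, of L] show ?thesis using L by simp
  qed
  show ?thesis
  proof (cases "w 1 = 0")
    case True
    have "dcone (?X / L) (u 1) (v 1) (p 1) (q 1)"
      using dcone_block00[OF b o _ w(3) _ d _ L(1,2)] True w by simp
    then show ?thesis using *[of 1] True w by simp
  next
    case False
    then have "w (1 + 1) = 0" "j \<noteq> 1" using w(1,2) unfolding no11_def by blast+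
    then have "w 2 = 0" "2 \<le> j" using w(4) by simp_all
    moreover have "dcone (?X / L) (u 2) (v 2) (p 2) (q 2)"
      using dcone_block010[OF b o _ w(3) _ d _ L(1,2)] False w \<open>2 \<le> j\<close> by simp
    ultimately show ?thesis using *[of 2] by simp
  qed
qed (use L in simp)

definition has00 :: "(int \<Rightarrow> nat) \<Rightarrow> int set" where
  "has00 w = {k. w k = 0 \<and> w (k + 1) = 0}"

text \<open>The end j is itself asked to be a position of 00, so that u at time j lies in
  [0, b].\<close>

lemma infinite_has00_count:
  assumes "\<And>m. \<exists>k\<ge>m. k \<in> has00 w"
  shows "\<exists>j\<ge>m. j \<in> has00 w \<and> c \<le> count00 w 2 j"
proof (induction c)
  case 0
  then show ?case using assms[of m] by auto
next
  case (Suc c)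
  then obtain j where j: "j \<ge> m" "j \<in> has00 w" "c \<le> count00 w 2 j" by blast
  obtain j' where j': "max (j + 1) 3 \<le> j'" "j' \<in> has00 w" using assms by blast
  obtain j'' where j'': "j' + 1 \<le> j''" "j'' \<in> has00 w" using assms by blast
  have "Suc (count00 w 2 j) = card (insert j' {k\<in>{2..<j}. w k = 0 \<and> w (k + 1) = 0})"
  proof -
    have "finite {k\<in>{2..<j}. w k = 0 \<and> w (k + 1) = 0}" by (rule finite_subset[of _ "{2..<j}"]) auto
    moreover have "j' \<notin> {k\<in>{2..<j}. w k = 0 \<and> w (k + 1) = 0}" using j' by simp
    ultimately show ?thesis unfolding count00_def by (metis (no_types, lifting) card_insert_disjoint)
  qed
  also have "\<dots> \<le> count00 w 2 j''"
    unfolding count00_def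
  proof (rule card_mono)
    show "finite {k \<in> {2..<j''}. w k = 0 \<and> w (k + 1) = 0}"
      by (rule finite_subset[of _ "{2..<j''}"]) auto
    show "insert j' {k\<in>{2..<j}. w k = 0 \<and> w (k + 1) = 0} \<subseteq> {k \<in> {2..<j''}. w k = 0 \<and> w (k + 1) = 0}"
      using j j' j'' by (auto simp: has00_def)
  qed
  finally show ?case using j j' j'' Suc by (intro exI[of _ j'']) auto
qed

text \<open>If 00 recurs forever, a discrepancy at time 0 would be multiplied beyond ln (1 + b), the
  largest possible one at a position of 00. Otherwise let N0 be the last position of 00. After it
  the word alternates, so u at time N0 + 1 is huge, and the relation (1 + u') u = (1 + v) v' makes u
  at time N0 tiny for both orbits. The cone estimate carries this back to time 0. A past 00 is
  needed to bound v at time N0.\<close>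

lemma forward_contraction:
  assumes b: "0 < b" and w: "no11 w" "w 0 = 0"
    and k0: "0 \<le> k0" "k0 \<in> has00 w" and k1: "k1 < 0" "k1 \<in> has00 w" and e: "0 < e"
  shows "\<exists>N::nat. \<forall>u v p q. orb b w (- int N) (int N) u v \<longrightarrow> orb b w (- int N) (int N) p q \<longrightarrow>
     \<bar>ln (1 + q 0) - ln (1 + v 0)\<bar> \<le> \<bar>ln (1 + p 0) - ln (1 + u 0)\<bar> \<longrightarrow>
     \<bar>ln (1 + p 0) - ln (1 + u 0)\<bar> \<le> e"
proof -
  \<comment> \<open>Bounds u at time 0 through the future position k0 of 00.\<close>
  define L where "L = b + real_of_int k0 * (b + 2)"
  have L: "0 < L" using b k0 by (auto simp: L_def intro!: add_pos_nonneg)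
  have uL: "u 0 \<le> L" if "orb b w 0 j u v" "k0 < j" for u v j
    using orb_u_bound[OF b w k0(1) that(2) _ _ that(1)] k0 by (auto simp: L_def has00_def)
  have ub: "0 \<le> u j" "u j \<le> b" if "orb b w 0 (j + 1) u v" "j \<in> has00 w" "0 \<le> j" for u v j
    using orb_step00(1,3,6)[of b w j "j+1" u v] orb_sub[OF that(1), of j "j+1"] that by (auto simp: has00_def)
  show ?thesis
  proof (cases "\<forall>m. \<exists>k\<ge>m. k \<in> has00 w")
    case True
    have "(\<lambda>c. L * ln (1 + b) * (1 / (1 + 1 / b)) ^ c) \<longlonglongrightarrow> L * ln (1 + b) * 0"
      using b by (intro tendsto_intros LIMSEQ_realpow_zero) (auto simp: divide_simps add_pos_pos)
    then have "\<forall>\<^sub>F c in sequentially. L * ln (1 + b) * (1 / (1 + 1 / b)) ^ c < e"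
      using e by (simp add: order_tendsto_iff)
    then obtain c where c: "L * ln (1 + b) * (1 / (1 + 1 / b)) ^ c < e"
      by (auto simp: eventually_sequentially)
    obtain j where j: "max 1 (k0 + 1) \<le> j" "j \<in> has00 w" "c \<le> count00 w 2 j"
      using infinite_has00_count[of w "max 1 (k0+1)" c] True by blast
    show ?thesis
    proof (intro exI[of _ "nat (j + 1)"] allI impI)
      fix u v p q
      assume o: "orb b w (- int (nat (j + 1))) (int (nat (j + 1))) u v"
        "orb b w (- int (nat (j + 1))) (int (nat (j + 1))) p q"
        and h: "\<bar>ln (1 + q 0) - ln (1 + v 0)\<bar> \<le> \<bar>ln (1 + p 0) - ln (1 + u 0)\<bar>"
      have o1: "orb b w 0 (j + 1) u v" "orb b w 0 (j + 1) p q"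
        using orb_sub[OF o(1), of 0 "j+1"] orb_sub[OF o(2), of 0 "j+1"] j by simp_all
      have o2: "orb b w 0 j u v" "orb b w 0 j p q"
        using orb_sub[OF o1(1), of 0 j] orb_sub[OF o1(2), of 0 j] by simp_all
      let ?X = "\<bar>ln (1 + p 0) - ln (1 + u 0)\<bar>"
      have "?X * (1 + 1 / b) ^ count00 w 2 j \<le> L * \<bar>ln (1 + p j) - ln (1 + u j)\<bar>"
        using dcone_growth[OF b w(1) _ w(2) _ o2 h uL[OF o2(1)] uL[OF o2(2)] L] j by (simp add: has00_def)
      moreover have "?X * (1 + 1 / b) ^ c \<le> ?X * (1 + 1 / b) ^ count00 w 2 j"
        using b j by (intro mult_left_mono power_increasing) auto
      moreover have "\<bar>ln (1 + p j) - ln (1 + u j)\<bar> \<le> ln (1 + b)"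
      proof -
        have B: "0 \<le> u j" "u j \<le> b" "0 \<le> p j" "p j \<le> b"
          using ub[OF o1(1)] ub[OF o1(2)] j by simp_all
        then have "0 \<le> ln (1 + u j)" "ln (1 + u j) \<le> ln (1 + b)" "0 \<le> ln (1 + p j)" "ln (1 + p j) \<le> ln (1 + b)"
          by simp_all
        then show ?thesis by linarith
      qed
      then have "L * \<bar>ln (1 + p j) - ln (1 + u j)\<bar> \<le> L * ln (1 + b)" using L by simp
      ultimately have "?X * (1 + 1 / b) ^ c \<le> L * ln (1 + b)" by linarith
      then have "?X \<le> L * ln (1 + b) / (1 + 1 / b) ^ c"
        using b by (subst pos_le_divide_eq) (auto intro!: zero_less_power add_pos_pos)
      also have "\<dots> = L * ln (1 + b) * (1 / (1 + 1 / b)) ^ c" by (simp add: power_one_over)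
      finally show "?X \<le> e" using c by simp
    qed
  next
    case False
    then obtain m where "\<not> (\<exists>k\<ge>m. k \<in> has00 w)" by blast
    then have m: "k < m" if "k \<in> has00 w" for k using that not_le by blast
    define N0 where "N0 = Max (has00 w \<inter> {0..m})"
    have fin: "finite (has00 w \<inter> {0..m})" by simp
    have k0m: "k0 \<in> has00 w \<inter> {0..m}" using k0 m[of k0] by simp
    have N0: "N0 \<in> has00 w" "0 \<le> N0" "k0 \<le> N0"
    proof -
      have "N0 \<in> has00 w \<inter> {0..m}" unfolding N0_def using k0m by (intro Max_in[OF fin]) blast
      then show "N0 \<in> has00 w" "0 \<le> N0" by simp_all
      show "k0 \<le> N0" unfolding N0_def by (rule Max_ge[OF fin k0m])
    qed
    have last: "k \<notin> has00 w" if "N0 < k" for k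
    proof
      assume "k \<in> has00 w"
      then have "k \<in> has00 w \<inter> {0..m}" using that N0(2) m[of k] by simp
      from Max_ge[OF fin this] that show False by (simp add: N0_def)
    qed
    \<comment> \<open>Bounds v at time N0 through the past position k1 of 00.\<close>
    define M where "M = b + real_of_int (N0 - k1) * (b + 2)"
    have M: "0 < M" using N0 k1 b by (auto simp: M_def intro!: add_pos_nonneg)
    \<comment> \<open>The growth estimate needs at least one step; the maximum with 1 lets the same
      bound cover N0 = 0.\<close>
    define L1 where "L1 = max L 1"
    \<comment> \<open>Chosen so that L2 u, at most (1 + M) b, gives u at most e / L1 at time N0; the
      factor L1 is lost on the way back to time 0.\<close>
    define L2 where "L2 = (1 + M) * b * L1 / e"
    have L2: "0 < L2" using M b e by (auto simp: L2_def L1_def)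
    from alternating_orb_bound[OF b L2] obtain N1 where N1: "\<And>w u v i. no11 w \<Longrightarrow> w i = 0 \<Longrightarrow>
        (\<forall>k\<in>{i..<i + 2 * int N1}. \<not> (w k = 0 \<and> w (k + 1) = 0)) \<Longrightarrow>
        orb b w i (i + 2 * int N1) u v \<Longrightarrow> L2 < u i" by blast
    define N where "N = nat (max (N0 + 1 + 2 * int N1) (- k1))"
    have N: "N0 + 1 + 2 * int N1 \<le> int N" "- int N \<le> k1" using k1 by (auto simp: N_def)
    have small: "0 \<le> u N0 \<and> u N0 \<le> e / L1" if o: "orb b w (- int N) (int N) u v" for u v
    proof -
      have w0: "w N0 = 0" "w (N0 + 1) = 0" using N0 by (auto simp: has00_def)
      have "orb b w N0 (N0 + 1) u v" by (rule orb_sub[OF o]) (use N N0 in auto)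
      note st = orb_step00[OF this _ w0, simplified]
      have "orb b w (- int N) N0 u v" by (rule orb_sub[OF o]) (use N N0 in auto)
      from orb_v_bound[OF b w(1) w0(1) N(2) _ _ _ this] k1 N0 have vM: "v N0 \<le> M"
        by (auto simp: M_def has00_def)
      have "L2 < u (N0 + 1)"
      proof (rule N1[OF w(1) w0(2)])
        show "\<forall>k\<in>{N0 + 1..<N0 + 1 + 2 * int N1}. \<not> (w k = 0 \<and> w (k + 1) = 0)"
          using last unfolding has00_def mem_Collect_eq by simp
        show "orb b w (N0 + 1) (N0 + 1 + 2 * int N1) u v" by (rule orb_sub[OF o]) (use N N0 in auto)
      qed
      then have "L2 * u N0 \<le> (1 + u (N0 + 1)) * u N0" using st by (intro mult_right_mono) auto
      also have "\<dots> = (1 + v N0) * v (N0 + 1)" using st(2) .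
      also have "\<dots> \<le> (1 + M) * b" using st vM M by (intro mult_mono) auto
      finally have "L2 * u N0 \<le> L2 * (e / L1)" using e b M by (simp add: L2_def L1_def)
      from mult_left_le_imp_le[OF this L2] show ?thesis using st(3) by simp
    qed
    show ?thesis
    proof (intro exI[of _ N] allI impI)
      fix u v p q
      assume o: "orb b w (- int N) (int N) u v" "orb b w (- int N) (int N) p q"
        and h: "\<bar>ln (1 + q 0) - ln (1 + v 0)\<bar> \<le> \<bar>ln (1 + p 0) - ln (1 + u 0)\<bar>"
      let ?X = "\<lambda>k. \<bar>ln (1 + p k) - ln (1 + u k)\<bar>"
      have XN: "?X N0 \<le> e / L1"
      proof -
        have "0 \<le> ln (1 + u N0)" "ln (1 + u N0) \<le> u N0" "0 \<le> ln (1 + p N0)" "ln (1 + p N0) \<le> p N0"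
          using small[OF o(1)] small[OF o(2)] ln_add_one_self_le_self by auto
        then show ?thesis using small[OF o(1)] small[OF o(2)] by linarith
      qed
      have "?X 0 \<le> L1 * ?X N0"
      proof (cases "N0 = 0")
        case True
        have "1 * ?X 0 \<le> L1 * ?X 0" by (intro mult_right_mono) (auto simp: L1_def)
        then show ?thesis using True by simp
      next
        case False
        have o1: "orb b w 0 (N0 + 1) u v" "orb b w 0 (N0 + 1) p q"
          using orb_sub[OF o(1), of 0 "N0 + 1"] orb_sub[OF o(2), of 0 "N0 + 1"] N by simp_all
        have o2: "orb b w 0 N0 u v" "orb b w 0 N0 p q"
          using orb_sub[OF o1(1), of 0 N0] orb_sub[OF o1(2), of 0 N0] by simp_all
        have A: "?X 0 * (1 + 1 / b) ^ count00 w 2 N0 \<le> L * ?X N0"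
          using dcone_growth[OF b w(1) _ w(2) _ o2 h uL[OF o1(1)] uL[OF o1(2)] L] N0 False by (simp add: has00_def)
        have B: "?X 0 * 1 \<le> ?X 0 * (1 + 1 / b) ^ count00 w 2 N0"
          using b by (intro mult_left_mono one_le_power) auto
        have C: "L * ?X N0 \<le> L1 * ?X N0" by (intro mult_right_mono) (auto simp: L1_def)
        show ?thesis using order_trans[OF B order_trans[OF A C]] unfolding mult_1_right .
      qed
      also have "\<dots> \<le> L1 * (e / L1)" using XN by (intro mult_left_mono) (auto simp: L1_def)
      also have "\<dots> = e" by (simp add: L1_def)
      finally show "?X 0 \<le> e" .
    qed
  qed
qed

text \<open>A block is recorded by its first letter, and reversal makes the last letter first; hence
  the shift by one.\<close>

lemma has00_rev: "k \<in> has00 (\<lambda>k. w (- k)) \<longleftrightarrow> - k - 1 \<in> has00 w"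
  by (auto simp: has00_def)

text \<open>If the u-difference dominates at time 0, the future contracts it and it controls the
  v-difference; if the v-difference dominates, the same holds for the reversed orbits.\<close>

lemma orb_contraction_log:
  assumes b: "0 < b" and w: "no11 w" "w 0 = 0"
    and k0: "0 \<le> k0" "k0 \<in> has00 w" and k1: "k1 < 0" "k1 \<in> has00 w" and e: "0 < e"
  shows "\<exists>N::nat. \<forall>u v p q. orb b w (- int N) (int N) u v \<longrightarrow> orb b w (- int N) (int N) p q \<longrightarrow>
     \<bar>ln (1 + p 0) - ln (1 + u 0)\<bar> \<le> e \<and> \<bar>ln (1 + q 0) - ln (1 + v 0)\<bar> \<le> e"
proof -
  obtain N1 where N1: "\<And>u v p q. orb b w (- int N1) (int N1) u v \<Longrightarrow> orb b w (- int N1) (int N1) p q \<Longrightarrow>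
     \<bar>ln (1 + q 0) - ln (1 + v 0)\<bar> \<le> \<bar>ln (1 + p 0) - ln (1 + u 0)\<bar> \<Longrightarrow>
     \<bar>ln (1 + p 0) - ln (1 + u 0)\<bar> \<le> e"
    using forward_contraction[OF b w k0 k1 e] by blast
  have "\<exists>N::nat. \<forall>u v p q. orb b (\<lambda>k. w (- k)) (- int N) (int N) u v \<longrightarrow> orb b (\<lambda>k. w (- k)) (- int N) (int N) p q \<longrightarrow>
     \<bar>ln (1 + q 0) - ln (1 + v 0)\<bar> \<le> \<bar>ln (1 + p 0) - ln (1 + u 0)\<bar> \<longrightarrow>
     \<bar>ln (1 + p 0) - ln (1 + u 0)\<bar> \<le> e"
    by (rule forward_contraction[OF b no11_rev[OF w(1)], of "- k1 - 1" "- k0 - 1"])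
      (use w k0 k1 e in \<open>simp_all add: has00_rev\<close>)
  then obtain N2 where N2: "\<And>u v p q. orb b (\<lambda>k. w (- k)) (- int N2) (int N2) u v \<Longrightarrow>
     orb b (\<lambda>k. w (- k)) (- int N2) (int N2) p q \<Longrightarrow>
     \<bar>ln (1 + q 0) - ln (1 + v 0)\<bar> \<le> \<bar>ln (1 + p 0) - ln (1 + u 0)\<bar> \<Longrightarrow>
     \<bar>ln (1 + p 0) - ln (1 + u 0)\<bar> \<le> e" by blast
  show ?thesis
  proof (intro exI[of _ "max N1 N2"] allI impI)
    fix u v p q
    assume o: "orb b w (- int (max N1 N2)) (int (max N1 N2)) u v" "orb b w (- int (max N1 N2)) (int (max N1 N2)) p q"
    have o1: "orb b w (- int N1) (int N1) u v" "orb b w (- int N1) (int N1) p q"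
      by (rule orb_sub[OF o(1)]; simp) (rule orb_sub[OF o(2)]; simp)
    have o2: "orb b w (- int N2) (int N2) u v" "orb b w (- int N2) (int N2) p q"
      by (rule orb_sub[OF o(1)]; simp) (rule orb_sub[OF o(2)]; simp)
    note r = orb_rev[OF o2(1), unfolded minus_minus] orb_rev[OF o2(2), unfolded minus_minus]
    show "\<bar>ln (1 + p 0) - ln (1 + u 0)\<bar> \<le> e \<and> \<bar>ln (1 + q 0) - ln (1 + v 0)\<bar> \<le> e"
    proof (cases "\<bar>ln (1 + q 0) - ln (1 + v 0)\<bar> \<le> \<bar>ln (1 + p 0) - ln (1 + u 0)\<bar>")
      case True
      then show ?thesis using N1[OF o1 True] by linarith
    next
      case False
      then show ?thesis using N2[OF r] by simp
    qed
  qed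
qed

lemma diff_le_of_ln_diff:
  fixes x y :: real
  assumes "0 \<le> x" "x \<le> L" "0 \<le> y" "y \<le> L" "\<bar>ln (1 + y) - ln (1 + x)\<bar> \<le> e"
  shows "\<bar>x - y\<bar> \<le> (1 + L) * e"
proof -
  have *: "y - x \<le> (1 + L) * (ln (1 + y) - ln (1 + x))" if "0 \<le> x" "x \<le> y" "y \<le> L" for x y
  proof -
    have "ln ((1 + x) / (1 + y)) \<le> (1 + x) / (1 + y) - 1" using that by (intro ln_le_minus_one) auto
    then have "(y - x) / (1 + y) \<le> ln (1 + y) - ln (1 + x)" using that by (simp add: ln_div field_simps)
    then have "y - x \<le> (ln (1 + y) - ln (1 + x)) * (1 + y)" using that by (simp add: pos_divide_le_eq)
    also have "\<dots> \<le> (ln (1 + y) - ln (1 + x)) * (1 + L)" using that by (intro mult_left_mono) auto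
    finally show ?thesis by (simp add: mult.commute)
  qed
  have "\<bar>x - y\<bar> \<le> (1 + L) * \<bar>ln (1 + y) - ln (1 + x)\<bar>"
  proof (cases "x \<le> y")
    case True
    then show ?thesis using *[of x y] assms by simp
  next
    case False
    then show ?thesis using *[of y x] assms by (simp add: abs_minus_commute)
  qed
  also have "\<dots> \<le> (1 + L) * e" using assms by (intro mult_left_mono) auto
  finally show ?thesis .
qed

lemma orb_contraction0:
  assumes b: "0 < b" and w: "no11 w" "w 0 = 0"
    and k0: "0 \<le> k0" "k0 \<in> has00 w" and k1: "k1 < 0" "k1 \<in> has00 w" and e: "0 < e"
  shows "\<exists>N::nat. \<forall>u v p q. orb b w (- int N) (int N) u v \<longrightarrow> orb b w (- int N) (int N) p q \<longrightarrow>
     \<bar>u 0 - p 0\<bar> \<le> e \<and> \<bar>v 0 - q 0\<bar> \<le> e"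
proof -
  define L where "L = b + real_of_int (max k0 (- k1)) * (b + 2)"
  have L: "0 < L" using b k0 by (auto simp: L_def intro!: add_pos_nonneg)
  have eL: "0 < e / (1 + L)" using e L by simp
  obtain N where N: "\<And>u v p q. orb b w (- int N) (int N) u v \<Longrightarrow> orb b w (- int N) (int N) p q \<Longrightarrow>
     \<bar>ln (1 + p 0) - ln (1 + u 0)\<bar> \<le> e / (1 + L) \<and> \<bar>ln (1 + q 0) - ln (1 + v 0)\<bar> \<le> e / (1 + L)"
    using orb_contraction_log[OF b w k0 k1 eL] by blast
  define M where "M = max N (nat (max (k0 + 1) (- k1)))"
  have M: "N \<le> M" "k0 < int M" "- int M \<le> k1" using k0 k1 by (auto simp: M_def)
  have bd: "0 \<le> u 0" "u 0 \<le> L" "0 \<le> v 0" "v 0 \<le> L" if o: "orb b w (- int M) (int M) u v" for u v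
  proof -
    show "0 \<le> u 0" "0 \<le> v 0" using orbD[OF o, of 0] by auto
    have "orb b w 0 (int M) u v" by (rule orb_sub[OF o]) auto
    from orb_u_bound[OF b w k0(1) M(2) _ _ this] k0(2) have "u 0 \<le> b + real_of_int k0 * (b + 2)"
      by (simp add: has00_def)
    also have "\<dots> \<le> L" unfolding L_def using b by (intro add_left_mono mult_right_mono) auto
    finally show "u 0 \<le> L" .
    have "orb b w (- int M) 0 u v" by (rule orb_sub[OF o]) auto
    from orb_v_bound[OF b w M(3) k1(1) _ _ this] k1(2) have "v 0 \<le> b + real_of_int (- k1) * (b + 2)"
      by (simp add: has00_def)
    also have "\<dots> \<le> L" unfolding L_def using b by (intro add_left_mono mult_right_mono) auto
    finally show "v 0 \<le> L" .
  qed
  show ?thesis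
  proof (intro exI[of _ M] allI impI)
    fix u v p q
    assume o: "orb b w (- int M) (int M) u v" "orb b w (- int M) (int M) p q"
    have "orb b w (- int N) (int N) u v" "orb b w (- int N) (int N) p q"
      using orb_sub[OF o(1), of "- int N" "int N"] orb_sub[OF o(2), of "- int N" "int N"] M(1) by simp_all
    from N[OF this] show "\<bar>u 0 - p 0\<bar> \<le> e \<and> \<bar>v 0 - q 0\<bar> \<le> e"
      using diff_le_of_ln_diff[OF bd(1,2)[OF o(1)] bd(1,2)[OF o(2)]]
        diff_le_of_ln_diff[OF bd(3,4)[OF o(1)] bd(3,4)[OF o(2)]] L by fastforce
  qed
qed

text \<open>The cone estimates start at a letter 0. If the letter at time 0 is 1, the next one is 0
  and closeness holds at time 1; it is pulled back by u 0 = v 1 - b - 1 and v 0 = (1 + u 1) (1 - b /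
  v 1).\<close>

lemma orb_contraction:
  assumes b: "0 < b" and w: "no11 w"
    and k0: "0 \<le> k0" "k0 \<in> has00 w" and k1: "k1 < 0" "k1 \<in> has00 w" and e: "0 < e"
  shows "\<exists>N::nat. \<forall>u v p q. orb b w (- int N) (int N) u v \<longrightarrow> orb b w (- int N) (int N) p q \<longrightarrow>
     \<bar>u 0 - p 0\<bar> \<le> e \<and> \<bar>v 0 - q 0\<bar> \<le> e"
proof (cases "w 0 = 0")
  case True
  then show ?thesis using orb_contraction0[OF b w _ k0 k1 e] by simp
next
  case False
  then have w1: "w 1 = 0" using w unfolding no11_def by (metis add_0)
  have k0': "1 \<le> k0" using k0 False by (cases "k0 = 0") (auto simp: has00_def)
  define w' where "w' k = w (k + 1)" for k
  have w': "no11 w'" "w' 0 = 0" using no11_shift[OF w] w1 unfolding w'_def by auto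
  have h: "k0 - 1 \<in> has00 w'" "k1 - 1 \<in> has00 w'" using k0 k1 by (auto simp: has00_def w'_def add.commute)
  define L where "L = b + real_of_int (k0 - 1) * (b + 2)"
  have L: "0 < L" using b k0' by (auto simp: L_def intro!: add_pos_nonneg)
  \<comment> \<open>2 + L is the Lipschitz constant of this pullback: 1 from the factor 1 + u 1, and
    1 + L from b / v 1, since u at time 1 is at most L and v at time 1 is at least b + 1.\<close>
  define e' where "e' = e / (2 + L)"
  have e': "0 < e'" "(2 + L) * e' = e" using e L by (auto simp: e'_def)
  have "0 \<le> k0 - 1" "k1 - 1 < 0" using k0' k1(1) by auto
  from orb_contraction0[OF b w' this(1) h(1) this(2) h(2) e'(1)] obtain N where
    N: "\<And>u v p q. orb b w' (- int N) (int N) u v \<Longrightarrow> orb b w' (- int N) (int N) p q \<Longrightarrow>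
      \<bar>u 0 - p 0\<bar> \<le> e' \<and> \<bar>v 0 - q 0\<bar> \<le> e'" by blast
  define M where "M = max (N + 1) (nat (k0 + 1))"
  have M: "int N + 1 \<le> int M" "k0 < int M" using k0 by (auto simp: M_def)
  show ?thesis
  proof (intro exI[of _ M] allI impI)
    fix u v p q
    assume o: "orb b w (- int M) (int M) u v" "orb b w (- int M) (int M) p q"
    have sh: "orb b w' (- int N) (int N) (\<lambda>k. u (k + 1)) (\<lambda>k. v (k + 1))"
      if "orb b w (- int M) (int M) u v" for u v
    proof -
      have "orb b w (- int N + 1) (int N + 1) u v" by (rule orb_sub[OF that]) (use M in auto)
      then show ?thesis unfolding orb_shift w'_def .
    qed
    have st: "v 1 = u 0 + b + 1 \<and> (1 + u 1) * (1 + u 0) = v 0 * v 1 \<and> 0 \<le> u 0 \<and> 0 \<le> v 0 \<and> 0 \<le> u 1 \<and> u 1 \<le> L"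
      if o: "orb b w (- int M) (int M) u v" for u v
    proof -
      have "step b (w 0) (w (0 + 1)) (u 0) (v 0) (u (0 + 1)) (v (0 + 1))"
        by (rule orb_step[OF o]) (use M in auto)
      moreover have "orb b w 1 (int M) u v" by (rule orb_sub[OF o]) auto
      then have "u 1 \<le> L" using orb_u_bound[OF b w w1 k0' M(2)] k0(2) by (simp add: L_def has00_def)
      ultimately show ?thesis using orbD[OF o, of 0] orbD[OF o, of 1] False w1 M by (simp add: step_def)
    qed
    have d: "\<bar>u 1 - p 1\<bar> \<le> e'" "\<bar>v 1 - q 1\<bar> \<le> e'"
      using N[OF sh[OF o(1)] sh[OF o(2)]] by auto
    note U = st[OF o(1)] and P = st[OF o(2)]
    have eq: "x0 = (1 + x1) * (1 - b / y1)" if "y1 = t + b + 1" "(1 + x1) * (1 + t) = x0 * y1" "0 \<le> t" for x0 x1 y1 t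
    proof -
      have y: "0 < y1" using that b by simp
      have "1 - b / y1 = (1 + t) / y1" using y that(1) by (simp add: field_simps)
      then show ?thesis using that(2) y by (simp add: field_simps)
    qed
    have "v 0 = (1 + u 1) * (1 - b / v 1)" "q 0 = (1 + p 1) * (1 - b / q 1)"
      using eq[of "v 1" "u 0" "u 1" "v 0"] eq[of "q 1" "p 0" "p 1" "q 0"] U P by auto
    moreover have "(1 + x) * (1 - r) - (1 + y) * (1 - t) = (x - y) * (1 - r) + (1 + y) * (t - r)" for x y r t :: real
      by (simp add: algebra_simps)
    ultimately have "v 0 - q 0 = (u 1 - p 1) * (1 - b / v 1) + (1 + p 1) * (b / q 1 - b / v 1)"
      by (simp only:)
    then have "\<bar>v 0 - q 0\<bar> \<le> \<bar>(u 1 - p 1) * (1 - b / v 1)\<bar> + \<bar>(1 + p 1) * (b / q 1 - b / v 1)\<bar>"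
      by (simp only: abs_triangle_ineq)
    also have "\<bar>(u 1 - p 1) * (1 - b / v 1)\<bar> \<le> e' * 1"
      unfolding abs_mult using d U b e' by (intro mult_mono) (auto simp: abs_le_iff)
    also have "\<bar>(1 + p 1) * (b / q 1 - b / v 1)\<bar> \<le> (1 + L) * e'"
      unfolding abs_mult
    proof (rule mult_mono)
      have V: "b + 1 \<le> v 1" "b + 1 \<le> q 1" using U P by auto
      have "b * 1 \<le> q 1 * v 1" using V b by (intro mult_mono) auto
      then have "b / (q 1 * v 1) \<le> 1" using V b by (simp add: divide_le_eq)
      moreover have "b / q 1 - b / v 1 = b / (q 1 * v 1) * (v 1 - q 1)" using V b by (simp add: field_simps)
      then have "\<bar>b / q 1 - b / v 1\<bar> = b / (q 1 * v 1) * \<bar>v 1 - q 1\<bar>"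
        using V b by (simp add: abs_mult)
      ultimately have "\<bar>b / q 1 - b / v 1\<bar> \<le> 1 * \<bar>v 1 - q 1\<bar>"
        by (metis abs_ge_zero mult_right_mono)
      then show "\<bar>b / q 1 - b / v 1\<bar> \<le> e'" using d by simp
    qed (use P L in auto)
    finally have "\<bar>v 0 - q 0\<bar> \<le> (2 + L) * e'" by (simp add: algebra_simps)
    moreover have "\<bar>u 0 - p 0\<bar> \<le> e'" using d(2) U P by simp
    moreover have "1 * e' \<le> (2 + L) * e'" using e' L by (intro mult_right_mono) auto
    ultimately show "\<bar>u 0 - p 0\<bar> \<le> e \<and> \<bar>v 0 - q 0\<bar> \<le> e" using e'(2) by simp
  qed
qed

section \<open>Occurrence of the block 00 on both sides in the word of a finite point\<close>

text \<open>Without a later 00 the word alternates from its first letter 0 on, which stands at time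
  0 or 1. Then u at that time exceeds any given bound as soon as the segment is long enough.\<close>

lemma has00_forward:
  assumes b: "0 < b" and w: "no11 w"
    and o: "\<And>n::nat. \<exists>u v. orb b w (- int n) (int n) u v \<and> u 0 \<le> C \<and> v 0 \<le> C"
  shows "\<exists>k\<ge>0. k \<in> has00 w"
proof (rule ccontr)
  assume no: "\<not> (\<exists>k\<ge>0. k \<in> has00 w)"
  \<comment> \<open>If the first 0 is at time 1, then v 1 = u 0 + b + 1 is at most (b + 1) (1 + u
    0), so 1 + u 1 is at most (b + 1) v 0.\<close>
  define L where "L = max 1 (C * (b + 1))"
  have "0 < L" by (simp add: L_def)
  from alternating_orb_bound[OF b this] obtain N where N: "\<And>w u v i. no11 w \<Longrightarrow> w i = 0 \<Longrightarrow>
      (\<forall>k\<in>{i..<i + 2 * int N}. \<not> (w k = 0 \<and> w (k + 1) = 0)) \<Longrightarrow>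
      orb b w i (i + 2 * int N) u v \<Longrightarrow> L < u i" by blast
  have no': "\<forall>k\<in>{i..<i + 2 * int N}. \<not> (w k = 0 \<and> w (k + 1) = 0)" if "0 \<le> i" for i
    using no that unfolding has00_def mem_Collect_eq by (meson atLeastLessThan_iff order_trans)
  obtain u v where o': "orb b w (- int (2 * N + 1)) (int (2 * N + 1)) u v" and C: "u 0 \<le> C" "v 0 \<le> C"
    using o by blast
  have nn: "0 \<le> u 0" "0 \<le> v 0" "0 \<le> u 1" using orbD[OF o', of 0] orbD[OF o', of 1] by auto
  have CL: "C * 1 \<le> C * (b + 1)" using nn C b by (intro mult_left_mono) auto
  show False
  proof (cases "w 0 = 0")
    case True
    have "orb b w 0 (0 + 2 * int N) u v" by (rule orb_sub[OF o']) auto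
    from N[OF w True no' this] C CL show False by (simp add: L_def)
  next
    case False
    then have w1: "w 1 = 0" using w unfolding no11_def by (metis add_0)
    have "step b (w 0) (w (0 + 1)) (u 0) (v 0) (u (0 + 1)) (v (0 + 1))"
      by (rule orb_step[OF o']) auto
    then have s: "v 1 = u 0 + b + 1" "(1 + u 1) * (1 + u 0) = v 0 * v 1"
      using False w1 by (auto simp: step_def)
    have "v 0 * v 1 \<le> v 0 * ((b + 1) * (1 + u 0))"
      using s(1) nn b by (intro mult_left_mono) (auto simp: algebra_simps)
    then have "(1 + u 1) * (1 + u 0) \<le> (v 0 * (b + 1)) * (1 + u 0)" using s(2) by (simp add: mult.assoc)
    then have "1 + u 1 \<le> v 0 * (b + 1)" using nn by (simp add: mult_le_cancel_right)
    also have "\<dots> \<le> C * (b + 1)" using C b by (intro mult_right_mono) auto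
    finally have "u 1 \<le> L" by (simp add: L_def)
    moreover have "orb b w 1 (1 + 2 * int N) u v" by (rule orb_sub[OF o']) auto
    from N[OF w w1 no' this] have "L < u 1" by simp
    ultimately show False by simp
  qed
qed

lemma has00_backward:
  assumes b: "0 < b" and w: "no11 w"
    and o: "\<And>n::nat. \<exists>u v. orb b w (- int n) (int n) u v \<and> u 0 \<le> C \<and> v 0 \<le> C"
  shows "\<exists>k<0. k \<in> has00 w"
proof -
  have "\<exists>k\<ge>0. k \<in> has00 (\<lambda>k. w (- k))"
  proof (rule has00_forward[OF b no11_rev[OF w]])
    fix n :: nat
    obtain u v where "orb b w (- int n) (int n) u v" "u 0 \<le> C" "v 0 \<le> C" using o by blast
    then show "\<exists>u v. orb b (\<lambda>k. w (- k)) (- int n) (int n) u v \<and> u 0 \<le> C \<and> v 0 \<le> C"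
      using orb_rev[of b w "- int n" "int n" u v] by (intro exI[of _ "\<lambda>k. v (- k)"] exI[of _ "\<lambda>k. u (- k)"]) simp
  qed
  then obtain k where "0 \<le> k" "- k - 1 \<in> has00 w" by (auto simp: has00_rev)
  then show ?thesis by (intro exI[of _ "- k - 1"]) auto
qed

subsection \<open>The limit point determines the word\<close>

text \<open>Limits of a sequence of points: Inl is a finite limit; Inr z is a limit with exactly one infinite
  coordinate, which is u in the state 0 and v in the state 1, the other one being z.\<close>

fun conv :: "nat \<Rightarrow> (nat \<Rightarrow> real) \<Rightarrow> (nat \<Rightarrow> real) \<Rightarrow> real \<times> real + real \<Rightarrow> bool" where
  "conv s x y (Inl (X, Y)) \<longleftrightarrow> x \<longlonglongrightarrow> X \<and> y \<longlonglongrightarrow> Y"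
| "conv s x y (Inr z) \<longleftrightarrow> (if s = 0 then filterlim x at_top sequentially \<and> y \<longlonglongrightarrow> z
     else filterlim y at_top sequentially \<and> x \<longlonglongrightarrow> z)"

text \<open>Only eventually in n, because the n-th orbit segment covers a given time only for large
  n.\<close>

definition step_seq :: "real \<Rightarrow> nat \<Rightarrow> nat \<Rightarrow> (nat \<Rightarrow> real) \<Rightarrow> (nat \<Rightarrow> real) \<Rightarrow> (nat \<Rightarrow> real) \<Rightarrow> (nat \<Rightarrow> real) \<Rightarrow> bool" where
  "step_seq b s t x y x' y' \<longleftrightarrow> (\<forall>\<^sub>F n in sequentially.
     0 \<le> x n \<and> 0 \<le> y n \<and> 0 \<le> x' n \<and> 0 \<le> y' n \<and> step b s t (x n) (y n) (x' n) (y' n))"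

text \<open>The next letter can be read off the limit: a step to 0 needs u at most b and a step to 1
  needs u at least b + 1, and this gap survives in the limit. The letter and the new limit precede
  the sequences in the quantifiers, so two orbits with the same limit can be advanced
  together.\<close>

lemma conv_step_fin0:
  fixes b X Y :: real
  assumes b: "0 < b"
  shows "\<exists>s' c'. \<forall>t x y x' y'. t \<in> {0, 1} \<longrightarrow> conv 0 x y (Inl (X, Y)) \<longrightarrow> step_seq b 0 t x y x' y' \<longrightarrow>
    t = s' \<and> conv s' x' y' c'"
proof -
  define s' where "s' = (if X \<le> b then 0 else 1 :: nat)"
  \<comment> \<open>At X = 0 the point tends to the indeterminacy point of the boundary or to its
    line: u' becomes infinite while v' tends to b, whatever Y is.\<close>
  define c' where "c' = (if X \<le> b then if X = 0 then Inr b else Inl ((1 + Y) * (b - X) / X - 1, b - X)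
    else Inl ((1 + Y) * (1 + (X - b - 1)) / X, X - b - 1))"
  have "t = s' \<and> conv s' x' y' c'"
    if t: "t \<in> {0, 1}" and c: "conv 0 x y (Inl (X, Y))" and s: "step_seq b 0 t x y x' y'" for t x y x' y'
  proof (cases "t = 0")
    case True
    have lim: "x \<longlonglongrightarrow> X" "y \<longlonglongrightarrow> Y" using c by auto
    have s: "\<forall>\<^sub>F n in sequentially. 0 \<le> x n \<and> 0 \<le> y n \<and> 0 \<le> x' n \<and> 0 \<le> y' n \<and>
        y' n = b - x n \<and> (1 + x' n) * x n = (1 + y n) * y' n"
      using s True unfolding step_seq_def step_def by simp
    have Y: "0 \<le> Y" using lim(2) s by (intro tendsto_lowerbound[of y Y sequentially]) (auto elim: eventually_mono)
    have "X \<le> b" using lim(1) s by (intro tendsto_upperbound[of x X sequentially]) (auto elim: eventually_mono)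
    have y': "y' \<longlonglongrightarrow> b - X"
    proof (rule Lim_transform_eventually)
      show "(\<lambda>n. b - x n) \<longlonglongrightarrow> b - X" by (intro tendsto_intros lim)
      show "\<forall>\<^sub>F n in sequentially. b - x n = y' n" using s by (auto elim: eventually_mono)
    qed
    have pos: "\<forall>\<^sub>F n in sequentially. 0 < x n \<and> 0 < y' n"
      using s
    proof (rule eventually_mono)
      fix n assume h: "0 \<le> x n \<and> 0 \<le> y n \<and> 0 \<le> x' n \<and> 0 \<le> y' n \<and>
        y' n = b - x n \<and> (1 + x' n) * x n = (1 + y n) * y' n"
      then have "x n = 0 \<longleftrightarrow> y' n = 0"
        by (metis add_nonneg_eq_0_iff mult_eq_0_iff zero_le_one zero_neq_one)
      then show "0 < x n \<and> 0 < y' n" using h b by auto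
    qed
    show ?thesis
    proof (cases "X = 0")
      case X0: True
      have "(\<lambda>n. x n / ((1 + y n) * y' n)) \<longlonglongrightarrow> X / ((1 + Y) * (b - X))"
        using X0 b Y by (intro tendsto_intros lim y') auto
      moreover have "\<forall>\<^sub>F n in sequentially. 0 < x n / ((1 + y n) * y' n)"
        using s pos by eventually_elim (auto intro!: divide_pos_pos mult_pos_pos)
      ultimately have "filterlim (\<lambda>n. inverse (x n / ((1 + y n) * y' n))) at_top sequentially"
        using X0 by (intro filterlim_inverse_at_top) auto
      then have "filterlim (\<lambda>n. -1 + inverse (x n / ((1 + y n) * y' n))) at_top sequentially"
        by (rule filterlim_tendsto_add_at_top[OF tendsto_const])
      moreover have "\<forall>\<^sub>F n in sequentially. -1 + inverse (x n / ((1 + y n) * y' n)) \<le> x' n"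
        using s pos
      proof eventually_elim
        case (elim n)
        then have "(1 + y n) * y' n / x n = 1 + x' n" by (metis less_irrefl nonzero_mult_div_cancel_right)
        then show ?case by simp
      qed
      ultimately have "filterlim x' at_top sequentially" by (rule filterlim_at_top_mono)
      then show ?thesis using True X0 b y' by (simp add: s'_def c'_def)
    next
      case X0: False
      have "x' \<longlonglongrightarrow> (1 + Y) * (b - X) / X - 1"
      proof (rule Lim_transform_eventually)
        show "(\<lambda>n. (1 + y n) * y' n / x n - 1) \<longlonglongrightarrow> (1 + Y) * (b - X) / X - 1"
          by (intro tendsto_intros lim y' X0)
        show "\<forall>\<^sub>F n in sequentially. (1 + y n) * y' n / x n - 1 = x' n"
          using s pos by eventually_elim (simp add: field_simps)
      qed
      then show ?thesis using True X0 \<open>X \<le> b\<close> y' by (simp add: s'_def c'_def)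
    qed
  next
    case False
    then have t1: "t = 1" using t by simp
    have lim: "x \<longlonglongrightarrow> X" "y \<longlonglongrightarrow> Y" using c by auto
    have s: "\<forall>\<^sub>F n in sequentially. 0 \<le> x n \<and> 0 \<le> y n \<and> 0 \<le> x' n \<and> 0 \<le> y' n \<and>
        x n = y' n + b + 1 \<and> x' n * x n = (1 + y n) * (1 + y' n)"
      using s t1 unfolding step_seq_def step_def by simp
    have X: "b + 1 \<le> X" using lim(1) s
      by (intro tendsto_lowerbound[of x X sequentially]) (auto elim: eventually_mono)
    have y': "y' \<longlonglongrightarrow> X - b - 1"
    proof (rule Lim_transform_eventually)
      show "(\<lambda>n. x n - b - 1) \<longlonglongrightarrow> X - b - 1" by (intro tendsto_intros lim)
      show "\<forall>\<^sub>F n in sequentially. x n - b - 1 = y' n" using s by (auto elim: eventually_mono)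
    qed
    have "x' \<longlonglongrightarrow> (1 + Y) * (1 + (X - b - 1)) / X"
    proof (rule Lim_transform_eventually)
      show "(\<lambda>n. (1 + y n) * (1 + y' n) / x n) \<longlonglongrightarrow> (1 + Y) * (1 + (X - b - 1)) / X"
        using X b by (intro tendsto_intros lim y') auto
      show "\<forall>\<^sub>F n in sequentially. (1 + y n) * (1 + y' n) / x n = x' n"
        using s
      proof (rule eventually_mono)
        fix n assume h: "0 \<le> x n \<and> 0 \<le> y n \<and> 0 \<le> x' n \<and> 0 \<le> y' n \<and>
          x n = y' n + b + 1 \<and> x' n * x n = (1 + y n) * (1 + y' n)"
        then have "x n \<noteq> 0" using b by auto
        then show "(1 + y n) * (1 + y' n) / x n = x' n" using h by (metis nonzero_mult_div_cancel_right)
      qed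
    qed
    then show ?thesis using t1 X b y' by (simp add: s'_def c'_def)
  qed
  then show ?thesis by blast
qed

lemma conv_step_fin1:
  fixes b X Y :: real
  assumes b: "0 < b" and s0: "s \<noteq> 0"
  shows "\<exists>s' c'. \<forall>t x y x' y'. t \<in> {0, 1} \<longrightarrow> conv s x y (Inl (X, Y)) \<longrightarrow> step_seq b s t x y x' y' \<longrightarrow>
    t = s' \<and> conv s' x' y' c'"
proof -
  have "t = 0 \<and> conv 0 x' y' (Inl (Y * (X + b + 1) / (1 + X) - 1, X + b + 1))"
    if c: "conv s x y (Inl (X, Y))" and s: "step_seq b s t x y x' y'" for t x y x' y'
  proof -
    have lim: "x \<longlonglongrightarrow> X" "y \<longlonglongrightarrow> Y" using c by auto
    have s: "\<forall>\<^sub>F n in sequentially. t = 0 \<and> 0 \<le> x n \<and> 0 \<le> y n \<and>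
        y' n = x n + b + 1 \<and> (1 + x' n) * (1 + x n) = y n * y' n"
      using s s0 unfolding step_seq_def step_def by (auto elim: eventually_mono)
    then have "t = 0" by (auto dest: eventually_happens)
    have X: "0 \<le> X" using lim(1) s by (intro tendsto_lowerbound[of x X sequentially]) (auto elim: eventually_mono)
    have y': "y' \<longlonglongrightarrow> X + b + 1"
    proof (rule Lim_transform_eventually)
      show "(\<lambda>n. x n + b + 1) \<longlonglongrightarrow> X + b + 1" by (intro tendsto_intros lim)
      show "\<forall>\<^sub>F n in sequentially. x n + b + 1 = y' n" using s by (auto elim: eventually_mono)
    qed
    have "x' \<longlonglongrightarrow> Y * (X + b + 1) / (1 + X) - 1"
    proof (rule Lim_transform_eventually)
      show "(\<lambda>n. y n * y' n / (1 + x n) - 1) \<longlonglongrightarrow> Y * (X + b + 1) / (1 + X) - 1"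
        using X by (intro tendsto_intros lim y') auto
      show "\<forall>\<^sub>F n in sequentially. y n * y' n / (1 + x n) - 1 = x' n"
        using s by eventually_elim (auto simp: divide_eq_eq algebra_simps)
    qed
    then show ?thesis using \<open>t = 0\<close> y' by simp
  qed
  then show ?thesis by blast
qed

text \<open>Infinite u exceeds b, so the next letter is 1; the finite coordinate becomes 1 + z and
  the limit stays infinite.\<close>

lemma conv_step_inf0:
  fixes b z :: real
  assumes b: "0 < b"
  shows "\<exists>s' c'. \<forall>t x y x' y'. t \<in> {0, 1} \<longrightarrow> conv 0 x y (Inr z) \<longrightarrow> step_seq b 0 t x y x' y' \<longrightarrow>
    t = s' \<and> conv s' x' y' c'"
proof -
  have "t = 1 \<and> conv 1 x' y' (Inr (1 + z))"
    if t: "t \<in> {0, 1}" and c: "conv 0 x y (Inr z)" and s: "step_seq b 0 t x y x' y'" for t x y x' y'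
  proof -
    have lim: "filterlim x at_top sequentially" "y \<longlonglongrightarrow> z" using c by auto
    have big: "\<forall>\<^sub>F n in sequentially. b < x n" using lim(1) by (simp add: filterlim_at_top_dense)
    have t1: "t = 1"
    proof (rule ccontr)
      assume "t \<noteq> 1"
      then have "t = 0" using t by simp
      then have "\<forall>\<^sub>F n in sequentially. x n \<le> b"
        using s unfolding step_seq_def step_def by (auto elim: eventually_mono)
      with big have "\<forall>\<^sub>F n in sequentially. False" by eventually_elim simp
      then show False by simp
    qed
    have s: "\<forall>\<^sub>F n in sequentially. x n = y' n + b + 1 \<and> x' n * x n = (1 + y n) * (1 + y' n)"
      using s t1 unfolding step_seq_def step_def by (auto elim: eventually_mono)
    have "filterlim (\<lambda>n. (- b - 1) + x n) at_top sequentially"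
      by (rule filterlim_tendsto_add_at_top[OF tendsto_const lim(1)])
    moreover have "\<forall>\<^sub>F n in sequentially. (- b - 1) + x n \<le> y' n" using s by (auto elim: eventually_mono)
    ultimately have y': "filterlim y' at_top sequentially" by (rule filterlim_at_top_mono)
    have "(\<lambda>n. inverse (x n)) \<longlonglongrightarrow> 0"
      by (rule tendsto_inverse_0_at_top[OF lim(1)])
    then have "(\<lambda>n. (1 + y n) * (1 - b * inverse (x n))) \<longlonglongrightarrow> (1 + z) * (1 - b * 0)"
      by (intro tendsto_intros lim)
    moreover have "\<forall>\<^sub>F n in sequentially. (1 + y n) * (1 - b * inverse (x n)) = x' n"
      using s big
    proof eventually_elim
      case (elim n)
      then have x: "x n \<noteq> 0" using b by auto
      have "1 + y' n = x n - b" using elim by simp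
      moreover have "x' n * x n = (1 + y n) * (1 + y' n)" using elim by blast
      ultimately have "x' n * x n = (1 + y n) * (x n - b)" by (simp only:)
      then have "x' n = (1 + y n) * (x n - b) / x n" using x by (metis nonzero_mult_div_cancel_right)
      then show ?case using x by (simp add: field_simps)
    qed
    ultimately have "x' \<longlonglongrightarrow> 1 + z" using Lim_transform_eventually by force
    then show ?thesis using t1 y' by simp
  qed
  then show ?thesis by blast
qed

lemma conv_step_inf1:
  fixes b z :: real
  assumes b: "0 < b" and s0: "s \<noteq> 0"
  shows "\<exists>s' c'. \<forall>t x y x' y'. t \<in> {0, 1} \<longrightarrow> conv s x y (Inr z) \<longrightarrow> step_seq b s t x y x' y' \<longrightarrow>
    t = s' \<and> conv s' x' y' c'"
proof -
  have "t = 0 \<and> conv 0 x' y' (Inr (z + b + 1))"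
    if c: "conv s x y (Inr z)" and s: "step_seq b s t x y x' y'" for t x y x' y'
  proof -
    have lim: "filterlim y at_top sequentially" "x \<longlonglongrightarrow> z" using c s0 by auto
    have s: "\<forall>\<^sub>F n in sequentially. t = 0 \<and> 0 \<le> x n \<and> 0 \<le> y n \<and>
        y' n = x n + b + 1 \<and> (1 + x' n) * (1 + x n) = y n * y' n"
      using s s0 unfolding step_seq_def step_def by (auto elim: eventually_mono)
    then have "t = 0" by (auto dest: eventually_happens)
    have y': "y' \<longlonglongrightarrow> z + b + 1"
    proof (rule Lim_transform_eventually)
      show "(\<lambda>n. x n + b + 1) \<longlonglongrightarrow> z + b + 1" by (intro tendsto_intros lim)
      show "\<forall>\<^sub>F n in sequentially. x n + b + 1 = y' n" using s by (auto elim: eventually_mono)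
    qed
    have "filterlim (\<lambda>n. -1 + y n) at_top sequentially"
      by (rule filterlim_tendsto_add_at_top[OF tendsto_const lim(1)])
    moreover have "\<forall>\<^sub>F n in sequentially. -1 + y n \<le> x' n"
      using s
    proof (rule eventually_mono)
      fix n assume h: "t = 0 \<and> 0 \<le> x n \<and> 0 \<le> y n \<and> y' n = x n + b + 1 \<and> (1 + x' n) * (1 + x n) = y n * y' n"
      then have "y n * (1 + x n) \<le> y n * y' n" using b by (intro mult_left_mono) auto
      then have "y n * (1 + x n) \<le> (1 + x' n) * (1 + x n)" using h by simp
      from mult_right_le_imp_le[OF this] have "y n \<le> 1 + x' n" using h by simp
      then show "-1 + y n \<le> x' n" by simp
    qed
    ultimately have "filterlim x' at_top sequentially" by (rule filterlim_at_top_mono)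
    then show ?thesis using \<open>t = 0\<close> y' by simp
  qed
  then show ?thesis by blast
qed

lemma conv_step:
  assumes b: "0 < b"
  obtains s' c' where "\<And>t x y x' y'. \<lbrakk>t \<in> {0, 1}; conv s x y c; step_seq b s t x y x' y'\<rbrakk> \<Longrightarrow>
    t = s' \<and> conv s' x' y' c'"
proof -
  have "\<exists>s' c'. \<forall>t x y x' y'. t \<in> {0, 1} \<longrightarrow> conv s x y c \<longrightarrow> step_seq b s t x y x' y' \<longrightarrow>
    t = s' \<and> conv s' x' y' c'"
  proof (cases c)
    case (Inl p)
    obtain X Y where p: "p = (X, Y)" by (cases p)
    show ?thesis unfolding Inl p
      by (cases "s = 0") (simp only: conv_step_fin0[OF b], rule conv_step_fin1[OF b])
  next
    case (Inr z)
    show ?thesis unfolding Inr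
      by (cases "s = 0") (simp only: conv_step_inf0[OF b], rule conv_step_inf1[OF b])
  qed
  then show ?thesis using that by blast
qed

text \<open>Induction along the future: both orbits keep having a common limit, possibly infinite,
  and this limit determines the next letter of both words.\<close>

lemma words_agree_forward:
  assumes b: "0 < b"
    and w: "\<And>k. w k \<in> {0, 1}" "\<And>k. w' k \<in> {0, 1}" "w 0 = w' 0"
    and o: "\<And>n::nat. orb b w (- int n) (int n) (u n) (v n)" "\<And>n::nat. orb b w' (- int n) (int n) (p n) (q n)"
    and lim: "(\<lambda>n. u n 0) \<longlonglongrightarrow> X" "(\<lambda>n. v n 0) \<longlonglongrightarrow> Y" "(\<lambda>n. p n 0) \<longlonglongrightarrow> X" "(\<lambda>n. q n 0) \<longlonglongrightarrow> Y"
  shows "w (int k) = w' (int k)"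
proof -
  have st: "step_seq b (w (int k)) (w (int (Suc k))) (\<lambda>n. u n (int k)) (\<lambda>n. v n (int k)) (\<lambda>n. u n (int (Suc k))) (\<lambda>n. v n (int (Suc k)))"
    if "\<And>n::nat. orb b w (- int n) (int n) (u n) (v n)" for w u v k
    unfolding step_seq_def
  proof (rule eventually_sequentiallyI)
    fix n assume "Suc k \<le> n"
    then show "0 \<le> u n (int k) \<and> 0 \<le> v n (int k) \<and> 0 \<le> u n (int (Suc k)) \<and> 0 \<le> v n (int (Suc k)) \<and>
        step b (w (int k)) (w (int (Suc k))) (u n (int k)) (v n (int k)) (u n (int (Suc k))) (v n (int (Suc k)))"
      using orb_step[OF that, of n "int k"] orbD[OF that, of n "int k"] orbD[OF that, of n "int (Suc k)"]
      by (simp add: add.commute)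
  qed
  have "w (int k) = w' (int k) \<and> (\<exists>c. conv (w (int k)) (\<lambda>n. u n (int k)) (\<lambda>n. v n (int k)) c \<and>
      conv (w (int k)) (\<lambda>n. p n (int k)) (\<lambda>n. q n (int k)) c)"
  proof (induction k)
    case 0
    then show ?case using w(3) lim by (auto intro!: exI[of _ "Inl (X, Y)"])
  next
    case (Suc k)
    then obtain c where c: "w (int k) = w' (int k)"
      "conv (w (int k)) (\<lambda>n. u n (int k)) (\<lambda>n. v n (int k)) c"
      "conv (w (int k)) (\<lambda>n. p n (int k)) (\<lambda>n. q n (int k)) c" by blast
    obtain s' c' where *: "\<And>t x y x' y'. \<lbrakk>t \<in> {0, 1}; conv (w (int k)) x y c; step_seq b (w (int k)) t x y x' y'\<rbrakk> \<Longrightarrow>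
      t = s' \<and> conv s' x' y' c'" using conv_step[OF b] by blast
    show ?case
      using *[OF w(1) c(2) st[OF o(1)]] *[OF w(2) c(3) st[OF o(2), of k, folded c(1)]] by auto
  qed
  then show ?thesis by blast
qed

lemma words_agree:
  assumes b: "0 < b"
    and w: "\<And>k. w k \<in> {0, 1}" "\<And>k. w' k \<in> {0, 1}" "w 0 = w' 0"
    and o: "\<And>n::nat. orb b w (- int n) (int n) (u n) (v n)" "\<And>n::nat. orb b w' (- int n) (int n) (p n) (q n)"
    and lim: "(\<lambda>n. u n 0) \<longlonglongrightarrow> X" "(\<lambda>n. v n 0) \<longlonglongrightarrow> Y" "(\<lambda>n. p n 0) \<longlonglongrightarrow> X" "(\<lambda>n. q n 0) \<longlonglongrightarrow> Y"
  shows "w = w'"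
proof
  fix k
  show "w k = w' k"
  proof (cases "0 \<le> k")
    case True
    then show ?thesis using words_agree_forward[OF assms, of "nat k"] by simp
  next
    case False
    have "(\<lambda>k. w (- k)) (int (nat (- k))) = (\<lambda>k. w' (- k)) (int (nat (- k)))"
      by (rule words_agree_forward[OF b, of _ _ "\<lambda>n k. v n (- k)" "\<lambda>n k. u n (- k)" "\<lambda>n k. q n (- k)" "\<lambda>n k. p n (- k)"])
        (use w lim orb_rev[OF o(1), unfolded minus_minus] orb_rev[OF o(2), unfolded minus_minus] in simp_all)
    then show ?thesis using False by simp
  qed
qed

subsection \<open>The map in the coordinates u, v\<close>

definition pt :: "nat \<Rightarrow> real \<Rightarrow> real \<Rightarrow> real \<times> real" where
  "pt s u v = (if s = 0 then (1 + u, - 1 - v) else (- u, v))"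

definition pos_pts :: "nat \<Rightarrow> (real \<times> real) set" where
  "pos_pts s = {pt s u v |u v. 0 < u \<and> 0 < v}"

lemma pos_pts_iff:
  "z \<in> pos_pts s \<longleftrightarrow> (if s = 0 then 1 < fst z \<and> snd z < - 1 else fst z < 0 \<and> 0 < snd z)"
proof
  assume h: "if s = 0 then 1 < fst z \<and> snd z < - 1 else fst z < 0 \<and> 0 < snd z"
  show "z \<in> pos_pts s"
  proof (cases "s = 0")
    case True
    have "z = pt s (fst z - 1) (- 1 - snd z)" "0 < fst z - 1" "0 < - 1 - snd z"
      using h True by (simp_all add: pt_def prod_eq_iff)
    then show ?thesis unfolding pos_pts_def by blast
  next
    case False
    have "z = pt s (- fst z) (snd z)" "0 < - fst z" "0 < snd z"
      using h False by (simp_all add: pt_def prod_eq_iff)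
    then show ?thesis unfolding pos_pts_def by blast
  qed
qed (auto simp: pos_pts_def pt_def)

lemma fmap_emb:
  "fmap a (emb (x, y)) = (if x = 1 then (None, Some (x + (a - 1))) else emb (y * ((x + a) / (x - 1)), x + (a - 1)))"
  by (simp add: fmap_def emb_def cmult_def cmobius_def ctranslate_def)

lemma finv_emb:
  "finv a (emb (x, y)) = (if y = - 1 then (Some (y + (1 - a)), None) else emb (y + (1 - a), x * ((y - a) / (y + 1))))"
  by (simp add: finv_def emb_def cmult_def cmobius_def ctranslate_def)

lemma emb_inj [simp]: "emb p = emb q \<longleftrightarrow> p = q"
  by (cases p; cases q) (simp add: emb_def)

lemma range_emb: "q \<in> range emb \<longleftrightarrow> fst q \<noteq> None \<and> snd q \<noteq> None"
  by (cases q) (auto simp: emb_def image_iff map_prod_def split: prod.splits)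

text \<open>Translation fixes infinity and a product with an infinite factor is \<open>None\<close>,
  so an orbit of \<open>fmap\<close> that has left the plane never returns. A finite end point
  therefore makes all earlier points finite.\<close>

lemma fmap_fin: "fmap a q \<in> range emb \<Longrightarrow> q \<in> range emb"
  unfolding range_emb by (cases q) (auto simp: fmap_def cmult_def ctranslate_def split: option.splits)

lemma finv_fin: "finv a q \<in> range emb \<Longrightarrow> q \<in> range emb"
  unfolding range_emb by (cases q) (auto simp: finv_def cmult_def ctranslate_def split: option.splits)

lemma funpow_fmap_fin: "(fmap a ^^ k) q \<in> range emb \<Longrightarrow> q \<in> range emb"
proof (induction k)
  case (Suc k)
  then show ?case using fmap_fin[of a "(fmap a ^^ k) q"] by simp
qed simp

lemma funpow_finv_fin: "(finv a ^^ k) q \<in> range emb \<Longrightarrow> q \<in> range emb"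
proof (induction k)
  case (Suc k)
  then show ?case using finv_fin[of a "(finv a ^^ k) q"] by simp
qed simp

lemma step_imp_fmap:
  assumes "b = - 1 - a" "0 < b" "0 < u" "0 < v" "0 < u'" "0 < v'"
  shows "fmap a (emb (pt s u v)) = emb (pt s' u' v') \<longleftrightarrow> step b s s' u v u' v'"
proof -
  have a: "a = - 1 - b" using assms by simp
  consider "s = 0" "s' = 0" | "s = 0" "s' \<noteq> 0" | "s \<noteq> 0" "s' = 0" | "s \<noteq> 0" "s' \<noteq> 0" by blast
  then show ?thesis
  proof cases
    case 1
    have "fmap a (emb (pt s u v)) = emb ((- 1 - v) * ((u - b) / u), u - b - 1)"
      using 1 assms by (simp add: pt_def fmap_emb a)
    also have "\<dots> = emb (pt s' u' v') \<longleftrightarrow> (- 1 - v) * ((u - b) / u) = 1 + u' \<and> v' = b - u"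
      using 1 by (auto simp: pt_def)
    also have "\<dots> \<longleftrightarrow> v' = b - u \<and> (- 1 - v) * (u - b) = (1 + u') * u"
      using assms by (auto simp: divide_eq_eq)
    also have "\<dots> \<longleftrightarrow> step b s s' u v u' v'"
      using 1 by (auto simp: step_def algebra_simps)
    finally show ?thesis .
  next
    case 2
    have "fmap a (emb (pt s u v)) = emb ((- 1 - v) * ((u - b) / u), u - b - 1)"
      using 2 assms by (simp add: pt_def fmap_emb a)
    also have "\<dots> = emb (pt s' u' v') \<longleftrightarrow> (- 1 - v) * ((u - b) / u) = - u' \<and> u = v' + b + 1"
      using 2 by (auto simp: pt_def)
    also have "\<dots> \<longleftrightarrow> u = v' + b + 1 \<and> (- 1 - v) * (u - b) = - u' * u"
      using assms by (auto simp: divide_eq_eq)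
    also have "\<dots> \<longleftrightarrow> step b s s' u v u' v'"
      using 2 by (auto simp: step_def algebra_simps)
    finally show ?thesis .
  next
    case 3
    have "fmap a (emb (pt s u v)) = emb (v * ((- u - 1 - b) / (- u - 1)), - u - b - 2)"
      using 3 assms by (simp add: pt_def fmap_emb a)
    also have "\<dots> = emb (pt s' u' v') \<longleftrightarrow> v * ((- u - 1 - b) / (- u - 1)) = 1 + u' \<and> v' = u + b + 1"
      using 3 by (auto simp: pt_def)
    also have "\<dots> \<longleftrightarrow> v' = u + b + 1 \<and> v * (- u - 1 - b) = (1 + u') * (- u - 1)"
      using assms by (auto simp: divide_eq_eq)
    also have "\<dots> \<longleftrightarrow> step b s s' u v u' v'"
      using 3 by (auto simp: step_def algebra_simps)
    finally show ?thesis .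
  next
    case 4
    have "fmap a (emb (pt s u v)) = emb (v * ((- u - 1 - b) / (- u - 1)), - u - b - 2)"
      using 4 assms by (simp add: pt_def fmap_emb a)
    then show ?thesis using 4 assms by (auto simp: pt_def step_def)
  qed
qed

subsection \<open>Interiors of the rectangles, and inversion along orbits\<close>

text \<open>Infinity is an interior point only if the complement of S is bounded. For half-lines it
  is a boundary point, so the interiors of the rectangles are open quadrants of the plane.\<close>

lemma cline_interior:
  assumes "\<not> bounded (- S)"
  shows "cline_top interior_of insert None (Some ` S) = Some ` interior S"
proof
  show "Some ` interior S \<subseteq> cline_top interior_of insert None (Some ` S)"
    using interior_subset[of S] by (intro interior_of_maximal) (auto simp: cline_top_def)
  show "cline_top interior_of insert None (Some ` S) \<subseteq> Some ` interior S"
  proof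
    fix x assume "x \<in> cline_top interior_of insert None (Some ` S)"
    then obtain T where T: "openin cline_top T" "x \<in> T" "T \<subseteq> insert None (Some ` S)"
      by (auto simp: interior_of_def)
    from T(1) consider U where "open U" "T = Some ` U" | C where "compact C" "T = insert None (Some ` (- C))"
      unfolding cline_top_def openin_Alexandroff_compactification by (auto simp: Compl_eq_Diff_UNIV)
    then show "x \<in> Some ` interior S"
    proof cases
      case 1
      then have "U \<subseteq> interior S" using T by (intro interior_maximal) auto
      then show ?thesis using 1 T by blast
    next
      case 2
      then have "- S \<subseteq> C" using T by auto
      then show ?thesis using assms 2 compact_imp_bounded bounded_subset by blast
    qed
  qed
qed

lemma not_bounded_halflines:
  "\<not> bounded {..<(c::real)}" "\<not> bounded {(c::real)<..}"
proof -
  show "\<not> bounded {..<c}"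
  proof
    assume "bounded {..<c}"
    then obtain B where B: "\<And>x. x < c \<Longrightarrow> \<bar>x\<bar> \<le> B" by (auto simp: bounded_iff)
    have "min c 0 \<le> c" "min c 0 \<le> 0" by auto
    with B[of "min c 0 - \<bar>B\<bar> - 1"] show False by linarith
  qed
  show "\<not> bounded {c<..}"
  proof
    assume "bounded {c<..}"
    then obtain B where B: "\<And>x. c < x \<Longrightarrow> \<bar>x\<bar> \<le> B" by (auto simp: bounded_iff)
    have "c \<le> max c 0" "0 \<le> max c 0" by auto
    with B[of "max c 0 + \<bar>B\<bar> + 1"] show False by linarith
  qed
qed

lemma interior_rect: "cplane_top interior_of rect j = emb ` pos_pts j"
proof -
  have *: "emb ` pos_pts j = Some ` (if j = 0 then {1<..} else {..<0}) \<times> Some ` (if j = 0 then {..<- 1} else {0<..})"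
    by (force simp: emb_def pos_pts_iff image_iff)
  have R: "cline_top interior_of insert None (Some ` {1..}) = Some ` {1<..}"
    "cline_top interior_of insert None (Some ` {..- 1}) = Some ` {..<- 1}"
    "cline_top interior_of insert None (Some ` {..0}) = Some ` {..<0}"
    "cline_top interior_of insert None (Some ` {0..}) = Some ` {0<..}"
    by (subst cline_interior; simp add: not_bounded_halflines Compl_atLeast Compl_atMost)+
  show ?thesis
    unfolding rect_def cplane_top_def *
    by (cases "j = 0") (simp_all only: if_True if_False interior_of_Times R simp_thms)
qed

text \<open>A forward invariant region that misses both open rectangles. It contains (0, -1), to
  which f contracts the line x = -a; a point of that line thus never enters the rectangles
  later.\<close>

lemma funpow_fmap_absorbing:
  assumes a: "a < - 1" and z: "fst z < 1" "snd z \<le> 0"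
  shows "\<exists>z'. (fmap a ^^ k) (emb z) = emb z' \<and> fst z' < 1 \<and> snd z' \<le> 0"
proof (induction k)
  case 0
  then show ?case using z by auto
next
  case (Suc k)
  then obtain x y where h: "(fmap a ^^ k) (emb z) = emb (x, y)" "x < 1" "y \<le> 0" by auto
  have "0 \<le> (x + a) / (x - 1)" using h a by (intro divide_nonpos_nonpos) auto
  then have "y * ((x + a) / (x - 1)) \<le> 0" using h by (intro mult_nonpos_nonneg)
  moreover have "(fmap a ^^ Suc k) (emb z) = emb (y * ((x + a) / (x - 1)), x + (a - 1))"
    using h by (simp add: fmap_emb)
  ultimately obtain r where "(fmap a ^^ Suc k) (emb z) = emb (r, x + (a - 1))" "r \<le> 0" by blast
  moreover have "x + (a - 1) \<le> 0" using h a by simp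
  ultimately show ?case by force
qed

lemma funpow_finv_absorbing:
  assumes a: "a < - 1" and z: "0 \<le> fst z" "- 1 < snd z"
  shows "\<exists>z'. (finv a ^^ k) (emb z) = emb z' \<and> 0 \<le> fst z' \<and> - 1 < snd z'"
proof (induction k)
  case 0
  then show ?case using z by auto
next
  case (Suc k)
  then obtain x y where h: "(finv a ^^ k) (emb z) = emb (x, y)" "0 \<le> x" "- 1 < y" by auto
  have "0 \<le> (y - a) / (y + 1)" using h a by (intro divide_nonneg_nonneg) auto
  then have "0 \<le> x * ((y - a) / (y + 1))" using h by (intro mult_nonneg_nonneg)
  moreover have "(finv a ^^ Suc k) (emb z) = emb (y + (1 - a), x * ((y - a) / (y + 1)))"
    using h by (simp add: finv_emb)
  ultimately obtain r where "(finv a ^^ Suc k) (emb z) = emb (y + (1 - a), r)" "0 \<le> r" by blast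
  moreover have "0 \<le> y + (1 - a)" using h a by simp
  ultimately show ?case by force
qed

text \<open>The two maps fail to be inverse at finite points only on the exceptional lines y = -1
  and y = a. The first is excluded by finiteness and the second by the absorbing region, since the
  orbit ends in an open rectangle.\<close>

lemma fmap_finv_funpow:
  assumes a: "a < - 1"
  shows "(finv a ^^ k) (emb z) \<in> emb ` pos_pts s \<Longrightarrow> (fmap a ^^ k) ((finv a ^^ k) (emb z)) = emb z"
proof (induction k arbitrary: z)
  case (Suc k)
  obtain x y where z: "z = (x, y)" by (cases z)
  have e: "(finv a ^^ Suc k) (emb z) = (finv a ^^ k) (finv a (emb z))" by (simp add: funpow_Suc_right del: funpow.simps)
  have "finv a (emb z) \<in> range emb"
    by (rule funpow_finv_fin[of k]) (use Suc.prems e in auto)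
  then have y: "y \<noteq> - 1" unfolding z by (auto simp: finv_emb range_emb)
  define z1 where "z1 = (y + (1 - a), x * ((y - a) / (y + 1)))"
  have z1: "finv a (emb z) = emb z1" using y by (simp add: z finv_emb z1_def)
  have ya: "y \<noteq> a"
  proof
    assume "y = a"
    then have "0 \<le> fst z1" "- 1 < snd z1" using a by (auto simp: z1_def)
    from funpow_finv_absorbing[OF a this, of k] Suc.prems show False
      unfolding e z1 by (auto simp: pos_pts_iff split: if_splits)
  qed
  have "fmap a (emb z1) = emb z" unfolding z1_def z fmap_emb using y ya by simp
  moreover have "(fmap a ^^ k) ((finv a ^^ k) (emb z1)) = emb z1"
    using Suc.IH Suc.prems unfolding e z1 by blast
  ultimately show ?case unfolding e z1 by simp
qed simp

lemma finv_fmap_funpow: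
  assumes a: "a < - 1"
  shows "(fmap a ^^ k) (emb z) \<in> emb ` pos_pts s \<Longrightarrow> (finv a ^^ k) ((fmap a ^^ k) (emb z)) = emb z"
proof (induction k arbitrary: z)
  case (Suc k)
  obtain x y where z: "z = (x, y)" by (cases z)
  have e: "(fmap a ^^ Suc k) (emb z) = (fmap a ^^ k) (fmap a (emb z))" by (simp add: funpow_Suc_right del: funpow.simps)
  have "fmap a (emb z) \<in> range emb"
    by (rule funpow_fmap_fin[of k]) (use Suc.prems e in auto)
  then have x: "x \<noteq> 1" unfolding z by (auto simp: fmap_emb range_emb)
  define z1 where "z1 = (y * ((x + a) / (x - 1)), x + (a - 1))"
  have z1: "fmap a (emb z) = emb z1" using x by (simp add: z fmap_emb z1_def)
  have xa: "x \<noteq> - a"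
  proof
    assume "x = - a"
    then have "fst z1 < 1" "snd z1 \<le> 0" by (auto simp: z1_def)
    from funpow_fmap_absorbing[OF a this, of k] Suc.prems show False
      unfolding e z1 by (auto simp: pos_pts_iff split: if_splits)
  qed
  have "x + a \<noteq> 0" using xa by simp
  then have "finv a (emb z1) = emb z" unfolding z1_def z finv_emb using x by simp
  moreover have "(finv a ^^ k) ((fmap a ^^ k) (emb z1)) = emb z1"
    using Suc.IH Suc.prems unfolding e z1 by blast
  ultimately show ?case unfolding e z1 by simp
qed simp

lemma fiter_minus:
  "fiter a (- int k) = finv a ^^ k" "fiter a (int k) = fmap a ^^ k"
proof -
  show "fiter a (- int k) = finv a ^^ k" by (cases "k = 0") (simp_all add: fiter_def)
  show "fiter a (int k) = fmap a ^^ k" by (simp add: fiter_def)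
qed

definition pos_orb :: "real \<Rightarrow> (int \<Rightarrow> nat) \<Rightarrow> int \<Rightarrow> int \<Rightarrow> (int \<Rightarrow> real) \<Rightarrow> (int \<Rightarrow> real) \<Rightarrow> bool" where
  "pos_orb b w i j u v \<longleftrightarrow> orb b w i j u v \<and> (\<forall>k\<in>{i..j}. 0 < u k \<and> 0 < v k)"

lemma fmap_emb_pos_orb:
  assumes a: "a < - 1" "b = - 1 - a" and o: "pos_orb b w i j u v" and k: "i \<le> k" "k < j"
  shows "fmap a (emb (pt (w k) (u k) (v k))) = emb (pt (w (k+1)) (u (k+1)) (v (k+1)))"
proof (rule step_imp_fmap[THEN iffD2])
  show "step b (w k) (w (k+1)) (u k) (v k) (u (k+1)) (v (k+1))"
    using o k by (intro orb_step[of b w i j]) (simp_all add: pos_orb_def)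
qed (use a o k in \<open>simp_all add: pos_orb_def\<close>)

lemma pos_orb_pts:
  assumes "pos_orb b w i j u v" "i \<le> k" "k \<le> j"
  shows "emb (pt (w k) (u k) (v k)) \<in> emb ` pos_pts (w k)"
proof -
  have "0 < u k" "0 < v k" using assms by (simp_all add: pos_orb_def)
  then show ?thesis unfolding pos_pts_def by blast
qed

text \<open>R(w) is defined by direct images under iterates of both maps, so passing to an orbit
  through time 0 requires undoing these iterates. This is legitimate because both ends of each
  iteration lie in open rectangles.\<close>

lemma block_iff:
  assumes a: "a < - 1" "b = - 1 - a"
  shows "(\<Inter>k\<in>{- int n..int m}. fiter a (- k) ` (cplane_top interior_of rect (w k))) =
    emb ` {pt (w 0) (u 0) (v 0) |u v. pos_orb b w (- int n) (int m) u v}" (is "?A = ?B")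
proof
  show "?A \<subseteq> ?B"
  proof
    fix q assume q: "q \<in> ?A"
    then have q': "q \<in> fiter a (- k) ` emb ` pos_pts (w k)" if "- int n \<le> k" "k \<le> int m" for k
      using that unfolding interior_rect by auto
    have q0: "q \<in> emb ` pos_pts (w 0)" using q'[of 0] by (simp add: fiter_def)
    have it: "fiter a k q \<in> emb ` pos_pts (w k)" if k: "- int n \<le> k" "k \<le> int m" for k
    proof (cases k rule: int_cases)
      case 1: (nonneg j)
      obtain y where y: "y \<in> pos_pts (w k)" "q = (finv a ^^ j) (emb y)"
        using q'[OF k] by (auto simp: 1 fiter_minus)
      have "(fmap a ^^ j) q = emb y" using fmap_finv_funpow[OF a(1), of j y] q0 y by simp
      then show ?thesis using y by (simp add: 1 fiter_minus)
    next
      case 2: (neg j)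
      obtain y where y: "y \<in> pos_pts (w k)" "q = (fmap a ^^ Suc j) (emb y)"
        using q'[OF k] unfolding 2 minus_minus fiter_minus by auto
      have "(finv a ^^ Suc j) q = emb y"
        using finv_fmap_funpow[OF a(1), of "Suc j" y "w 0"] q0 y by metis
      then show ?thesis using y unfolding 2 fiter_minus by simp
    qed
    have "\<forall>k. \<exists>p. k \<in> {- int n..int m} \<longrightarrow>
      fiter a k q = emb (pt (w k) (fst p) (snd p)) \<and> 0 < fst p \<and> 0 < snd p"
    proof (intro allI)
      fix k
      show "\<exists>p. k \<in> {- int n..int m} \<longrightarrow> fiter a k q = emb (pt (w k) (fst p) (snd p)) \<and> 0 < fst p \<and> 0 < snd p"
      proof (cases "k \<in> {- int n..int m}")
        case True
        then obtain x y where "fiter a k q = emb (pt (w k) x y)" "0 < x" "0 < y"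
          using it[of k] unfolding pos_pts_def by auto
        then show ?thesis by (intro exI[of _ "(x, y)"]) simp
      qed blast
    qed
    from choice[OF this] obtain F where F: "\<And>k. k \<in> {- int n..int m} \<Longrightarrow>
      fiter a k q = emb (pt (w k) (fst (F k)) (snd (F k))) \<and> 0 < fst (F k) \<and> 0 < snd (F k)" by blast
    define u v where "u k = fst (F k)" and "v k = snd (F k)" for k
    have uv: "fiter a k q = emb (pt (w k) (u k) (v k)) \<and> 0 < u k \<and> 0 < v k" if "k \<in> {- int n..int m}" for k
      using F[OF that] by (simp add: u_def v_def)
    have fs: "fmap a (fiter a k q) = fiter a (k + 1) q" if k: "- int n \<le> k" "k < int m" for k
    proof (cases k rule: int_cases)
      case 1: (nonneg j)
      have e: "k + 1 = int (Suc j)" using 1 by simp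
      show ?thesis unfolding e unfolding 1 fiter_minus by simp
    next
      case 2: (neg j)
      have e: "k + 1 = - int j" using 2 by simp
      have "fiter a (k + 1) q = emb (pt (w (k + 1)) (u (k + 1)) (v (k + 1)))"
        using uv[of "k + 1"] k by simp
      moreover have "fiter a k q = finv a (fiter a (k + 1) q)" unfolding e unfolding 2 fiter_minus by simp
      ultimately show ?thesis
        using fmap_finv_funpow[OF a(1), of 1 "pt (w (k + 1)) (u (k + 1)) (v (k + 1))" "w k"] it[of k] k by simp
    qed
    have "step b (w k) (w (k + 1)) (u k) (v k) (u (k + 1)) (v (k + 1))" if k: "k \<in> {- int n..<int m}" for k
    proof (rule step_imp_fmap[THEN iffD1])
      show "fmap a (emb (pt (w k) (u k) (v k))) = emb (pt (w (k + 1)) (u (k + 1)) (v (k + 1)))"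
        using fs[of k] uv[of k] uv[of "k + 1"] k by simp
    qed (use a uv[of k] uv[of "k + 1"] k in simp_all)
    then have "pos_orb b w (- int n) (int m) u v"
      using uv unfolding pos_orb_def orb_def by (auto intro: less_imp_le)
    moreover have "q = emb (pt (w 0) (u 0) (v 0))" using uv[of 0] by (simp add: fiter_def)
    ultimately show "q \<in> ?B" by blast
  qed
  show "?B \<subseteq> ?A"
  proof
    fix q assume "q \<in> ?B"
    then obtain u v where o: "pos_orb b w (- int n) (int m) u v" and q: "q = emb (pt (w 0) (u 0) (v 0))" by blast
    let ?P = "\<lambda>k. emb (pt (w k) (u k) (v k))"
    note f = fmap_emb_pos_orb[OF a o] and pp = pos_orb_pts[OF o]
    have fw: "?P 0 = (finv a ^^ j) (?P (int j))" if "int j \<le> int m" for j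
      using that
    proof (induction j)
      case (Suc j)
      have "finv a (fmap a (?P (int j))) = ?P (int j)"
        using finv_fmap_funpow[OF a(1), of 1 "pt (w (int j)) (u (int j)) (v (int j))" "w (int j + 1)"]
          f[of "int j"] pp[of "int j + 1"] Suc.prems by simp
      then have "finv a (?P (int (Suc j))) = ?P (int j)"
        using f[of "int j"] Suc.prems by (simp add: add.commute)
      then show ?case using Suc by (simp add: funpow_Suc_right del: funpow.simps)
    qed simp
    have bw: "?P 0 = (fmap a ^^ j) (?P (- int j))" if "int j \<le> int n" for j
      using that
    proof (induction j)
      case (Suc j)
      have e: "- int (Suc j) + 1 = - int j" by simp
      have "fmap a (?P (- int (Suc j))) = ?P (- int j)"
        by (rule f[of "- int (Suc j)", unfolded e]) (use Suc.prems in simp_all)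
      then show ?case using Suc by (simp add: funpow_Suc_right del: funpow.simps of_nat_Suc)
    qed simp
    show "q \<in> ?A"
    proof
      fix k assume k: "k \<in> {- int n..int m}"
      show "q \<in> fiter a (- k) ` (cplane_top interior_of rect (w k))"
      proof (cases k rule: int_cases)
        case 1: (nonneg j)
        show ?thesis using fw[of j] pp[of k] k unfolding q interior_rect 1 fiter_minus
          by (intro image_eqI[of _ _ "?P (int j)"]) auto
      next
        case 2: (neg j)
        show ?thesis using bw[of "Suc j"] pp[of k] k unfolding q interior_rect 2 minus_minus fiter_minus
          by (intro image_eqI[of _ _ "?P (- int (Suc j))"]) auto
      qed
    qed
  qed
qed

subsection \<open>Finite points of the sets R(w)\<close>

definition close :: "real \<Rightarrow> real \<times> real \<Rightarrow> real \<times> real \<Rightarrow> bool" where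
  "close e p q \<longleftrightarrow> \<bar>fst p - fst q\<bar> < e \<and> \<bar>snd p - snd q\<bar> < e"

lemma emb_eq: "emb p = (Some (fst p), Some (snd p))"
  by (cases p) (simp add: emb_def)

text \<open>The plane is open in the compactification with its usual topology, so closure at finite
  points is tested by squares.\<close>

lemma in_closure_of_emb:
  "emb p \<in> cplane_top closure_of (emb ` S) \<longleftrightarrow> (\<forall>e>0. \<exists>q\<in>S. close e q p)"
proof
  assume c: "emb p \<in> cplane_top closure_of (emb ` S)"
  show "\<forall>e>0. \<exists>q\<in>S. close e q p"
  proof (intro allI impI)
    fix e :: real assume e: "0 < e"
    let ?U = "\<lambda>x. Some ` {x - e<..<x + e}"
    have "openin cplane_top (?U (fst p) \<times> ?U (snd p))"
      by (simp add: cplane_top_def cline_top_def openin_prod_Times_iff)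
    moreover have "emb p \<in> ?U (fst p) \<times> ?U (snd p)"
      using e by (simp add: emb_eq inj_image_mem_iff)
    ultimately have "\<exists>y. y \<in> emb ` S \<and> y \<in> ?U (fst p) \<times> ?U (snd p)"
      using c[unfolded in_closure_of, THEN conjunct2, rule_format] by simp
    then obtain q where q: "q \<in> S" "emb q \<in> ?U (fst p) \<times> ?U (snd p)"
      by (elim exE conjE imageE) simp
    then have "fst q \<in> {fst p - e<..<fst p + e}" "snd q \<in> {snd p - e<..<snd p + e}"
      by (simp_all add: emb_eq inj_image_mem_iff)
    then have "close e q p" by (auto simp: close_def)
    then show "\<exists>q\<in>S. close e q p" using q(1) by (rule bexI)
  qed
next
  assume h: "\<forall>e>0. \<exists>q\<in>S. close e q p"
  have top: "topspace cplane_top = UNIV"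
    by (simp add: cplane_top_def cline_top_def UNIV_option_conv[symmetric])
  have op: "\<exists>e>0. \<forall>y. \<bar>y - x\<bar> < e \<longrightarrow> Some y \<in> U" if "openin cline_top U" "Some x \<in> U" for U x
  proof -
    have "openin euclidean {y \<in> topspace euclideanreal. Some y \<in> U}"
      by (rule openin_continuous_map_preimage[OF continuous_map_Some that(1)[unfolded cline_top_def]])
    then have "open {y. Some y \<in> U}" by simp
    from this[unfolded open_dist, rule_format, of x] that(2) show ?thesis by (simp add: dist_real_def)
  qed
  show "emb p \<in> cplane_top closure_of (emb ` S)"
    unfolding in_closure_of
  proof (intro conjI allI impI)
    show "emb p \<in> topspace cplane_top" by (simp add: top)
    fix T assume "emb p \<in> T \<and> openin cplane_top T"
    then have T: "(Some (fst p), Some (snd p)) \<in> T" "openin (prod_topology cline_top cline_top) T"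
      by (simp_all add: emb_eq cplane_top_def)
    from T(2)[unfolded openin_prod_topology_alt, rule_format, OF T(1)] obtain U V where UV: "openin cline_top U" "openin cline_top V" "Some (fst p) \<in> U" "Some (snd p) \<in> V" "U \<times> V \<subseteq> T" by (elim exE conjE)
    obtain d where d: "0 < d" "\<And>y. \<bar>y - fst p\<bar> < d \<Longrightarrow> Some y \<in> U" using op[OF UV(1,3)] by blast
    obtain e where e: "0 < e" "\<And>y. \<bar>y - snd p\<bar> < e \<Longrightarrow> Some y \<in> V" using op[OF UV(2,4)] by blast
    obtain q where q: "q \<in> S" "close (min d e) q p" using h d(1) e(1) by (metis min_less_iff_conj)
    then have "emb q \<in> U \<times> V" using d(2)[of "fst q"] e(2)[of "snd q"] by (simp add: close_def emb_eq)
    then show "\<exists>y. y \<in> emb ` S \<and> y \<in> T" using q(1) UV(5) by (intro exI[of _ "emb q"]) auto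
  qed
qed

text \<open>Membership of a finite point in R(w), freed of the compactification. The orbit may
  change with n and e; p itself need not have an orbit in the interiors.\<close>

definition near :: "real \<Rightarrow> (int \<Rightarrow> nat) \<Rightarrow> real \<times> real \<Rightarrow> bool" where
  "near b w p \<longleftrightarrow> (\<forall>n::nat. \<forall>e>0. \<exists>u v. pos_orb b w (- int n) (int n) u v \<and> close e (pt (w 0) (u 0) (v 0)) p)"

lemma pos_orb_sub: "pos_orb b w i j u v \<Longrightarrow> i \<le> i' \<Longrightarrow> j' \<le> j \<Longrightarrow> pos_orb b w i' j' u v"
  using orb_sub[of b w i j u v i' j'] unfolding pos_orb_def by simp

lemma Rword_iff_near:
  assumes a: "a < - 1" "b = - 1 - a"
  shows "emb p \<in> Rword a w \<longleftrightarrow> near b w p"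
proof -
  have *: "emb p \<in> Rblock a w n m \<longleftrightarrow>
    (\<forall>e>0. \<exists>u v. pos_orb b w (- int n) (int m) u v \<and> close e (pt (w 0) (u 0) (v 0)) p)" for n m
    unfolding Rblock_def block_iff[OF a] in_closure_of_emb by blast
  show ?thesis
  proof
    assume "emb p \<in> Rword a w"
    then have "emb p \<in> Rblock a w n n" for n by (simp add: Rword_def)
    then show "near b w p" unfolding near_def using * by blast
  next
    assume n: "near b w p"
    have "emb p \<in> Rblock a w n m" for n m
      unfolding *
    proof (intro allI impI)
      fix e :: real assume "0 < e"
      then obtain u v where "pos_orb b w (- int (max n m)) (int (max n m)) u v" "close e (pt (w 0) (u 0) (v 0)) p"
        using n unfolding near_def by blast
      then show "\<exists>u v. pos_orb b w (- int n) (int m) u v \<and> close e (pt (w 0) (u 0) (v 0)) p"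
        using pos_orb_sub[of b w "- int (max n m)" "int (max n m)" u v "- int n" "int m"] by auto
    qed
    then show "emb p \<in> Rword a w" by (simp add: Rword_def)
  qed
qed

subsection \<open>Periodic points stay in the rectangles\<close>

text \<open>Reducing times modulo n supplies the past of a periodic point without using an inverse
  map.\<close>

lemma periodic_extension:
  fixes f :: "'a \<Rightarrow> 'a"
  assumes n: "1 \<le> n" and p: "(f ^^ n) x = x"
  obtains Z where "Z 0 = x" "\<And>k. f (Z k) = Z (k + 1)" "\<And>k. Z (k + int n) = Z k"
    "\<And>k. \<exists>m. (f ^^ m) (Z k) = x"
proof
  let ?Z = "\<lambda>k. (f ^^ nat (k mod int n)) x"
  show "?Z 0 = x" by simp
  show "?Z (k + int n) = ?Z k" for k by simp
  show "f (?Z k) = ?Z (k + 1)" for k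
  proof -
    have "int (Suc (nat (k mod int n)) mod n) = (k mod int n + 1) mod int n"
      using n by (simp add: zmod_int add.commute)
    also have "\<dots> = (k + 1) mod int n" by (simp add: mod_add_left_eq)
    finally have "nat ((k + 1) mod int n) = Suc (nat (k mod int n)) mod n" by simp
    then show ?thesis using funpow_mod_eq[OF p, of "Suc (nat (k mod int n))"] by simp
  qed
  show "\<exists>m. (f ^^ m) (?Z k) = x" for k
  proof -
    have "nat (k mod int n) \<le> n" using n by (simp add: nat_le_iff less_imp_le)
    then have "(f ^^ (n - nat (k mod int n))) (?Z k) = x"
      using p by (metis comp_apply funpow_add le_add_diff_inverse2)
    then show ?thesis by blast
  qed
qed

text \<open>A periodic orbit is finite throughout, and it avoids two regions: {x < 1, y <= 0}, where
  forward orbits escape, and {x >= 0, y > -1}, where backward orbits escape. What remains are the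
  two rectangles, and their edges are excluded separately.\<close>

lemma periodic_in_Omega_plane:
  assumes a: "a < - 1" and n: "1 \<le> n" and p: "(fmap a ^^ n) (emb p) = emb p"
  shows "p \<in> Omega_plane a"
proof -
  define b where "b = - 1 - a"
  have b: "0 < b" using a by (simp add: b_def)
  obtain Z where Z: "Z 0 = emb p" "\<And>k. fmap a (Z k) = Z (k + 1)" "\<And>k. Z (k + int n) = Z k"
    "\<And>k. \<exists>m. (fmap a ^^ m) (Z k) = emb p"
    by (rule periodic_extension[OF n p]) blast
  have "Z k \<in> range emb" for k
    using Z(4)[of k] funpow_fmap_fin by (metis rangeI)
  then have "\<forall>k. \<exists>z. Z k = emb z" by blast
  from choice[OF this] obtain z where z: "\<And>k. Z k = emb (z k)" by blast
  define x y where "x k = fst (z k)" and "y k = snd (z k)" for k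
  have Zxy: "Z k = emb (x k, y k)" for k using z by (simp add: x_def y_def)
  have per: "x (k + int n) = x k" "y (k + int n) = y k" for k
    using Z(3)[of k] unfolding Zxy by simp_all
  have x1: "x k \<noteq> 1" for k
  proof
    assume "x k = 1"
    then have "fmap a (Z k) \<notin> range emb" unfolding Zxy by (simp add: fmap_emb range_emb)
    then show False using Z(2)[of k] Zxy[of "k + 1"] by simp
  qed
  have st: "x (k + 1) = y k * ((x k + a) / (x k - 1))" "y (k + 1) = x k + (a - 1)" for k
    using Z(2)[of k] x1[of k] unfolding Zxy by (simp_all add: fmap_emb)
  have per2: "x (k + int (n * m)) = x k" "y (k + int (n * m)) = y k" for k m
  proof (induction m)
    case (Suc m)
    have e: "k + int (n * Suc m) = (k + int (n * m)) + int n" by simp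
    case 1 show ?case unfolding e per using Suc by simp
    case 2 show ?case unfolding e per using Suc by simp
  qed simp_all
  have A1: "x (k + 1) \<le> y k \<and> x (k + 1) < 1 \<and> y (k + 1) \<le> 0" if "x k < 1" "y k \<le> 0" for k
  proof -
    have "1 \<le> (x k + a) / (x k - 1)" using that a by (simp add: le_divide_eq)
    then have "y k * ((x k + a) / (x k - 1)) \<le> y k * 1" using that by (intro mult_left_mono_neg) auto
    then have "x (k + 1) \<le> y k" unfolding st(1) by (simp only: mult_1_right)
    then show ?thesis using st(2)[of k] that a by simp
  qed
  have A2: "x (k + 2) \<le> x k - 2 \<and> x (k + 2) < 1 \<and> y (k + 2) \<le> 0" if "x k < 1" "y k \<le> 0" for k
  proof -
    have e: "k + 2 = k + 1 + 1" by simp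
    show ?thesis using A1[OF that] A1[of "k + 1"] st(2)[of k] that a unfolding e by auto
  qed
  \<comment> \<open>Two steps lower x by at least 2, but after 2 n steps x must be back.\<close>
  have notA: "\<not> (x k < 1 \<and> y k \<le> 0)" for k
  proof
    assume h: "x k < 1 \<and> y k \<le> 0"
    have "x (k + 2 * int m) \<le> x k - 2 * real m \<and> x (k + 2 * int m) < 1 \<and> y (k + 2 * int m) \<le> 0" for m
    proof (induction m)
      case (Suc m)
      have e: "k + 2 * int (Suc m) = k + 2 * int m + 2" by simp
      show ?case using A2[of "k + 2 * int m"] Suc unfolding e by auto
    qed (use h in simp)
    from this[of n] per2(1)[of k 2] n show False by (simp add: mult.commute)
  qed
  have B2: "0 \<le> x k \<and> - 1 < y k \<and> y (k + 2) + 2 \<le> y k" if h: "0 \<le> x (k + 2)" "- 1 < y (k + 2)" for k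
  proof -
    have bk: "0 \<le> x k \<and> - 1 < y k \<and> x (k + 1) \<le> y k" if "0 \<le> x (k + 1)" "- 1 < y (k + 1)" for k
    proof -
      have xk: "- a < x k" using st(2)[of k] that by simp
      then have r: "0 < (x k + a) / (x k - 1)" "(x k + a) / (x k - 1) \<le> 1" using a by (auto simp: divide_le_eq)
      have "0 \<le> y k" using st(1)[of k] that r(1) by (metis mult_neg_pos not_le)
      moreover have "x (k + 1) \<le> y k"
      proof -
        have "y k * ((x k + a) / (x k - 1)) \<le> y k * 1"
          using r \<open>0 \<le> y k\<close> by (intro mult_left_mono) auto
        then show ?thesis unfolding st(1) by (simp only: mult_1_right)
      qed
      ultimately show ?thesis using xk a by simp
    qed
    have e: "k + 2 = k + 1 + 1" by simp
    from bk[of "k + 1"] h have "0 \<le> x (k + 1)" "- 1 < y (k + 1)" unfolding e by auto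
    then show ?thesis using bk[of k] st(2)[of "k + 1"] a unfolding e by auto
  qed
  \<comment> \<open>The same in the past: two steps back raise y by at least 2.\<close>
  have notB: "\<not> (0 \<le> x k \<and> - 1 < y k)" for k
  proof
    assume h: "0 \<le> x k \<and> - 1 < y k"
    have "0 \<le> x (k - 2 * int m) \<and> - 1 < y (k - 2 * int m) \<and> y k + 2 * real m \<le> y (k - 2 * int m)" for m
    proof (induction m)
      case (Suc m)
      have e: "k - 2 * int m = (k - 2 * int (Suc m)) + 2" by simp
      show ?case using B2[of "k - 2 * int (Suc m)"] Suc unfolding e by auto
    qed (use h in simp)
    from this[of n] per2(2)[of "k - 2 * int n" 2] n show False by (simp add: mult.commute)
  qed
  have y1: "y k \<noteq> - 1" if "1 < x k" for k
  proof
    assume "y k = - 1"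
    then have "x (k - 1) + a = 0" using st(2)[of "k - 1"] by simp
    then have "x k = 0" using st(1)[of "k - 1"] by simp
    then show False using that by simp
  qed
  define w where "w k = (if 1 < x k then 0 else 1 :: nat)" for k
  define u v where "u k = (if 1 < x k then x k - 1 else - x k)" and "v k = (if 1 < x k then - 1 - y k else y k)" for k
  have zpt: "(x k, y k) = pt (w k) (u k) (v k)" "0 < u k" "0 < v k" for k
    using notA[of k] notB[of k] y1[of k] x1[of k] by (auto simp: w_def u_def v_def pt_def)
  have step: "step b (w k) (w (k+1)) (u k) (v k) (u (k+1)) (v (k+1))" for k
  proof (rule step_imp_fmap[THEN iffD1])
    show "fmap a (emb (pt (w k) (u k) (v k))) = emb (pt (w (k + 1)) (u (k + 1)) (v (k + 1)))"
      using Z(2)[of k] unfolding Zxy zpt(1) .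
  qed (use b b_def zpt in auto)
  have "w \<in> Sig"
  proof -
    have "\<not> (w k = 1 \<and> w (k + 1) = 1)" for k using step[of k] by (auto simp: step_def)
    then show ?thesis by (auto simp: Sig_def w_def)
  qed
  moreover have "emb p \<in> Rword a w"
  proof -
    have "pos_orb b w i j u v" for i j
      using step zpt less_imp_le unfolding pos_orb_def orb_def by blast
    moreover have "p = pt (w 0) (u 0) (v 0)" using Z(1) zpt(1)[of 0] unfolding Zxy by simp
    ultimately have "near b w p" unfolding near_def close_def
      by (intro allI impI exI[of _ u] exI[of _ v]) simp
    then show ?thesis using Rword_iff_near[OF a b_def] by simp
  qed
  ultimately show ?thesis by (auto simp: Omega_plane_def Omega_def)
qed

subsection \<open>Periodic orbits in the interiors are hyperbolic\<close>

text \<open>In the coordinates (d ln (1 + u), d ln (1 + v)) in the state 0 and (d ln v, d ln (1 + u)) in the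
  state 1, b1 is (1, 0) and b2 is (1, 1). In these bases the derivative of f is a matrix with
  nonnegative entries, up to sign.\<close>

definition b1 :: "nat \<Rightarrow> real \<Rightarrow> real \<Rightarrow> real \<times> real" where
  "b1 s u v = (if s = 0 then (1 + u, 0) else (0, v))"

definition b2 :: "nat \<Rightarrow> real \<Rightarrow> real \<Rightarrow> real \<times> real" where
  "b2 s u v = (if s = 0 then (1 + u, - 1 - v) else (- 1 - u, v))"

definition dfmap :: "real \<Rightarrow> real \<times> real \<Rightarrow> real \<times> real \<Rightarrow> real \<times> real" where
  "dfmap a z d = (snd d * ((fst z + a) / (fst z - 1)) + snd z * ((- 1 - a) / (fst z - 1)\<^sup>2 * fst d), fst d)"

text \<open>An infinitesimal cone condition. The sign -1 belongs to the step 00, where the order of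
  points is reversed. A step from 1 to 0 maps b1 to b1, so q is claimed to be positive only for
  steps out of the state 0.\<close>

lemma dfmap_basis:
  assumes a: "b = - 1 - a" "0 < b" and pos: "0 < u" "0 < v" "0 < u'" "0 < v'"
    and st: "step b s s' u v u' v'"
  obtains c p q r t where "c = 1 \<or> c = - 1" "0 < p" "0 \<le> q" "0 < r" "0 < t" "s = 0 \<Longrightarrow> 0 < q"
    "dfmap a (pt s u v) (b1 s u v) = c *\<^sub>R (p *\<^sub>R b1 s' u' v' + q *\<^sub>R b2 s' u' v')"
    "dfmap a (pt s u v) (b2 s u v) = c *\<^sub>R (r *\<^sub>R b1 s' u' v' + t *\<^sub>R b2 s' u' v')"
proof -
  have a': "a = - 1 - b" using a by simp
  have nz: "u \<noteq> 0" "v' \<noteq> 0" "1 + v' \<noteq> 0" "1 + u' \<noteq> 0" "1 + u \<noteq> 0" using pos by auto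
  have neg: "(- 1 - v) * x = - ((1 + v) * x)" for x by (simp add: algebra_simps)
  have D: "dfmap a (pt s u v) (b1 s u v) = ((- 1 - v) * (b / u\<^sup>2 * (1 + u)), 1 + u)"
    "dfmap a (pt s u v) (b2 s u v) = ((- 1 - v) * ((u - b) / u) + (- 1 - v) * (b / u\<^sup>2 * (1 + u)), 1 + u)" if "s = 0"
    using that by (simp_all add: dfmap_def pt_def b1_def b2_def a')
  consider (s00) "s = 0" "s' = 0" | (s01) "s = 0" "s' \<noteq> 0" | (s10) "s \<noteq> 0" "s' = 0"
    using st by (auto simp: step_def)
  then show ?thesis
  proof cases
    case s00
    have e: "b = u + v'" "1 + u' = (1 + v) * v' / u"
      using st s00 pos by (auto simp: step_def field_simps)
    \<comment> \<open>Comparison of components: the second gives q (1 + v') = 1 + u, the first gives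
      p + q. For b2 the coefficient p drops by 1, so p > 1 is what has to be proved.\<close>
    define p where "p = (1 + u) * (1 / u + 1 / v' - 1 / (1 + v'))"
    define q where "q = (1 + u) / (1 + v')"
    have q: "0 < q" using pos by (simp add: q_def)
    have "1 / (1 + v') < 1 / v'" using pos by (simp add: frac_less2)
    then have "0 < (1 + u) * (1 / v' - 1 / (1 + v'))" using pos by simp
    moreover have "p = (1 + u) * (1 / u) + (1 + u) * (1 / v' - 1 / (1 + v'))"
      by (simp add: p_def algebra_simps)
    then have "p - 1 = 1 / u + (1 + u) * (1 / v' - 1 / (1 + v'))"
      using nz by (simp add: add_divide_distrib)
    moreover have "0 < 1 / u" using pos by simp
    ultimately have p: "1 < p" by linarith
    have pq: "(p + q) * (1 + u') = (1 + v) * (b / u\<^sup>2 * (1 + u))"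
    proof -
      have "1 / u + 1 / v' = b / (u * v')" using e(1) nz by (simp add: field_simps)
      then have "p + q = (1 + u) * (b / (u * v'))" by (simp add: p_def q_def algebra_simps)
      then show ?thesis using e(2) nz by (simp add: power2_eq_square)
    qed
    have qv: "q * (1 + v') = 1 + u" using nz by (simp add: q_def)
    have d1: "dfmap a (pt s u v) (b1 s u v) = (- ((p + q) * (1 + u')), 1 + u)"
      unfolding pq D(1)[OF s00(1)] neg ..
    have d2: "dfmap a (pt s u v) (b2 s u v) = (- ((p + q) * (1 + u')) + (1 + u'), 1 + u)"
    proof -
      have x: "(- 1 - v) * ((u - b) / u) = 1 + u'" unfolding e using nz by (simp add: field_simps)
      show ?thesis unfolding D(2)[OF s00(1)] x unfolding pq neg by simp
    qed
    show ?thesis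
    proof (rule that[of "- 1" p q "p - 1" q])
      show "dfmap a (pt s u v) (b1 s u v) = - 1 *\<^sub>R (p *\<^sub>R b1 s' u' v' + q *\<^sub>R b2 s' u' v')"
        unfolding d1 using s00 qv by (simp add: b1_def b2_def algebra_simps)
      show "dfmap a (pt s u v) (b2 s u v) = - 1 *\<^sub>R ((p - 1) *\<^sub>R b1 s' u' v' + q *\<^sub>R b2 s' u' v')"
        unfolding d2 using s00 qv by (simp add: b1_def b2_def algebra_simps)
    qed (use p q in auto)
  next
    case s01
    have e: "u = v' + b + 1" "u' * u = (1 + v) * (1 + v')"
      using st s01 pos by (auto simp: step_def)
    \<comment> \<open>This is d ln (1 + u') / d ln u'. Passing from b1 to b2 moves the amount
      \<open>\<rho>\<close> from the first coefficient to the second, so the point is p >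
      \<open>\<rho>\<close>, that is, \<open>\<rho>\<close> (h + 1) < (1 + u) / v'.\<close>
    define \<rho> where "\<rho> = u' / (1 + u')"
    define h where "h = b * (1 + u) / (u * (1 + v'))"
    define q where "q = \<rho> * h"
    define p where "p = (1 + u) / v' - q"
    have \<rho>: "0 < \<rho>" "\<rho> < 1" using pos by (auto simp: \<rho>_def)
    have h: "0 < h" using pos a by (simp add: h_def)
    have "h + 1 = (1 + u) / (1 + v') - 1 / u"
    proof -
      have "(u - T) * (1 + u) / (u * T) = (1 + u) / T - (1 + u) / u" if "T \<noteq> 0" for T
        using nz that by (simp add: field_simps)
      moreover have "b = u - (1 + v')" using e by simp
      ultimately have "h = (1 + u) / (1 + v') - (1 + u) / u" using nz by (simp add: h_def)
      then show ?thesis using nz by (simp add: add_divide_distrib)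
    qed
    moreover have "(1 + u) / (1 + v') < (1 + u) / v'" using pos by (intro divide_strict_left_mono) auto
    moreover have "0 < 1 / u" using pos by simp
    ultimately have "h + 1 < (1 + u) / v'" by linarith
    moreover have "\<rho> * (h + 1) < 1 * (h + 1)" using \<rho> h by (intro mult_strict_right_mono) auto
    ultimately have r: "0 < p - \<rho>" by (simp add: p_def q_def algebra_simps)
    have q: "0 < q" using \<rho> h by (simp add: q_def)
    have U: "(1 + u') * q = (1 + v) * (b / u\<^sup>2 * (1 + u))"
    proof -
      have "(1 + u') * q = u' * h" using nz by (simp add: q_def \<rho>_def)
      moreover have "u' = (1 + v) * (1 + v') / u" using e nz by (metis nonzero_mult_div_cancel_right)
      then have "u' * h = (1 + v) * (1 + v') / u * h" by (rule arg_cong)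
      ultimately have "(1 + u') * q = (1 + v) * (1 + v') / u * h" by (rule trans)
      moreover have "(1 + v) * T / u * (b * (1 + u) / (u * T)) = (1 + v) * (b / u\<^sup>2 * (1 + u))"
        if "T \<noteq> 0" for T
        using nz that by (simp add: power2_eq_square)
      ultimately show ?thesis unfolding h_def using nz by simp
    qed
    have \<rho>u: "\<rho> * (1 + u') = u'" using nz by (simp add: \<rho>_def)
    have pv: "(p + q) * v' = 1 + u" using nz by (simp add: p_def)
    have d1: "dfmap a (pt s u v) (b1 s u v) = (- ((1 + u') * q), 1 + u)"
      unfolding U D(1)[OF s01(1)] neg ..
    have d2: "dfmap a (pt s u v) (b2 s u v) = (- ((1 + u') * q) - u', 1 + u)"
    proof -
      have "(- 1 - v) * (u - b) = - u' * u" using e by (simp add: algebra_simps)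
      then have x: "(- 1 - v) * ((u - b) / u) = - u'" using nz by (simp add: divide_eq_eq)
      show ?thesis unfolding D(2)[OF s01(1)] x unfolding U neg by simp
    qed
    show ?thesis
    proof (rule that[of 1 p q "p - \<rho>" "q + \<rho>"])
      show "dfmap a (pt s u v) (b1 s u v) = 1 *\<^sub>R (p *\<^sub>R b1 s' u' v' + q *\<^sub>R b2 s' u' v')"
        unfolding d1 using s01 pv by (simp add: b1_def b2_def algebra_simps)
      show "dfmap a (pt s u v) (b2 s u v) = 1 *\<^sub>R ((p - \<rho>) *\<^sub>R b1 s' u' v' + (q + \<rho>) *\<^sub>R b2 s' u' v')"
        unfolding d2 using s01 pv \<rho>u by (simp add: b1_def b2_def algebra_simps)
    qed (use r q \<rho> in auto)
  next
    case s10
    have e: "v' = u + b + 1" "(1 + u') * (1 + u) = v * v'"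
      using st s10 pos by (auto simp: step_def)
    define t where "t = (1 + u) / (1 + v')"
    define r where "r = (1 + u) / v' - t"
    have t: "0 < t" using pos by (simp add: t_def)
    have "(1 + u) / (1 + v') < (1 + u) / v'" using pos by (intro divide_strict_left_mono) auto
    then have r: "0 < r" by (simp add: r_def t_def)
    have tv: "t * (1 + v') = 1 + u" using nz by (simp add: t_def)
    have V: "v = (1 + u') * (1 + u) / v'" using e nz by (metis nonzero_mult_div_cancel_right)
    have x: "v * ((- u - 1 - b) / (- u - 1)) = 1 + u'"
    proof -
      have "(- u - 1 - b) / (- u - 1) = v' / (1 + u)"
        using e nz pos by (simp add: divide_simps) (simp add: algebra_simps)
      then show ?thesis unfolding V using nz by simp
    qed
    have D1: "dfmap a (pt s u v) (b1 s u v) = (v * ((- u - 1 - b) / (- u - 1)), 0)"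
      "dfmap a (pt s u v) (b2 s u v) = (v * ((- u - 1 - b) / (- u - 1)) + v * (b / (- u - 1)\<^sup>2 * (- 1 - u)), - 1 - u)"
      using s10 by (simp_all add: dfmap_def pt_def b1_def b2_def a')
    have d1: "dfmap a (pt s u v) (b1 s u v) = (1 + u', 0)"
      unfolding D1 x ..
    have rt: "(r + t) * (1 + u') = 1 + u' - v * (b / (1 + u))"
    proof -
      have "v * (b / (1 + u)) = (1 + u') * (b / v')" unfolding V using nz by simp
      moreover have "b / v' = 1 - (1 + u) / v'" using e nz by (simp add: field_simps)
      ultimately show ?thesis by (simp add: r_def algebra_simps)
    qed
    have d2: "dfmap a (pt s u v) (b2 s u v) = ((r + t) * (1 + u'), - 1 - u)"
    proof -
      have y: "v * (b / (- u - 1)\<^sup>2 * (- 1 - u)) = - (v * (b / (1 + u)))"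
      proof -
        have e2: "(- u - 1)\<^sup>2 = (1 + u)\<^sup>2" "- 1 - u = - (1 + u)" by (simp_all add: power2_eq_square algebra_simps)
        have gen: "v * (b / T\<^sup>2 * (- T)) = - (v * (b / T))" if "T \<noteq> 0" for T
          using that by (simp add: power2_eq_square)
        show ?thesis unfolding e2 by (rule gen[OF nz(5)])
      qed
      show ?thesis unfolding rt D1 x y by simp
    qed
    show ?thesis
    proof (rule that[of 1 1 0 r t])
      show "dfmap a (pt s u v) (b1 s u v) = 1 *\<^sub>R (1 *\<^sub>R b1 s' u' v' + 0 *\<^sub>R b2 s' u' v')"
        unfolding d1 using s10 by (simp add: b1_def b2_def)
      show "dfmap a (pt s u v) (b2 s u v) = 1 *\<^sub>R (r *\<^sub>R b1 s' u' v' + t *\<^sub>R b2 s' u' v')"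
        unfolding d2 using s10 tv by (simp add: b1_def b2_def algebra_simps)
    qed (use r t s10 in auto)
  qed
qed

text \<open>The area form dx dy / (y - x + 1) is invariant under f.\<close>

definition cross :: "real \<times> real \<Rightarrow> real \<times> real \<Rightarrow> real" where
  "cross d e = fst d * snd e - snd d * fst e"

text \<open>With k = (x + a) / (x - 1), the Jacobian determinant of f is -k, and y - x + 1 is
  multiplied by the same factor.\<close>

lemma cross_dfmap:
  assumes "fst z \<noteq> 1" and z': "z' = (snd z * ((fst z + a) / (fst z - 1)), fst z + (a - 1))"
  shows "cross (dfmap a z d) (dfmap a z e) * (snd z - fst z + 1) = cross d e * (snd z' - fst z' + 1)"
proof -
  define k where "k = (fst z + a) / (fst z - 1)"
  have k: "k * (fst z - 1) = fst z + a" using assms by (simp add: k_def)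
  have "cross (dfmap a z d) (dfmap a z e) = - k * cross d e"
    unfolding cross_def dfmap_def k_def[symmetric] fst_conv snd_conv by (simp add: algebra_simps)
  moreover have "snd z' - fst z' + 1 = - k * (snd z - fst z + 1)"
    using k unfolding z' k_def[symmetric] by (simp add: algebra_simps)
  ultimately show ?thesis by simp
qed

lemma has_derivative_fmap:
  assumes "fst z \<noteq> 1"
  shows "((\<lambda>z. (snd z * ((fst z + a) / (fst z - 1)), fst z + (a - 1))) has_derivative dfmap a z) (at z)"
proof -
  have *: "((\<lambda>x. (x + a) / (x - 1)) has_derivative (\<lambda>d. (- 1 - a) / (x - 1)\<^sup>2 * d)) (at x)" if "x \<noteq> 1" for x :: real
  proof -
    have "((\<lambda>x. (x + a) / (x - 1)) has_real_derivative (- 1 - a) / (x - 1)\<^sup>2) (at x)"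
      using that by (auto intro!: derivative_eq_intros simp: power2_eq_square field_simps)
    then show ?thesis unfolding has_field_derivative_def .
  qed
  have "((\<lambda>z::real \<times> real. (fst z + a) / (fst z - 1)) has_derivative (\<lambda>d. (- 1 - a) / (fst z - 1)\<^sup>2 * fst d)) (at z)"
    by (rule has_derivative_compose[OF has_derivative_fst[OF has_derivative_ident] *[OF assms]])
  then have "((\<lambda>z. snd z * ((fst z + a) / (fst z - 1))) has_derivative
     (\<lambda>d. snd z * ((- 1 - a) / (fst z - 1)\<^sup>2 * fst d) + snd d * ((fst z + a) / (fst z - 1)))) (at z)"
    by (rule has_derivative_mult[OF has_derivative_snd[OF has_derivative_ident]])
  moreover have "((\<lambda>z::real \<times> real. fst z + (a - 1)) has_derivative fst) (at z)"
    by (auto intro!: derivative_eq_intros)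
  ultimately have "((\<lambda>z. (snd z * ((fst z + a) / (fst z - 1)), fst z + (a - 1))) has_derivative
     (\<lambda>d. (snd z * ((- 1 - a) / (fst z - 1)\<^sup>2 * fst d) + snd d * ((fst z + a) / (fst z - 1)), fst d))) (at z)"
    by (rule has_derivative_Pair)
  moreover have "dfmap a z = (\<lambda>d. (snd z * ((- 1 - a) / (fst z - 1)\<^sup>2 * fst d) + snd d * ((fst z + a) / (fst z - 1)), fst d))"
    by (rule ext) (simp only: dfmap_def add.commute)
  ultimately show ?thesis by (simp only:)
qed

lemma funpow_fmap_pos_orb:
  assumes a: "a < - 1" "b = - 1 - a" and o: "pos_orb b w 0 (int N) u v" and k: "k \<le> N"
  shows "(fmap a ^^ k) (emb (pt (w 0) (u 0) (v 0))) = emb (pt (w (int k)) (u (int k)) (v (int k)))"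
  using k
proof (induction k)
  case (Suc k)
  then show ?case using fmap_emb_pos_orb[OF a o, of "int k"] by (simp add: add.commute)
qed simp

text \<open>Matrices with positive diagonal and nonnegative other entries are closed under products;
  r becomes positive after one step and q after a visit to the state 0. Finiteness of the iterate
  near the starting point is carried along because \<open>fin\<close> is meaningful only
  there.\<close>

lemma derivative_along_orb:
  assumes a: "a < - 1" "b = - 1 - a" and o: "pos_orb b w 0 (int N) u v" and k: "k \<le> N"
  shows "\<exists>D c p q r t. ((fin \<circ> (fmap a ^^ k) \<circ> emb) has_derivative D) (at (pt (w 0) (u 0) (v 0))) \<and>
     (\<forall>\<^sub>F z in nhds (pt (w 0) (u 0) (v 0)). (fmap a ^^ k) (emb z) \<in> range emb) \<and>
     (c = 1 \<or> c = - 1) \<and> 0 < p \<and> 0 \<le> q \<and> 0 \<le> r \<and> 0 < t \<and> (k \<noteq> 0 \<longrightarrow> 0 < r) \<and>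
     ((\<exists>i<k. w (int i) = 0) \<longrightarrow> 0 < q) \<and>
     D (b1 (w 0) (u 0) (v 0)) = c *\<^sub>R (p *\<^sub>R b1 (w (int k)) (u (int k)) (v (int k)) + q *\<^sub>R b2 (w (int k)) (u (int k)) (v (int k))) \<and>
     D (b2 (w 0) (u 0) (v 0)) = c *\<^sub>R (r *\<^sub>R b1 (w (int k)) (u (int k)) (v (int k)) + t *\<^sub>R b2 (w (int k)) (u (int k)) (v (int k))) \<and>
     (\<forall>d e. cross (D d) (D e) * (snd (pt (w 0) (u 0) (v 0)) - fst (pt (w 0) (u 0) (v 0)) + 1) =
        cross d e * (snd (pt (w (int k)) (u (int k)) (v (int k))) - fst (pt (w (int k)) (u (int k)) (v (int k))) + 1))"
  using k
proof (induction k)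
  case 0
  have "fin \<circ> (fmap a ^^ 0) \<circ> emb = (\<lambda>z. z)" by (auto simp: fin_def emb_def fun_eq_iff)
  then have d: "((fin \<circ> (fmap a ^^ 0) \<circ> emb) has_derivative (\<lambda>d. d)) (at (pt (w 0) (u 0) (v 0)))"
    by (simp only: has_derivative_ident)
  show ?case
    by (rule exI[of _ "\<lambda>d. d"], rule exI[of _ 1], rule exI[of _ 1], rule exI[of _ 0], rule exI[of _ 0],
      rule exI[of _ 1], intro conjI; (rule d | simp))
next
  case (Suc k)
  let ?z = "\<lambda>k. pt (w k) (u k) (v k)"
  let ?g = "fin \<circ> (fmap a ^^ k) \<circ> emb"
  let ?F = "\<lambda>z::real \<times> real. (snd z * ((fst z + a) / (fst z - 1)), fst z + (a - 1))"
  from Suc.IH[OF Suc_leD[OF Suc.prems]] obtain D c p q r t where D: "(?g has_derivative D) (at (?z 0))"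
    and ev: "\<forall>\<^sub>F z in nhds (?z 0). (fmap a ^^ k) (emb z) \<in> range emb"
    and c: "c = 1 \<or> c = - 1" and pos: "0 < p" "0 \<le> q" "0 \<le> r" "0 < t" "k \<noteq> 0 \<longrightarrow> 0 < r"
      "(\<exists>i<k. w (int i) = 0) \<longrightarrow> 0 < q"
    and D1: "D (b1 (w 0) (u 0) (v 0)) = c *\<^sub>R (p *\<^sub>R b1 (w (int k)) (u (int k)) (v (int k)) + q *\<^sub>R b2 (w (int k)) (u (int k)) (v (int k)))"
    and D2: "D (b2 (w 0) (u 0) (v 0)) = c *\<^sub>R (r *\<^sub>R b1 (w (int k)) (u (int k)) (v (int k)) + t *\<^sub>R b2 (w (int k)) (u (int k)) (v (int k)))"
    and cr: "\<forall>d e. cross (D d) (D e) * (snd (?z 0) - fst (?z 0) + 1) = cross d e * (snd (?z (int k)) - fst (?z (int k)) + 1)"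
    by (elim exE conjE)
  have gz: "?g (?z 0) = ?z (int k)"
    using funpow_fmap_pos_orb[OF a o, of k] Suc.prems by (simp add: fin_def emb_def prod_eq_iff)
  have ps: "0 < u (int k)" "0 < v (int k)" "0 < u (int k + 1)" "0 < v (int k + 1)"
    using o Suc.prems by (auto simp: pos_orb_def)
  have st: "step b (w (int k)) (w (int k + 1)) (u (int k)) (v (int k)) (u (int k + 1)) (v (int k + 1))"
    using o Suc.prems by (intro orb_step[of b w 0 "int N"]) (auto simp: pos_orb_def)
  have x1: "fst (?z (int k)) \<noteq> 1" using ps by (simp add: pt_def)
  have Fz: "?F (?z (int k)) = ?z (int k + 1)"
  proof -
    have "fmap a (emb (?z (int k))) = emb (?z (int k + 1))"
      using fmap_emb_pos_orb[OF a o, of "int k"] Suc.prems by simp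
    moreover have "fmap a (emb (?z (int k))) = emb (?F (?z (int k)))"
      using fmap_emb[of a "fst (?z (int k))" "snd (?z (int k))"] x1 by simp
    ultimately show ?thesis by simp
  qed
  \<comment> \<open>By continuity the k-th iterate avoids the line x = 1 near the starting point, so
    the next application of \<open>fmap\<close> is the rational formula on a whole
    neighbourhood.\<close>
  have "isCont ?g (?z 0)" using D has_derivative_continuous by blast
  then have "((\<lambda>z. fst (?g z)) \<longlongrightarrow> fst (?g (?z 0))) (nhds (?z 0))"
    unfolding isCont_def tendsto_at_iff_tendsto_nhds by (rule tendsto_fst)
  then have "\<forall>\<^sub>F z in nhds (?z 0). fst (?g z) \<noteq> 1"
    using x1 unfolding gz by (rule tendsto_imp_eventually_ne)
  with ev have ev': "\<forall>\<^sub>F z in nhds (?z 0). (fmap a ^^ Suc k) (emb z) = emb (?F (?g z))"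
  proof eventually_elim
    case (elim z)
    then obtain y where y: "(fmap a ^^ k) (emb z) = emb y" by blast
    then have "?g z = y" by (simp add: fin_def emb_def prod_eq_iff)
    then show ?case using y elim fmap_emb[of a "fst y" "snd y"] by simp
  qed
  have D0: "((\<lambda>z. ?F (?g z)) has_derivative (\<lambda>d. dfmap a (?z (int k)) (D d))) (at (?z 0))"
    by (rule has_derivative_compose[OF D]) (use has_derivative_fmap[OF x1] gz in simp)
  have e1: "\<forall>\<^sub>F z in nhds (?z 0). ?F (?g z) = (fin \<circ> (fmap a ^^ Suc k) \<circ> emb) z"
    using ev' by (rule eventually_mono) (simp add: fin_def emb_def)
  have "\<forall>\<^sub>F z in at (?z 0). ?F (?g z) = (fin \<circ> (fmap a ^^ Suc k) \<circ> emb) z"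
    unfolding eventually_at_filter by (rule eventually_mono[OF e1]) blast
  from has_derivative_transform_eventually[OF D0 this eventually_nhds_x_imp_x[OF e1] UNIV_I]
  have D': "((fin \<circ> (fmap a ^^ Suc k) \<circ> emb) has_derivative (\<lambda>d. dfmap a (?z (int k)) (D d))) (at (?z 0))" .
  have ev2: "\<forall>\<^sub>F z in nhds (?z 0). (fmap a ^^ Suc k) (emb z) \<in> range emb"
    using ev' by (rule eventually_mono) simp
  obtain c' p' q' r' t' where M: "c' = 1 \<or> c' = - 1" "0 < p'" "0 \<le> q'" "0 < r'" "0 < t'" "w (int k) = 0 \<Longrightarrow> 0 < q'"
    "dfmap a (?z (int k)) (b1 (w (int k)) (u (int k)) (v (int k))) =
       c' *\<^sub>R (p' *\<^sub>R b1 (w (int k + 1)) (u (int k + 1)) (v (int k + 1)) + q' *\<^sub>R b2 (w (int k + 1)) (u (int k + 1)) (v (int k + 1)))"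
    "dfmap a (?z (int k)) (b2 (w (int k)) (u (int k)) (v (int k))) =
       c' *\<^sub>R (r' *\<^sub>R b1 (w (int k + 1)) (u (int k + 1)) (v (int k + 1)) + t' *\<^sub>R b2 (w (int k + 1)) (u (int k + 1)) (v (int k + 1)))"
    by (rule dfmap_basis[OF a(2) _ ps st]) (use a in auto)
  have lin: "dfmap a z (s *\<^sub>R (x *\<^sub>R d + y *\<^sub>R e)) = s *\<^sub>R (x *\<^sub>R dfmap a z d + y *\<^sub>R dfmap a z e)" for z s x y d e
  proof -
    define A B where "A = (fst z + a) / (fst z - 1)" and "B = (- 1 - a) / (fst z - 1)\<^sup>2"
    show ?thesis unfolding dfmap_def A_def[symmetric] B_def[symmetric] by (simp add: algebra_simps)
  qed
  have comb: "c *\<^sub>R (x *\<^sub>R (c' *\<^sub>R (p' *\<^sub>R d + q' *\<^sub>R e)) + y *\<^sub>R (c' *\<^sub>R (r' *\<^sub>R d + t' *\<^sub>R e))) =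
      (c * c') *\<^sub>R ((x * p' + y * r') *\<^sub>R d + (x * q' + y * t') *\<^sub>R e)" for x y and d e :: "real \<times> real"
    by (rule prod_eqI) (simp_all add: algebra_simps)
  have e: "int (Suc k) = int k + 1" by simp
  have cc: "c * c' = 1 \<or> c * c' = - 1" using c M(1) by auto
  have m: "0 < x * y" if "0 < x" "0 < y" for x y :: real using that by simp
  have n: "0 \<le> x * y" if "0 \<le> x" "0 \<le> y" for x y :: real using that by simp
  note le = less_imp_le[OF pos(1)] less_imp_le[OF pos(4)] less_imp_le[OF M(2)] less_imp_le[OF M(4)] less_imp_le[OF M(5)]
  have P: "0 < p * p' + q * r'" "0 \<le> p * q' + q * t'" "0 < r * p' + t * r'" "0 < r * q' + t * t'"
    subgoal by (rule add_pos_nonneg[OF m n]; rule pos le M)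
    subgoal by (rule add_nonneg_nonneg[OF n n]; rule pos le M)
    subgoal by (rule add_nonneg_pos[OF n m]; rule pos le M)
    subgoal by (rule add_nonneg_pos[OF n m]; rule pos le M)
    done
  have Q: "0 < p * q' + q * t'" if "\<exists>i<Suc k. w (int i) = 0"
  proof (cases "w (int k) = 0")
    case True
    show ?thesis by (rule add_pos_nonneg[OF m n]; rule pos le M(6)[OF True])
  next
    case False
    then have "\<exists>i<k. w (int i) = 0" using that less_Suc_eq by metis
    then have "0 < q" using pos(6) by blast
    then show ?thesis by (intro add_nonneg_pos[OF n m]) (use pos M in simp_all)
  qed
  have cr': "cross (dfmap a (?z (int k)) (D d)) (dfmap a (?z (int k)) (D e)) * (snd (?z 0) - fst (?z 0) + 1) =
      cross d e * (snd (?z (int k + 1)) - fst (?z (int k + 1)) + 1)" for d e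
  proof -
    let ?s = "\<lambda>k. snd (?z k) - fst (?z k) + 1"
    have nz: "?s (int k) \<noteq> 0" using ps by (auto simp: pt_def)
    have 1: "cross (dfmap a (?z (int k)) (D d)) (dfmap a (?z (int k)) (D e)) * ?s (int k) = cross (D d) (D e) * ?s (int k + 1)"
      by (rule cross_dfmap[OF x1 Fz[symmetric]])
    have swap: "(x * s0) * sk = (y * s1) * sk" if "x * sk = z * s1" "z * s0 = y * sk" for x y z s0 s1 sk :: real
    proof -
      have "(x * s0) * sk = (x * sk) * s0" by (simp only: ac_simps)
      also have "\<dots> = (z * s0) * s1" unfolding that(1) by (simp only: ac_simps)
      also have "\<dots> = (y * s1) * sk" unfolding that(2) by (simp only: ac_simps)
      finally show ?thesis .
    qed
    have "(cross (dfmap a (?z (int k)) (D d)) (dfmap a (?z (int k)) (D e)) * ?s 0) * ?s (int k) =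
      (cross d e * ?s (int k + 1)) * ?s (int k)"
      by (rule swap[OF 1 cr[rule_format]])
    then show ?thesis using nz mult_right_cancel by blast
  qed
  show ?case unfolding e
  proof (intro exI conjI)
    show "((fin \<circ> (fmap a ^^ Suc k) \<circ> emb) has_derivative (\<lambda>d. dfmap a (?z (int k)) (D d))) (at (?z 0))" by (rule D')
    show "dfmap a (?z (int k)) (D (b1 (w 0) (u 0) (v 0))) = (c * c') *\<^sub>R
       ((p * p' + q * r') *\<^sub>R b1 (w (int k + 1)) (u (int k + 1)) (v (int k + 1)) +
        (p * q' + q * t') *\<^sub>R b2 (w (int k + 1)) (u (int k + 1)) (v (int k + 1)))"
      unfolding D1 lin M(7,8) comb ..
    show "dfmap a (?z (int k)) (D (b2 (w 0) (u 0) (v 0))) = (c * c') *\<^sub>R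
       ((r * p' + t * r') *\<^sub>R b1 (w (int k + 1)) (u (int k + 1)) (v (int k + 1)) +
        (r * q' + t * t') *\<^sub>R b2 (w (int k + 1)) (u (int k + 1)) (v (int k + 1)))"
      unfolding D2 lin M(7,8) comb ..
  qed (use ev2 cc P Q cr' in auto)
qed

lemma eigenvalue_cmatrix:
  fixes l :: real
  assumes D: "linear D" and d: "D d = l *\<^sub>R d" "d \<noteq> 0"
  shows "eigenvalue (cmatrix D) (of_real l)"
proof -
  let ?x = "vec 2 (\<lambda>i. of_real (if i = 0 then fst d else snd d)) :: complex vec"
  have "D d = D (fst d *\<^sub>R (1, 0) + snd d *\<^sub>R (0, 1))" by simp
  also have "\<dots> = fst d *\<^sub>R D (1, 0) + snd d *\<^sub>R D (0, 1)" using D by (simp only: linear_add linear_scale)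
  finally have Dd: "l *\<^sub>R d = fst d *\<^sub>R D (1, 0) + snd d *\<^sub>R D (0, 1)" using d(1) by simp
  have e: "fst d * fst (D (1, 0)) + snd d * fst (D (0, 1)) = l * fst d"
    "fst d * snd (D (1, 0)) + snd d * snd (D (0, 1)) = l * snd d"
    using arg_cong[OF Dd, of fst] arg_cong[OF Dd, of snd] by simp_all
  have dim: "dim_row (cmatrix D) = 2" "dim_col (cmatrix D) = 2" by (simp_all add: cmatrix_def mat_of_rows_list_def)
  have two: "{0..<2} = {0, 1 :: nat}" by auto
  have ent: "cmatrix D $$ (0, 0) = of_real (fst (D (1, 0)))" "cmatrix D $$ (0, 1) = of_real (fst (D (0, 1)))"
    "cmatrix D $$ (1, 0) = of_real (snd (D (1, 0)))" "cmatrix D $$ (1, 1) = of_real (snd (D (0, 1)))"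
    by (simp_all add: cmatrix_def mat_of_rows_list_def)
  have mv: "(cmatrix D *\<^sub>v ?x) $ i = cmatrix D $$ (i, 0) * of_real (fst d) + cmatrix D $$ (i, 1) * of_real (snd d)"
    if "i < 2" for i
    using that dim by (simp add: scalar_prod_def two)
  have "eigenvector (cmatrix D) ?x (of_real l)"
    unfolding eigenvector_def dim
  proof (intro conjI)
    show "?x \<in> carrier_vec 2" by (rule vec_carrier)
    show "?x \<noteq> 0\<^sub>v 2"
    proof
      assume z: "?x = 0\<^sub>v 2"
      have "fst d = 0" using arg_cong[OF z, of "\<lambda>v. vec_index v 0"] by simp
      moreover have "snd d = 0" using arg_cong[OF z, of "\<lambda>v. vec_index v 1"] by simp
      ultimately show False using d(2) by (simp add: prod_eq_iff)
    qed
    show "cmatrix D *\<^sub>v ?x = of_real l \<cdot>\<^sub>v ?x"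
    proof (rule eq_vecI)
      fix i assume "i < dim_vec (of_real l \<cdot>\<^sub>v ?x)"
      then have "i = 0 \<or> i = 1" by auto
      then show "(cmatrix D *\<^sub>v ?x) $ i = (of_real l \<cdot>\<^sub>v ?x) $ i"
      proof
        assume i: "i = 0"
        have "(cmatrix D *\<^sub>v ?x) $ 0 = of_real (fst d * fst (D (1, 0)) + snd d * fst (D (0, 1)))"
          using mv[of 0] unfolding ent by (simp add: mult.commute)
        then show ?thesis unfolding e i by simp
      next
        assume i: "i = 1"
        have "(cmatrix D *\<^sub>v ?x) $ 1 = of_real (fst d * snd (D (1, 0)) + snd d * snd (D (0, 1)))"
          using mv[of 1] unfolding ent by (simp add: mult.commute)
        then show ?thesis unfolding e i by simp
      qed
    qed (simp add: dim)
  qed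
  then show ?thesis unfolding eigenvalue_def by blast
qed

text \<open>The density of the area form is the same at both ends and cancels, so p t - q r = 1. As
  q and r are positive, p t > 1 and (p + t)^2 = (p - t)^2 + 4 p t > 4. The eigenvalues are real and
  reciprocal up to the sign c.\<close>

lemma closed_pos_orb_saddle:
  assumes a: "a < - 1" "b = - 1 - a" and N: "1 \<le> N" and o: "pos_orb b w 0 (int N) u v"
    and per: "w (int N) = w 0" "u (int N) = u 0" "v (int N) = v 0"
  shows "saddle_periodic a (pt (w 0) (u 0) (v 0))"
proof -
  let ?p = "pt (w 0) (u 0) (v 0)"
  let ?e1 = "b1 (w 0) (u 0) (v 0)" and ?e2 = "b2 (w 0) (u 0) (v 0)"
  have ps: "0 < u 0" "0 < v 0" using o N by (auto simp: pos_orb_def)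
  \<comment> \<open>A closed orbit cannot stay in the state 1; its visit to the state 0 gives q >
    0.\<close>
  have w0: "\<exists>i<N. w (int i) = 0"
  proof (cases "w 0 = 0")
    case True
    then show ?thesis using N by (intro exI[of _ 0]) simp
  next
    case False
    have "step b (w 0) (w (0 + 1)) (u 0) (v 0) (u (0 + 1)) (v (0 + 1))"
      using o N by (intro orb_step[of b w 0 "int N"]) (auto simp: pos_orb_def)
    then have "w 1 = 0" using False by (simp add: step_def)
    moreover have "N \<noteq> 1" using per(1) calculation False by auto
    ultimately show ?thesis using N by (intro exI[of _ 1]) simp
  qed
  from derivative_along_orb[OF a o order_refl] obtain D c p q r t where
    D: "((fin \<circ> (fmap a ^^ N) \<circ> emb) has_derivative D) (at ?p)" and
    c: "c = 1 \<or> c = - 1" and pos: "0 < p" "0 \<le> q" "0 \<le> r" "0 < t" "N \<noteq> 0 \<longrightarrow> 0 < r" "(\<exists>i<N. w (int i) = 0) \<longrightarrow> 0 < q" and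
    D1: "D ?e1 = c *\<^sub>R (p *\<^sub>R ?e1 + q *\<^sub>R ?e2)" and D2: "D ?e2 = c *\<^sub>R (r *\<^sub>R ?e1 + t *\<^sub>R ?e2)" and
    cr: "\<forall>d e. cross (D d) (D e) * (snd ?p - fst ?p + 1) = cross d e * (snd ?p - fst ?p + 1)"
    unfolding per by (elim exE conjE)
  have rq: "0 < r" "0 < q" using pos N w0 by auto
  have s0: "snd ?p - fst ?p + 1 \<noteq> 0" using ps by (auto simp: pt_def)
  have e12: "cross ?e1 ?e2 \<noteq> 0" using ps by (simp add: cross_def b1_def b2_def)
  have "cross (D ?e1) (D ?e2) = (p * t - q * r) * cross ?e1 ?e2"
    using c unfolding D1 D2 by (auto simp: cross_def algebra_simps)
  moreover have "cross (D ?e1) (D ?e2) = cross ?e1 ?e2" using cr[rule_format, of ?e1 ?e2] s0 by simp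
  ultimately have det: "p * t - q * r = 1" using e12 by simp
  define \<tau> where "\<tau> = p + t"
  have "4 < \<tau>\<^sup>2"
  proof -
    have "\<tau>\<^sup>2 = (p - t)\<^sup>2 + 4 * (p * t)" by (simp add: \<tau>_def power2_eq_square algebra_simps)
    moreover have "1 < p * t" using det rq by (simp add: algebra_simps)
    ultimately show ?thesis by (smt (verit) zero_le_power2)
  qed
  then have \<tau>: "2 < \<tau>" using pos power2_less_imp_less[of 2 \<tau>] by (simp add: \<tau>_def)
  define \<mu> where "\<mu> = (\<tau> + sqrt (\<tau>\<^sup>2 - 4)) / 2"
  have sq: "0 < sqrt (\<tau>\<^sup>2 - 4)" "(sqrt (\<tau>\<^sup>2 - 4))\<^sup>2 = \<tau>\<^sup>2 - 4" using \<open>4 < \<tau>\<^sup>2\<close> by auto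
  have "2 < \<tau> + sqrt (\<tau>\<^sup>2 - 4)" using \<tau> sq(1) by linarith
  then have \<mu>: "1 < \<mu>" by (simp add: \<mu>_def)
  have root: "\<mu>\<^sup>2 - \<tau> * \<mu> + 1 = 0"
  proof -
    have "4 * (\<mu>\<^sup>2 - \<tau> * \<mu> + 1) = (sqrt (\<tau>\<^sup>2 - 4))\<^sup>2 - \<tau>\<^sup>2 + 4"
      by (simp add: \<mu>_def power2_eq_square field_simps)
    then show ?thesis using sq(2) by simp
  qed
  have root': "(1 / \<mu>)\<^sup>2 - \<tau> * (1 / \<mu>) + 1 = 0"
  proof -
    have "\<mu>\<^sup>2 * ((1 / \<mu>)\<^sup>2 - \<tau> * (1 / \<mu>) + 1) = \<mu>\<^sup>2 - \<tau> * \<mu> + 1"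
      using \<mu> by (simp add: power2_eq_square algebra_simps)
    then show ?thesis using root \<mu> by simp
  qed
  have lin: "linear D" using D has_derivative_linear by blast
  have eig: "eigenvalue (cmatrix D) (of_real (c * m))" if m: "m\<^sup>2 - \<tau> * m + 1 = 0" for m
  proof (rule eigenvalue_cmatrix[OF lin])
    \<comment> \<open>The b1-coefficient fixes this vector; comparing b2-coefficients gives the
      characteristic equation. Its independence of \<open>?e2\<close>, as r > 0, shows that it is
      nonzero.\<close>
    let ?d = "r *\<^sub>R ?e1 + (m - p) *\<^sub>R ?e2"
    have "D ?d = r *\<^sub>R D ?e1 + (m - p) *\<^sub>R D ?e2" using lin by (simp only: linear_add linear_scale)
    also have "\<dots> = c *\<^sub>R ((r * p + (m - p) * r) *\<^sub>R ?e1 + (r * q + (m - p) * t) *\<^sub>R ?e2)"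
      unfolding D1 D2 by (simp add: algebra_simps)
    also have "r * p + (m - p) * r = m * r" by (simp add: algebra_simps)
    also have "r * q + (m - p) * t = m * (m - p)"
      using m det by (simp add: \<tau>_def power2_eq_square algebra_simps)
    finally show "D ?d = (c * m) *\<^sub>R ?d" by (simp add: scaleR_add_right mult.assoc)
    have "cross ?d ?e2 = r * cross ?e1 ?e2" by (simp add: cross_def algebra_simps)
    then have "cross ?d ?e2 \<noteq> 0" using rq e12 by simp
    moreover have "cross 0 ?e2 = 0" by (simp add: cross_def)
    ultimately show "?d \<noteq> 0" by metis
  qed
  have per': "(fmap a ^^ N) (emb ?p) = emb ?p"
    using funpow_fmap_pos_orb[OF a o order_refl] per by simp
  have ind: "(fmap a ^^ i) (emb ?p) \<notin> indet a" if "i < N" for i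
  proof -
    have "(fmap a ^^ i) (emb ?p) = emb (pt (w (int i)) (u (int i)) (v (int i)))"
      using funpow_fmap_pos_orb[OF a o, of i] that by simp
    moreover have "0 < u (int i)" "0 < v (int i)" using o that by (auto simp: pos_orb_def)
    ultimately show ?thesis by (auto simp: indet_def emb_def pt_def)
  qed
  have "cmod (of_real (c * \<mu>)) > 1" "cmod (of_real (c * (1 / \<mu>))) < 1"
    unfolding norm_of_real using c \<mu> by auto
  then show ?thesis unfolding saddle_periodic_def
    using N per' ind D eig[OF root] eig[OF root'] by blast
qed

subsection \<open>Periodic orbits with prescribed itinerary\<close>

text \<open>The step out of a point makes one of its coordinates positive and the step into it makes
  the other one positive. At every point of a closed orbit both are available.\<close>

lemma step_pos:
  assumes "0 < b" "step b s s' u v u' v'" "0 \<le> u" "0 \<le> v" "0 \<le> u'" "0 \<le> v'"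
  shows "(if s = 0 then 0 < u else 0 < v) \<and> (if s' = 0 then 0 < v' else 0 < u')"
proof (cases "s = 0")
  case s: True
  show ?thesis
  proof (cases "s' = 0")
    case True
    then have h: "v' = b - u" "(1 + u') * u = (1 + v) * v'" using s assms by (auto simp: step_def)
    have "u = 0 \<longleftrightarrow> v' = 0" using h(2) assms(3-6)
      by (metis add_nonneg_eq_0_iff mult_eq_0_iff zero_le_one zero_neq_one)
    then show ?thesis using h assms s True by auto
  next
    case False
    then have h: "u = v' + b + 1" "u' * u = (1 + v) * (1 + v')" using s assms by (auto simp: step_def)
    have "0 < (1 + v) * (1 + v')" using assms by (intro mult_pos_pos) auto
    then have "u' \<noteq> 0" using h(2) by auto
    then show ?thesis using h assms s False by auto
  qed
next
  case s: False
  then have h: "s' = 0" "v' = u + b + 1" "(1 + u') * (1 + u) = v * v'" using assms by (auto simp: step_def)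
  have "0 < (1 + u') * (1 + u)" using assms by (intro mult_pos_pos) auto
  then have "v \<noteq> 0" using h(3) by auto
  then show ?thesis using h assms s by auto
qed

text \<open>The closed segment is repeated by reducing times to {i..<j}. Letters and coordinates
  agree at i and j, so the relation also holds across the seam.\<close>

lemma exists_periodic_orb:
  assumes b: "0 < b" and w: "no11 w" "\<And>k. w k \<in> {0, 1}"
    and ij: "i < j" "w i = 0" "w (i + 1) = 0" "w (j - 1) = 0" "w j = 0"
  shows "\<exists>W u v N. 1 \<le> N \<and> no11 W \<and> (\<forall>k. W k \<in> {0, 1}) \<and> (\<forall>k\<in>{i..j}. W k = w k) \<and>
    (\<forall>k l. pos_orb b W k l u v) \<and> W (int N) = W 0 \<and> u (int N) = u 0 \<and> v (int N) = v 0"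
proof -
  obtain u v where o: "orb b w i j u v" and c: "u i = u j" "v i = v j"
    using exists_closed_orb[OF b w(1) ij] by blast
  define N where "N = nat (j - i)"
  have N: "int N = j - i" "1 \<le> N" using ij by (auto simp: N_def)
  define m where "m k = i + (k - i) mod (j - i)" for k
  have m: "i \<le> m k" "m k < j" for k
  proof -
    have "0 \<le> (k - i) mod (j - i)" "(k - i) mod (j - i) < j - i"
      by (rule pos_mod_sign pos_mod_bound; use ij in simp)+
    then show "i \<le> m k" "m k < j" by (simp_all add: m_def)
  qed
  have msuc: "f (m (k + 1)) = f (m k + 1)" if "f i = f j" for f :: "int \<Rightarrow> 'a" and k
  proof -
    have "(k + 1 - i) mod (j - i) = ((k - i) mod (j - i) + 1) mod (j - i)"
    proof -
      have e0: "k + 1 - i = (k - i) + 1" by simp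
      show ?thesis unfolding e0 mod_add_left_eq ..
    qed
    then have e: "m (k + 1) = i + (m k - i + 1) mod (j - i)" by (simp add: m_def)
    show ?thesis
    proof (cases "m k + 1 = j")
      case True
      then have h: "m k - i + 1 = j - i" by simp
      have "m (k + 1) = i" using e unfolding h by simp
      then show ?thesis using True that by simp
    next
      case False
      then have "(m k - i + 1) mod (j - i) = m k - i + 1"
        using m[of k] by (intro mod_pos_pos_trivial) auto
      then have "m (k + 1) = m k + 1" using e by simp
      then show ?thesis by simp
    qed
  qed
  have wc: "w i = w j" using ij by simp
  have st: "step b (w (m k)) (w (m (k+1))) (u (m k)) (v (m k)) (u (m (k+1))) (v (m (k+1)))" for k
    unfolding msuc[of w, OF wc] msuc[of u, OF c(1)] msuc[of v, OF c(2)] by (rule orb_step[OF o m])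
  have nn: "0 \<le> u (m k)" "0 \<le> v (m k)" for k
    using orbD[OF o m(1) less_imp_le[OF m(2)]] by auto
  have per: "m (int N) = m 0"
  proof -
    have h: "int N - i = (0 - i) + (j - i)" using N(1) by simp
    show ?thesis unfolding m_def h mod_add_self2 ..
  qed
  have pos: "0 < u (m k) \<and> 0 < v (m k)" for k
  proof -
    have "step b (w (m (k - 1))) (w (m k)) (u (m (k - 1))) (v (m (k - 1))) (u (m k)) (v (m k))"
      using st[of "k - 1"] by simp
    from step_pos[OF b this nn nn] step_pos[OF b st[of k] nn nn] show ?thesis by (auto split: if_splits)
  qed
  show ?thesis
  proof (intro exI conjI)
    \<comment> \<open>No separate check at the seam is needed: \<open>step\<close> itself forbids
      two consecutive nonzero states.\<close>
    show "no11 (\<lambda>k. w (m k))"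
      unfolding no11_def using st by (metis step_def)
    show "\<forall>k l. pos_orb b (\<lambda>k. w (m k)) k l (\<lambda>k. u (m k)) (\<lambda>k. v (m k))"
      using st nn pos unfolding pos_orb_def orb_def by blast
    show "1 \<le> N" by (rule N(2))
    show "\<forall>k\<in>{i..j}. w (m k) = w k"
    proof
      fix k assume k: "k \<in> {i..j}"
      show "w (m k) = w k"
      proof (cases "k = j")
        case True
        then show ?thesis using wc by (simp add: m_def)
      next
        case False
        then have "(k - i) mod (j - i) = k - i" using k by (intro mod_pos_pos_trivial) auto
        then show ?thesis by (simp add: m_def)
      qed
    qed
  qed (use w(2) per in simp_all)
qed

section \<open>Correspondence between finite points and words; approximation by saddles\<close>

lemma close_pt:
  "close e (pt s u v) (pt s p q) \<longleftrightarrow> \<bar>u - p\<bar> < e \<and> \<bar>v - q\<bar> < e"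
proof -
  have "\<bar>q - v\<bar> = \<bar>v - q\<bar>" "\<bar>p - u\<bar> = \<bar>u - p\<bar>" by (rule abs_minus_commute)+
  then show ?thesis by (cases "s = 0") (simp_all add: close_def pt_def)
qed

lemma close_trans: "close d p q \<Longrightarrow> close e q r \<Longrightarrow> close (d + e) p r"
  unfolding close_def abs_less_iff by auto

lemma close_sym: "close e p q = close e q p"
  unfolding close_def abs_less_iff by auto

lemma pos_orb_cong:
  assumes "pos_orb b w i j u v" "\<And>k. i \<le> k \<Longrightarrow> k \<le> j \<Longrightarrow> w' k = w k"
  shows "pos_orb b w' i j u v"
  using assms unfolding pos_orb_def orb_def by auto

text \<open>A finite p bounds u 0 and v 0 along its approximating orbits, which forces 00 on both
  sides of the word and makes the contraction available. The conclusion covers every positive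
  segment following the word on the window, so it serves both uniqueness and approximation.\<close>

lemma near_contraction:
  assumes b: "0 < b" and w: "no11 w" and p: "near b w p" and e: "0 < e"
  obtains N :: nat where "\<And>u v. pos_orb b w (- int N) (int N) u v \<Longrightarrow> close e (pt (w 0) (u 0) (v 0)) p"
proof -
  define C where "C = \<bar>fst p\<bar> + \<bar>snd p\<bar> + 2"
  have *: "\<exists>u v. orb b w (- int n) (int n) u v \<and> u 0 \<le> C \<and> v 0 \<le> C" for n
  proof -
    have "\<exists>u v. pos_orb b w (- int n) (int n) u v \<and> close 1 (pt (w 0) (u 0) (v 0)) p"
      using p unfolding near_def by simp
    then obtain u v where "pos_orb b w (- int n) (int n) u v" "close 1 (pt (w 0) (u 0) (v 0)) p" by blast
    then show ?thesis
      by (intro exI[of _ u] exI[of _ v]) (auto simp: pos_orb_def close_def pt_def C_def split: if_splits)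
  qed
  obtain k0 where k0: "0 \<le> k0" "k0 \<in> has00 w" using has00_forward[OF b w *] by blast
  obtain k1 where k1: "k1 < 0" "k1 \<in> has00 w" using has00_backward[OF b w *] by blast
  have e3: "0 < e / 3" using e by simp
  obtain N where N: "\<And>u v p q. orb b w (- int N) (int N) u v \<Longrightarrow> orb b w (- int N) (int N) p q \<Longrightarrow>
     \<bar>u 0 - p 0\<bar> \<le> e / 3 \<and> \<bar>v 0 - q 0\<bar> \<le> e / 3"
    using orb_contraction[OF b w k0 k1 e3] by blast
  show ?thesis
  proof (rule that[of N])
    fix u v assume o: "pos_orb b w (- int N) (int N) u v"
    obtain u' v' where o': "pos_orb b w (- int N) (int N) u' v'" and c: "close (e / 3) (pt (w 0) (u' 0) (v' 0)) p"
      using p e3 unfolding near_def by blast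
    have "\<bar>u 0 - u' 0\<bar> \<le> e / 3 \<and> \<bar>v 0 - v' 0\<bar> \<le> e / 3"
      using N o o' unfolding pos_orb_def by blast
    then have "close (e / 3 + e / 3) (pt (w 0) (u 0) (v 0)) (pt (w 0) (u' 0) (v' 0))"
      unfolding close_pt using e3 by linarith
    from close_trans[OF this c] show "close e (pt (w 0) (u 0) (v 0)) p" by simp
  qed
qed

lemma near_unique:
  assumes b: "0 < b" and w: "no11 w" and p: "near b w p" and q: "near b w q"
  shows "p = q"
proof (rule ccontr)
  assume "p \<noteq> q"
  define d where "d = max \<bar>fst p - fst q\<bar> \<bar>snd p - snd q\<bar>"
  have d: "0 < d / 2" using \<open>p \<noteq> q\<close> by (auto simp: d_def prod_eq_iff less_max_iff_disj)
  obtain N where N: "\<And>u v. pos_orb b w (- int N) (int N) u v \<Longrightarrow> close (d / 2) (pt (w 0) (u 0) (v 0)) p"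
    using near_contraction[OF b w p d] by blast
  obtain u v where o: "pos_orb b w (- int N) (int N) u v" and c: "close (d / 2) (pt (w 0) (u 0) (v 0)) q"
    using q d unfolding near_def by blast
  have "close (d / 2 + d / 2) p q" using close_trans[OF _ c] N[OF o] close_sym by blast
  then show False by (auto simp: close_def d_def)
qed

lemma near_imp_word_eq:
  assumes b: "0 < b" and w: "\<And>k. w k \<in> {0, 1}" "\<And>k. w' k \<in> {0, 1}" and p: "near b w p" "near b w' p"
  shows "w = w'"
proof -
  have seq: "\<exists>u v. (\<forall>n::nat. orb b w (- int n) (int n) (u n) (v n)) \<and>
      (\<lambda>n. u n 0) \<longlonglongrightarrow> (if w 0 = 0 then fst p - 1 else - fst p) \<and>
      (\<lambda>n. v n 0) \<longlonglongrightarrow> (if w 0 = 0 then - 1 - snd p else snd p)" if "near b w p" for w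
  proof -
    have "\<forall>n::nat. \<exists>u v. pos_orb b w (- int n) (int n) u v \<and> close (inverse (real (Suc n))) (pt (w 0) (u 0) (v 0)) p"
      using that unfolding near_def by simp
    then obtain u v where o: "\<And>n. pos_orb b w (- int n) (int n) (u n) (v n)"
      and c: "\<And>n. close (inverse (real (Suc n))) (pt (w 0) (u n 0) (v n 0)) p" by metis
    have lim: "f \<longlonglongrightarrow> l" if "\<And>n. \<bar>f n - l\<bar> < inverse (real (Suc n))" for f :: "nat \<Rightarrow> real" and l
    proof -
      have "(\<lambda>n. f n - l) \<longlonglongrightarrow> 0"
        by (rule Lim_null_comparison[OF _ LIMSEQ_inverse_real_of_nat])
          (use that in \<open>auto intro!: always_eventually less_imp_le\<close>)
      then show ?thesis by (simp add: LIM_zero_iff)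
    qed
    have "(\<lambda>n. u n 0) \<longlonglongrightarrow> (if w 0 = 0 then fst p - 1 else - fst p)"
    proof (rule lim)
      fix n show "\<bar>u n 0 - (if w 0 = 0 then fst p - 1 else - fst p)\<bar> < inverse (real (Suc n))"
        using c[of n] by (cases "w 0 = 0") (simp_all only: close_def pt_def fst_conv snd_conv if_True if_False simp_thms abs_less_iff, linarith+)
    qed
    moreover have "(\<lambda>n. v n 0) \<longlonglongrightarrow> (if w 0 = 0 then - 1 - snd p else snd p)"
    proof (rule lim)
      fix n show "\<bar>v n 0 - (if w 0 = 0 then - 1 - snd p else snd p)\<bar> < inverse (real (Suc n))"
        using c[of n] by (cases "w 0 = 0") (simp_all only: close_def pt_def fst_conv snd_conv if_True if_False simp_thms abs_less_iff, linarith+)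
    qed
    ultimately show ?thesis using o unfolding pos_orb_def by blast
  qed
  from seq[OF p(1)] obtain u v where A: "\<And>n::nat. orb b w (- int n) (int n) (u n) (v n)"
    "(\<lambda>n. u n 0) \<longlonglongrightarrow> (if w 0 = 0 then fst p - 1 else - fst p)"
    "(\<lambda>n. v n 0) \<longlonglongrightarrow> (if w 0 = 0 then - 1 - snd p else snd p)" by blast
  from seq[OF p(2)] obtain u' v' where B: "\<And>n::nat. orb b w' (- int n) (int n) (u' n) (v' n)"
    "(\<lambda>n. u' n 0) \<longlonglongrightarrow> (if w' 0 = 0 then fst p - 1 else - fst p)"
    "(\<lambda>n. v' n 0) \<longlonglongrightarrow> (if w' 0 = 0 then - 1 - snd p else snd p)" by blast
  \<comment> \<open>In the limit a state 0 at time 0 requires x >= 1 and a state 1 requires x <= 0;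
    this fixes the letter at time 0.\<close>
  have ge: "0 \<le> (if w 0 = 0 then fst p - 1 else - fst p)"
    by (rule LIMSEQ_le_const[OF A(2)]) (use orbD(1)[OF A(1), of _ 0] in auto)
  have ge': "0 \<le> (if w' 0 = 0 then fst p - 1 else - fst p)"
    by (rule LIMSEQ_le_const[OF B(2)]) (use orbD(1)[OF B(1), of _ 0] in auto)
  have w0: "w 0 = w' 0" using ge ge' w(1)[of 0] w(2)[of 0] by (auto split: if_splits)
  show ?thesis
    by (rule words_agree[OF b w w0 A(1) B(1) A(2,3) B(2,3)[folded w0]])
qed

lemma near_of_pos_orb:
  assumes "\<And>k l. pos_orb b w k l u v"
  shows "near b w (pt (w 0) (u 0) (v 0))"
  unfolding near_def close_def using assms by (intro allI impI exI[of _ u] exI[of _ v]) simp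

text \<open>Two different saddles are produced so that at least one differs from p; this yields
  accumulation as well as density.\<close>

lemma saddle_near:
  assumes a: "a < - 1" "b = - 1 - a" and w: "no11 w" "\<And>k. w k \<in> {0, 1}" and p: "near b w p" and e: "0 < e"
  obtains q q' where "saddle_periodic a q" "saddle_periodic a q'" "q \<noteq> q'" "close e q p" "close e q' p"
proof -
  have b: "0 < b" using a by simp
  obtain N where N: "\<And>u v. pos_orb b w (- int N) (int N) u v \<Longrightarrow> close e (pt (w 0) (u 0) (v 0)) p"
    using near_contraction[OF b w(1) p e] by blast
  have ex: "\<exists>q W. saddle_periodic a q \<and> close e q p \<and> near b W q \<and> (\<forall>k. W k \<in> {0, 1}) \<and> W (int N + 2) = x"
    if x: "x \<in> {0, 1}" for x
  proof -
    \<comment> \<open>The window of w is continued by zeros, except for a free letter x at N + 2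
      that has zeros on both sides. The zeros further out supply the blocks 00 needed at the two
      ends, and the two values of x give different words and hence different points.\<close>
    define w' where "w' k = (if \<bar>k\<bar> \<le> int N then w k else if k = int N + 2 then x else 0)" for k
    have w': "w' k \<in> {0, 1}" for k using w(2)[of k] x by (auto simp: w'_def)
    have "no11 w'"
      unfolding no11_def
    proof (intro allI impI)
      fix k assume k: "w' k \<noteq> 0"
      show "w' (k + 1) = 0"
      proof (cases "\<bar>k\<bar> \<le> int N")
        case True
        then have "w (k + 1) = 0" using k w(1) unfolding no11_def w'_def by auto
        then show ?thesis using True by (auto simp: w'_def)
      next
        case False
        then have "k = int N + 2" using k by (auto simp: w'_def split: if_splits)
        then show ?thesis by (simp add: w'_def)
      qed
    qed
    then have n11: "no11 w'" .
    have "- int N - 3 < int N + 5" "w' (- int N - 3) = 0" "w' (- int N - 3 + 1) = 0"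
      "w' (int N + 5 - 1) = 0" "w' (int N + 5) = 0" by (auto simp: w'_def)
    from exists_periodic_orb[where w = w', OF b n11 w' this]
    obtain W u v M where W: "1 \<le> M" "no11 W" "\<forall>k. W k \<in> {0, 1}"
      "\<forall>k\<in>{- int N - 3..int N + 5}. W k = w' k"
      "\<forall>k l. pos_orb b W k l u v" "W (int M) = W 0" "u (int M) = u 0" "v (int M) = v 0"
      by (elim exE conjE)
    have W4: "W k = w' k" if "- int N - 3 \<le> k" "k \<le> int N + 5" for k using W(4) that by simp
    note W5 = W(5)[rule_format]
    have Ww: "w k = W k" if "- int N \<le> k" "k \<le> int N" for k
      using W4[of k] that by (simp add: w'_def abs_le_iff)
    have "pos_orb b w (- int N) (int N) u v"
      by (rule pos_orb_cong[OF W5]) (rule Ww)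
    from N[OF this] have "close e (pt (W 0) (u 0) (v 0)) p" using Ww[of 0] by simp
    moreover have "saddle_periodic a (pt (W 0) (u 0) (v 0))"
      by (rule closed_pos_orb_saddle[OF a W(1) W5 W(6-8)])
    moreover have "near b W (pt (W 0) (u 0) (v 0))" by (rule near_of_pos_orb[OF W5])
    moreover have "W (int N + 2) = x" using W4[of "int N + 2"] by (simp add: w'_def)
    ultimately show ?thesis using W(3) by (intro exI conjI) assumption+
  qed
  obtain q W where q: "saddle_periodic a q" "close e q p" "near b W q" "\<forall>k. W k \<in> {0, 1}" "W (int N + 2) = 0"
    using ex[of 0] by auto
  obtain q' W' where q': "saddle_periodic a q'" "close e q' p" "near b W' q'" "\<forall>k. W' k \<in> {0, 1}" "W' (int N + 2) = 1"
    using ex[of 1] by auto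
  have "q \<noteq> q'"
  proof
    assume "q = q'"
    then have "W = W'" using near_imp_word_eq[OF b q(4)[rule_format] q'(4)[rule_format] q(3)] q'(3) by simp
    then show False using q(5) q'(5) by simp
  qed
  then show ?thesis using that[OF q(1) q'(1) _ q(2) q'(2)] by simp
qed

subsection \<open>Topology of the invariant set\<close>

text \<open>Sequential compactness of the space of two-sided binary words, by a diagonal argument
  over an enumeration of the integers.\<close>

lemma binary_words_subseq:
  fixes w :: "nat \<Rightarrow> int \<Rightarrow> nat"
  assumes w: "\<And>n k. w n k \<in> {0, 1}"
  obtains r :: "nat \<Rightarrow> nat" and l where "strict_mono r" "\<And>k. \<forall>\<^sub>F n in sequentially. w (r n) k = l k"
proof -
  define P where "P m s \<longleftrightarrow> (\<exists>c. \<forall>n. w (s n) (from_nat m) = c)" for m and s :: "nat \<Rightarrow> nat"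
  interpret subseqs P
  proof
    fix m and s :: "nat \<Rightarrow> nat"
    have "range (\<lambda>n. w (s n) (from_nat m)) \<subseteq> {0, 1}" by (rule image_subsetI) (rule w)
    then have "finite (range (\<lambda>n. w (s n) (from_nat m)))" using finite_subset by blast
    then obtain i where i: "infinite {j. w (s j) (from_nat m) = w (s i) (from_nat m)}"
      using pigeonhole_infinite[of "UNIV :: nat set" "\<lambda>n. w (s n) (from_nat m)"] by auto
    define r' where "r' = enumerate {j. w (s j) (from_nat m) = w (s i) (from_nat m)}"
    have "strict_mono r'" unfolding r'_def by (rule strict_mono_enumerate[OF i])
    moreover have "w (s (r' n)) (from_nat m) = w (s i) (from_nat m)" for n
      using enumerate_in_set[OF i, of n] by (simp add: r'_def)
    ultimately show "\<exists>r'. strict_mono r' \<and> P m (s \<circ> r')" unfolding P_def by auto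
  qed
  have "\<exists>c. \<forall>n. w (diagseq (Suc m + n)) (from_nat m) = c" for m
  proof -
    have "P m (diagseq \<circ> ((+) (Suc m)))" by (rule diagseq_holds) (auto simp: P_def)
    then show ?thesis by (simp add: P_def)
  qed
  then obtain c where c: "\<And>m n. w (diagseq (Suc m + n)) (from_nat m) = c m" by metis
  show ?thesis
  proof (rule that[of diagseq "\<lambda>k. c (to_nat k)"])
    show "strict_mono diagseq" by (rule subseq_diagseq)
    fix k :: int
    show "\<forall>\<^sub>F n in sequentially. w (diagseq n) k = c (to_nat k)"
    proof (rule eventually_sequentiallyI)
      fix n assume "Suc (to_nat k) \<le> n"
      then show "w (diagseq n) k = c (to_nat k)"
        using c[of "to_nat k" "n - Suc (to_nat k)"] by simp
    qed
  qed
qed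

lemma no11_iff_Sig: "w \<in> Sig \<longleftrightarrow> no11 w \<and> (\<forall>k. w k \<in> {0, 1})"
proof
  assume w: "w \<in> Sig"
  have "w (k + 1) = 0" if "w k \<noteq> 0" for k
  proof -
    have "w k \<in> {0, 1}" "w (k + 1) \<in> {0, 1}" "\<not> (w k = 1 \<and> w (k + 1) = 1)" using w unfolding Sig_def by blast+
    then show ?thesis using that by simp
  qed
  then show "no11 w \<and> (\<forall>k. w k \<in> {0, 1})" using w unfolding Sig_def no11_def by blast
next
  assume w: "no11 w \<and> (\<forall>k. w k \<in> {0, 1})"
  have "\<not> (w k = 1 \<and> w (k + 1) = 1)" for k
    using w[unfolded no11_def, THEN conjunct1, rule_format, of k] by auto
  then show "w \<in> Sig" using w unfolding Sig_def by blast
qed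

text \<open>The limit word comes from compactness of the space of words. As \<open>near\<close>
  tests finite windows, on which the words of the subsequence eventually equal the limit word, their
  orbits can be reused. Fixing one letter prepares the splitting into closed pieces.\<close>

lemma closed_near:
  "closed {p. \<exists>w\<in>Sig. w k = c \<and> near b w p}"
  unfolding closed_sequential_limits
proof (intro allI impI)
  fix p l
  assume h: "(\<forall>n. p n \<in> {p. \<exists>w\<in>Sig. w k = c \<and> near b w p}) \<and> p \<longlonglongrightarrow> l"
  then have "\<forall>n. \<exists>w. w \<in> Sig \<and> w k = c \<and> near b w (p n)" by blast
  from choice[OF this] obtain w where w: "\<And>n. w n \<in> Sig" "\<And>n. w n k = c" "\<And>n. near b (w n) (p n)" by blast
  have w01: "w n k \<in> {0, 1}" for n k using w(1)[of n] unfolding Sig_def by simp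
  obtain r w' where r: "strict_mono r" "\<And>k. \<forall>\<^sub>F n in sequentially. w (r n) k = w' k"
    using binary_words_subseq[of w] w01 by blast
  have fin: "\<forall>\<^sub>F n in sequentially. \<forall>k\<in>K. w (r n) k = w' k" if "finite K" for K
    using that r(2) by (intro eventually_ball_finite) auto
  have ex: "\<exists>n. \<forall>k\<in>K. w (r n) k = w' k" if "finite K" for K
    using fin[OF that] by (auto simp: eventually_sequentially)
  have "w' \<in> Sig"
    unfolding no11_iff_Sig
  proof (intro conjI allI)
    show "w' k \<in> {0, 1}" for k using ex[of "{k}"] w01 by (metis finite.emptyI finite_insert singletonI)
    show "no11 w'"
      unfolding no11_def
    proof (intro allI impI)
      fix k assume k: "w' k \<noteq> 0"
      obtain n where "w (r n) k = w' k" "w (r n) (k + 1) = w' (k + 1)" using ex[of "{k, k + 1}"] by auto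
      then show "w' (k + 1) = 0" using w(1)[of "r n"] k unfolding no11_iff_Sig no11_def by metis
    qed
  qed
  moreover have "w' k = c" using ex[of "{k}"] w(2) by auto
  moreover have "near b w' l"
    unfolding near_def
  proof (intro allI impI)
    fix n :: nat and e :: real assume e: "0 < e"
    have "(\<lambda>m. p (r m)) \<longlonglongrightarrow> l" using h LIMSEQ_subseq_LIMSEQ[OF _ r(1)] by (auto simp: o_def)
    then have lim: "(\<lambda>m. fst (p (r m))) \<longlonglongrightarrow> fst l" "(\<lambda>m. snd (p (r m))) \<longlonglongrightarrow> snd l"
      by (rule tendsto_fst, rule tendsto_snd)
    have "\<forall>\<^sub>F m in sequentially. dist (fst (p (r m))) (fst l) < e / 2"
      "\<forall>\<^sub>F m in sequentially. dist (snd (p (r m))) (snd l) < e / 2"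
      using tendstoD[OF lim(1), of "e / 2"] tendstoD[OF lim(2), of "e / 2"] e by auto
    then have "\<forall>\<^sub>F m in sequentially. close (e / 2) (p (r m)) l"
      by eventually_elim (simp add: close_def dist_real_def)
    moreover have "\<forall>\<^sub>F m in sequentially. \<forall>k\<in>{- int n..int n}. w (r m) k = w' k" by (rule fin) simp
    ultimately have "\<forall>\<^sub>F m in sequentially. close (e / 2) (p (r m)) l \<and> (\<forall>k\<in>{- int n..int n}. w (r m) k = w' k)"
      by (rule eventually_conj)
    then obtain m where m: "close (e / 2) (p (r m)) l" "\<forall>k\<in>{- int n..int n}. w (r m) k = w' k"
      by (auto simp: eventually_sequentially)
    have "0 < e / 2" using e by simp
    then obtain u v where o: "pos_orb b (w (r m)) (- int n) (int n) u v"
      and c: "close (e / 2) (pt (w (r m) 0) (u 0) (v 0)) (p (r m))"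
      using w(3)[of "r m"] unfolding near_def by blast
    have "pos_orb b w' (- int n) (int n) u v" by (rule pos_orb_cong[OF o]) (use m(2) in simp)
    moreover have "close e (pt (w' 0) (u 0) (v 0)) l"
      using close_trans[OF c m(1)] m(2) by simp
    ultimately show "\<exists>u v. pos_orb b w' (- int n) (int n) u v \<and> close e (pt (w' 0) (u 0) (v 0)) l" by blast
  qed
  ultimately show "l \<in> {p. \<exists>w\<in>Sig. w k = c \<and> near b w p}" by blast
qed

lemma dist_le_close: "close (e / 2) p q \<Longrightarrow> dist p q < e"
proof -
  assume c: "close (e / 2) p q"
  have "dist p q \<le> \<bar>fst p - fst q\<bar> + \<bar>snd p - snd q\<bar>"
    unfolding dist_prod_def dist_real_def by (rule sqrt_sum_squares_le_sum_abs[of "\<bar>_\<bar>" "\<bar>_\<bar>", unfolded abs_abs])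
  also have "\<dots> < e" using c unfolding close_def by linarith
  finally show ?thesis .
qed

theorem corollary8p2:
  fixes a :: real
  assumes "a < -1"
  shows "{p. saddle_periodic a p} \<subseteq> Omega_plane a
       \<and> Omega_plane a \<subseteq> closure {p. saddle_periodic a p}
       \<and> totally_disconnected (Omega_plane a)
       \<and> perfect (Omega_plane a)"
proof -
  define b where "b = - 1 - a"
  have b: "0 < b" using assms by (simp add: b_def)
  have Omega: "Omega_plane a = {p. \<exists>w\<in>Sig. near b w p}"
    by (simp add: Omega_plane_def Omega_def vimage_def Rword_iff_near[OF assms b_def])
  \<comment> \<open>Cylinder sets: for each k the two letters split the invariant set into two
    closed pieces.\<close>
  define H where "H k c = {p. \<exists>w\<in>Sig. w k = c \<and> near b w p}" for k c
  have split: "Omega_plane a = H k 0 \<union> H k 1" for k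
    unfolding Omega H_def by (auto simp: Sig_def)
  have closedH: "closed (H k c)" for k c unfolding H_def by (rule closed_near)
  have sub: "{p. saddle_periodic a p} \<subseteq> Omega_plane a"
    using periodic_in_Omega_plane[OF assms] unfolding saddle_periodic_def by blast
  have dense: "\<exists>q q'. saddle_periodic a q \<and> saddle_periodic a q' \<and> q \<noteq> q' \<and> dist q p < e \<and> dist q' p < e"
    if p: "p \<in> Omega_plane a" and e: "0 < e" for p e
  proof -
    obtain w where w: "w \<in> Sig" "near b w p" using p unfolding Omega by blast
    have e2: "0 < e / 2" using e by simp
    have w': "no11 w" "\<And>k. w k \<in> {0, 1}" using w(1) unfolding no11_iff_Sig by auto
    obtain q q' where "saddle_periodic a q" "saddle_periodic a q'" "q \<noteq> q'" "close (e / 2) q p" "close (e / 2) q' p"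
      by (rule saddle_near[OF assms b_def w' w(2) e2])
    then show ?thesis using dist_le_close by blast
  qed
  have "Omega_plane a \<subseteq> closure {p. saddle_periodic a p}"
  proof
    fix p assume "p \<in> Omega_plane a"
    then show "p \<in> closure {p. saddle_periodic a p}"
      unfolding closure_approachable using dense by blast
  qed
  moreover have "totally_disconnected (Omega_plane a)"
    unfolding totally_disconnected_def
  proof (intro allI impI)
    fix T assume T: "T \<subseteq> Omega_plane a \<and> connected T"
    have "p = q" if pq: "p \<in> T" "q \<in> T" for p q
    proof -
      obtain w where w: "w \<in> Sig" "near b w p" using T pq unfolding Omega by blast
      obtain w' where w': "w' \<in> Sig" "near b w' q" using T pq unfolding Omega by blast
      have "w k = w' k" for k
      proof -
        \<comment> \<open>A point has only one word, so the pieces are disjoint and a connected set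
          lies in one of them for every k. All its points then share one word, which belongs to a
          single finite point.\<close>
        have disj: "H k 0 \<inter> H k 1 \<inter> T = {}"
        proof -
          have "w1 = w2" if "w1 \<in> Sig" "w2 \<in> Sig" "near b w1 z" "near b w2 z" for w1 w2 z
            using that near_imp_word_eq[OF b _ _ that(3,4)] unfolding no11_iff_Sig by blast
          then show ?thesis unfolding H_def by fastforce
        qed
        have "H k 0 \<inter> T = {} \<or> H k 1 \<inter> T = {}"
          using connected_closedD[OF _ disj _ closedH closedH] T split[of k] by blast
        moreover have "w k \<in> {0, 1}" "w' k \<in> {0, 1}" using w(1) w'(1) unfolding Sig_def by auto
        moreover have "p \<in> H k (w k)" "q \<in> H k (w' k)" using w w' unfolding H_def by auto
        ultimately show ?thesis using pq by (metis disjoint_iff insertE singletonD)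
      qed
      then have "w = w'" by blast
      then show ?thesis using near_unique[OF b _ w(2)] w(1) w'(2) unfolding no11_iff_Sig by blast
    qed
    then show "\<exists>x. T \<subseteq> {x}" by blast
  qed
  moreover have "perfect (Omega_plane a)"
    unfolding perfect_def
  proof (intro conjI ballI)
    show "closed (Omega_plane a)" unfolding split[of 0] by (intro closed_Un closedH)
    fix p assume p: "p \<in> Omega_plane a"
    show "p islimpt Omega_plane a"
      unfolding islimpt_approachable
    proof (intro allI impI)
      fix e :: real assume "0 < e"
      then obtain q q' where "saddle_periodic a q" "saddle_periodic a q'" "q \<noteq> q'" "dist q p < e" "dist q' p < e"
        using dense[OF p] by blast
      moreover from this have "q \<in> Omega_plane a" "q' \<in> Omega_plane a" using sub by auto
      ultimately show "\<exists>x'\<in>Omega_plane a. x' \<noteq> p \<and> dist x' p < e" by (cases "q = p") auto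
    qed
  qed
  ultimately show ?thesis using sub by blast
qed

end
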